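(* Consider the system $$w_t(t,x)=\bar pw_{xx}(t,x)+\theta_1(t,x)K(x,y(t))+\delta(t,x),\quad w(t,0)=w(t,1)=0,$$ $$\dot y(t)=b(t)u(t)+\theta_2(t)L(w[t],y(t))+d(t),$$ with $x\in[0,1]$, in closed loop with $$u=-(\kappa+\exp(z))^7\left(P_1(y)+P_2(y)y^2+P_3(y)y^6\right)y,\qquad\dot z=\Gamma\exp(-z)\left(\tfrac12y^2-\varepsilon\right)^+,$$ where all objects are as described in the context. Suppose that for all $x\in[0,1]$, $y\in\mathbb{R}$ and $w\in H^2(0,1)\cap H_0^1(0,1)$ $$|L(w,y)|\le\|w\|+\phi(y)|y|,\qquad|K(x,y)|\le|y|.$$ Let $\varepsilon,\Gamma,\kappa,a,C>0$ be constants with $2\kappa>a$. Then every solution $(w,y,z)$ of the closed-loop system, where $w\in C^0(\mathbb{R}_+;L^2(0,1))$ with $t\mapsto\|w[t]\|^2$ locally absolutely continuous on $\mathbb{R}_+$ and $w\in L^1((0,T);H^2(0,1)\cap H_0^1(0,1))$ for each $T>0$, $z\in C^1(\mathbb{R}_+)$, and $y\in C^0(\mathbb{R}_+)$ is locally absolutely continuous, that corresponds to some $d\in L^\infty(\mathbb{R}_+)$, $\theta_1\in L^\infty(\mathbb{R}_+;L^2(0,1))$, $\theta_2\in L^\infty(\mathbb{R}_+)$, $\delta\in L^\infty(\mathbb{R}_+;L^2(0,1))$, $b\in L^\infty(\mathbb{R}_+;(0,+\infty))$ with $\inf_{t\ge0}(b(t))>0$ (i.e., for which the closed-loop equations hold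 for almost every $t\ge0$), satisfies for all $t\ge0$: $$2k_1\|w[t]\|^2+|y(t)|^2\le\exp(-\mu t)\left(2k_2\|w[0]\|^2+|y(0)|^2\right)+2\mu^{-1}Z,$$ $$z(0)\le z(t)\le\ln\left(\exp(z(0))+\frac{\Gamma}{4C}|y(0)|^2+aB\,\frac{2C(1+\exp(z(0)))+\varepsilon\Gamma}{4C^2\varepsilon\min(1,\kappa)(1+\exp(z(0)))}\right),$$ $$\limsup_{t\to+\infty}\|w[t]\|\le\sqrt{\frac{k_2}{k_1}\left(2\varepsilon R^2\Big(\limsup_{t\to+\infty}\|\theta_1[t]\|\Big)^2+G\Big(\limsup_{t\to+\infty}\|\delta[t]\|\Big)^2\right)},\qquad\limsup_{t\to+\infty}|y(t)|\le\sqrt{2\varepsilon},$$ where $$k_1=k_2=\frac{1}{2\bar p},\quad R=\frac1{\bar p},\quad G=\frac{1}{\bar p^2(4\pi^2-5)},\quad\mu=\min\left(\frac{2\kappa-a}{2\kappa k_2},2C\right),$$ $$Z=G\|\delta\|_\infty^2+\frac{a}{\kappa+\exp(z(0))}\left(\|d\|_\infty^2+g(\|\theta_2\|_\infty,z(0))+g^2(\|\theta_2\|_\infty,z(0))+4\beta\,g(1/\beta,z(0))+g^2(R\|\theta_1\|_\infty,z(0))\right),$$ $$B=\frac{1}{2k_1}\left(k_2\|w[0]\|^2+\frac12|y(0)|^2+\mu^{-1}Z\right)+g(\|\theta_2\|_\infty,z(0))+\|d\|_\infty^2+g^2(\|\theta_2\|_\infty,z(0))+2\beta\,g(1/\beta,z(0)),$$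 with $\beta=\inf_{s\ge0}(b(s))$ and $g(s,l)=\left((s-\kappa-\exp(l))^+\right)^2$. Finally, if $\lim_{t\to+\infty}d(t)=0$, $\lim_{t\to+\infty}\delta[t]=0$ and $\liminf_{t\to+\infty}b(t)\ge1/\kappa$, then one of the following holds: either $\lim_{t\to+\infty}|y(t)|=\lim_{t\to+\infty}\|w[t]\|=0$, or $$\kappa+\exp\Big(\lim_{s\to+\infty}z(s)\Big)<\limsup_{t\to+\infty}\Big(\max\big(\bar p^{-1}\|\theta_1[t]\|,|\theta_2(t)|\big)\Big).$$
   Context: Notation: $\mathbb{R}_+=[0,+\infty)$; $s^+=\max(s,0)$; $\|\cdot\|$ is the norm of $L^2(0,1)$; $\|\cdot\|_\infty$ is the essential supremum over $\mathbb{R}_+$ of the norm (absolute value or $L^2(0,1)$ norm) of the function; $w[t]$ denotes the profile $x\mapsto w(t,x)$, and $w_t$ is the derivative of $t\mapsto w[t]$ as an $L^2(0,1)$-valued map. Setting: $y(t)\in\mathbb{R}$ and $w[t]\in H^2(0,1)\cap H_0^1(0,1)$ are state components, $u(t)\in\mathbb{R}$ is the control input, $d(t)\in\mathbb{R}$ and $\delta[t]\in L^2(0,1)$ are disturbances, $\theta_1[t]\in L^2(0,1)$, $\theta_2(t)\in\mathbb{R}$, $b(t)>0$ are time-varying parameters, $\bar p>0$ is a constant, $K:[0,1]\times\mathbb{R}\to\mathbb{R}$ is a function, $L:(H^2(0,1)\cap H_0^1(0,1))\times\mathbb{R}\to\mathbb{R}$ is a functional, and $\phi\in C^\infty(\mathbb{R};\mathbb{R}_+)$.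 Controller functions: $P_1,P_2,P_3\in C^\infty(\mathbb{R})$ satisfy for all $y\in\mathbb{R}$ $$P_1(y)\ge\frac{1}{4a\kappa^6}\left(\kappa+4aC+4\kappa^3+4a\kappa\phi(y)+8a\kappa^2\right),$$ $$P_2(y)\ge\frac{1}{4a^3\kappa^5}\left(\frac{1}{16\kappa}\left(\kappa+4aC+4\kappa^3+4a\kappa\phi(y)\right)^2+\kappa^2+a^2\phi^2(y)+4a^2(\kappa^3+1)\right),$$ $$P_3(y)\ge\frac{1}{64a^7\kappa^4}\left(\left(\kappa^2+a^2\phi^2(y)\right)^2+16a^4\right).$$ *)

theory Defs
  imports "HOL-Analysis.Analysis" "HOL-Probability.Essential_Supremum"
begin

section \<open>The Hilbert space of square-integrable functions on the unit interval\<close>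

abbreviation unit_meas :: "real measure"
  where "unit_meas \<equiv> lebesgue_on {0<..<1}"

definition sq_int :: "(real \<Rightarrow> real) \<Rightarrow> bool"
  where "sq_int f \<longleftrightarrow> f \<in> borel_measurable unit_meas \<and> integrable unit_meas (\<lambda>x. (f x)\<^sup>2)"

definition L2_rel :: "(real \<Rightarrow> real) \<Rightarrow> (real \<Rightarrow> real) \<Rightarrow> bool"
  where "L2_rel f g \<longleftrightarrow> sq_int f \<and> sq_int g \<and> (AE x in unit_meas. f x = g x)"

lemma sq_int_mult:
  assumes "sq_int f" "sq_int g"
  shows "integrable unit_meas (\<lambda>x. f x * g x)"
proof (rule Bochner_Integration.integrable_bound)
  show "integrable unit_meas (\<lambda>x. (f x)\<^sup>2 + (g x)\<^sup>2)"
    using assms unfolding sq_int_def by (intro Bochner_Integration.integrable_add) auto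
  show "(\<lambda>x. f x * g x) \<in> borel_measurable unit_meas"
    using assms unfolding sq_int_def by (intro borel_measurable_times) auto
  have "\<bar>a * b\<bar> \<le> a\<^sup>2 + b\<^sup>2" for a b :: real
  proof -
    have "2 * (\<bar>a\<bar> * \<bar>b\<bar>) \<le> a\<^sup>2 + b\<^sup>2"
      using sum_squares_bound[of "\<bar>a\<bar>" "\<bar>b\<bar>"] by simp
    moreover have "0 \<le> \<bar>a\<bar> * \<bar>b\<bar>" by simp
    ultimately show ?thesis unfolding abs_mult by linarith
  qed
  then show "AE x in unit_meas. norm (f x * g x) \<le> norm ((f x)\<^sup>2 + (g x)\<^sup>2)"
    by simp
qed

lemma sq_int_zero: "sq_int (\<lambda>x. 0)"
  by (simp add: sq_int_def)

lemma sq_int_scale: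
  assumes "sq_int f"
  shows "sq_int (\<lambda>x. c * f x)"
  using assms unfolding sq_int_def
  by (auto simp: power_mult_distrib intro!: borel_measurable_times[OF borel_measurable_const])

lemma sq_int_add:
  assumes "sq_int f" "sq_int g"
  shows "sq_int (\<lambda>x. f x + g x)"
proof -
  have "integrable unit_meas (\<lambda>x. (f x)\<^sup>2 + (g x)\<^sup>2 + 2 * (f x * g x))"
    using assms sq_int_mult[OF assms] unfolding sq_int_def
    by (intro Bochner_Integration.integrable_add integrable_mult_right) auto
  moreover have "(\<lambda>x. (f x + g x)\<^sup>2) = (\<lambda>x. (f x)\<^sup>2 + (g x)\<^sup>2 + 2 * (f x * g x))"
    by (simp add: power2_sum mult.assoc)
  ultimately show ?thesis
    using assms unfolding sq_int_def by (auto intro!: borel_measurable_add)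
qed

quotient_type L2 = "real \<Rightarrow> real" / partial: L2_rel
proof (rule part_equivpI)
  show "\<exists>f. L2_rel f f"
    using sq_int_zero unfolding L2_rel_def by blast
  show "symp L2_rel"
    unfolding symp_def L2_rel_def by (auto elim: eventually_mono)
  show "transp L2_rel"
    unfolding transp_def L2_rel_def by (auto elim: eventually_elim2)
qed

instantiation L2 :: real_inner
begin

lift_definition zero_L2 :: L2 is "\<lambda>x. 0"
  by (simp add: L2_rel_def sq_int_zero)

lift_definition plus_L2 :: "L2 \<Rightarrow> L2 \<Rightarrow> L2" is "\<lambda>f g x. f x + g x"
  unfolding L2_rel_def by (auto intro: sq_int_add)

lift_definition scaleR_L2 :: "real \<Rightarrow> L2 \<Rightarrow> L2" is "\<lambda>c f x. c * f x"
  unfolding L2_rel_def by (auto intro: sq_int_scale)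

lift_definition inner_L2 :: "L2 \<Rightarrow> L2 \<Rightarrow> real" is "\<lambda>f g. LINT x|unit_meas. f x * g x"
proof -
  fix f f' g g' :: "real \<Rightarrow> real"
  assume "L2_rel f f'" "L2_rel g g'"
  then show "(LINT x|unit_meas. f x * g x) = (LINT x|unit_meas. f' x * g' x)"
    unfolding L2_rel_def sq_int_def
    by (intro integral_cong_AE borel_measurable_times) auto
qed

definition uminus_L2 :: "L2 \<Rightarrow> L2" where "uminus_L2 f = (-1) *\<^sub>R f"
definition minus_L2 :: "L2 \<Rightarrow> L2 \<Rightarrow> L2" where "minus_L2 f g = f + - g"
definition norm_L2 :: "L2 \<Rightarrow> real" where "norm_L2 f = sqrt (inner f f)"
definition sgn_L2 :: "L2 \<Rightarrow> L2" where "sgn_L2 f = scaleR (inverse (norm f)) f"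
definition dist_L2 :: "L2 \<Rightarrow> L2 \<Rightarrow> real" where "dist_L2 f g = norm (f - g)"
definition uniformity_L2 :: "(L2 \<times> L2) filter"
  where "uniformity_L2 = (INF e\<in>{0<..}. principal {(x, y). dist x y < e})"
definition open_L2 :: "L2 set \<Rightarrow> bool"
  where "open_L2 U \<longleftrightarrow> (\<forall>x\<in>U. \<forall>\<^sub>F (x', y) in uniformity. x' = x \<longrightarrow> y \<in> U)"

instance
proof
  fix a b c :: L2 and r s :: real and U :: "L2 set"
  show "a + b + c = a + (b + c)"
    by transfer (auto simp: L2_rel_def algebra_simps intro!: sq_int_add)
  show "a + b = b + a"
    by transfer (auto simp: L2_rel_def algebra_simps intro!: sq_int_add)
  show "0 + a = a"
    by transfer (auto simp: L2_rel_def)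
  show "- a + a = 0"
    unfolding uminus_L2_def
    by transfer (auto simp: L2_rel_def sq_int_zero)
  show "a - b = a + - b"
    by (rule minus_L2_def)
  show "r *\<^sub>R (a + b) = r *\<^sub>R a + r *\<^sub>R b"
    by transfer (auto simp: L2_rel_def algebra_simps intro!: sq_int_add sq_int_scale)
  show "(r + s) *\<^sub>R a = r *\<^sub>R a + s *\<^sub>R a"
  proof transfer
    fix f :: "real \<Rightarrow> real" and r s :: real
    assume "L2_rel f f"
    then have "sq_int (\<lambda>x. (r + s) * f x)" "sq_int (\<lambda>x. r * f x + s * f x)"
      unfolding L2_rel_def by (auto intro!: sq_int_scale sq_int_add)
    then show "L2_rel (\<lambda>x. (r + s) * f x) (\<lambda>x. r * f x + s * f x)"
      unfolding L2_rel_def by (simp add: distrib_right)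
  qed
  show "r *\<^sub>R s *\<^sub>R a = (r * s) *\<^sub>R a"
  proof transfer
    fix f :: "real \<Rightarrow> real" and r s :: real
    assume "L2_rel f f"
    then have "sq_int (\<lambda>x. r * (s * f x))" "sq_int (\<lambda>x. (r * s) * f x)"
      unfolding L2_rel_def by (auto intro: sq_int_scale)
    then show "L2_rel (\<lambda>x. r * (s * f x)) (\<lambda>x. r * s * f x)"
      unfolding L2_rel_def by (simp add: mult.assoc)
  qed
  show "1 *\<^sub>R a = a"
    by transfer (auto simp: L2_rel_def)
  show "dist a b = norm (a - b)"
    by (rule dist_L2_def)
  show "sgn a = scaleR (inverse (norm a)) a"
    by (rule sgn_L2_def)
  show "uniformity = (INF e\<in>{0<..}. principal {(x, y::L2). dist x y < e})"
    by (rule uniformity_L2_def)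
  show "open U = (\<forall>x\<in>U. \<forall>\<^sub>F (x', y) in uniformity. x' = x \<longrightarrow> y \<in> U)"
    by (rule open_L2_def)
  show "inner a b = inner b a"
    by transfer (simp add: mult.commute)
  show "inner (a + b) c = inner a c + inner b c"
    by transfer (auto simp: L2_rel_def distrib_right sq_int_mult)
  show "inner (r *\<^sub>R a) b = r * inner a b"
    by transfer (simp add: mult.assoc)
  show "0 \<le> inner a a"
    by transfer simp
  show "(inner a a = 0) = (a = 0)"
  proof transfer
    fix f :: "real \<Rightarrow> real"
    assume "L2_rel f f"
    then have f: "sq_int f" by (simp add: L2_rel_def)
    have "((LINT x|unit_meas. f x * f x) = 0) \<longleftrightarrow> (AE x in unit_meas. f x * f x = 0)"
      using sq_int_mult[OF f f] by (intro integral_nonneg_eq_0_iff_AE) auto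
    then show "((LINT x|unit_meas. f x * f x) = 0) = L2_rel f (\<lambda>x. 0)"
      using f by (simp add: L2_rel_def sq_int_zero)
  qed
  show "norm a = sqrt (inner a a)"
    by (rule norm_L2_def)
qed

end

section \<open>Sobolev spaces on the unit interval\<close>

definition C_infinity :: "(real \<Rightarrow> real) \<Rightarrow> bool"
  where "C_infinity f \<longleftrightarrow> (\<forall>n x. ((deriv ^^ n) f) differentiable (at x))"

definition test_function :: "(real \<Rightarrow> real) \<Rightarrow> bool"
  where "test_function \<phi> \<longleftrightarrow>
    C_infinity \<phi> \<and> (\<exists>a b. 0 < a \<and> b < 1 \<and> (\<forall>x. x \<notin> {a..b} \<longrightarrow> \<phi> x = 0))"

definition has_weak_deriv :: "L2 \<Rightarrow> L2 \<Rightarrow> bool"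
  where "has_weak_deriv f g \<longleftrightarrow> (\<forall>\<phi>. test_function \<phi> \<longrightarrow>
    (LINT x|unit_meas. rep_L2 f x * deriv \<phi> x) = - (LINT x|unit_meas. rep_L2 g x * \<phi> x))"

text \<open>The weak derivative is unique as an element of \<^typ>\<open>L2\<close>, so the choice below
  only has an effect on arguments outside of \<open>H1\<close>.\<close>

definition weak_deriv :: "L2 \<Rightarrow> L2"
  where "weak_deriv f = (SOME g. has_weak_deriv f g)"

definition H1 :: "L2 set"
  where "H1 = {f. \<exists>g. has_weak_deriv f g}"

definition H2 :: "L2 set"
  where "H2 = {f \<in> H1. weak_deriv f \<in> H1}"

text \<open>The closure of the test functions in the \<open>H1\<close> norm; this is how the Dirichlet
  conditions at 0 and 1 are expressed.\<close>

definition H10 :: "L2 set"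
  where "H10 = {f \<in> H1. \<exists>\<phi>. (\<forall>n. test_function (\<phi> n)) \<and>
    (\<lambda>n. abs_L2 (\<phi> n)) \<longlonglongrightarrow> f \<and> (\<lambda>n. abs_L2 (deriv (\<phi> n))) \<longlonglongrightarrow> weak_deriv f}"

definition H2_norm :: "L2 \<Rightarrow> real"
  where "H2_norm f =
    sqrt ((norm f)\<^sup>2 + (norm (weak_deriv f))\<^sup>2 + (norm (weak_deriv (weak_deriv f)))\<^sup>2)"

text \<open>Bochner integrability on \<open>(0,T)\<close> of a map with values in the intersection of \<open>H2\<close> and
  \<open>H10\<close>, normed by \<open>H2_norm\<close>: strong measurability together with integrability of the norm.\<close>

definition L1_H2_H10 :: "real \<Rightarrow> (real \<Rightarrow> L2) \<Rightarrow> bool"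
  where "L1_H2_H10 T w \<longleftrightarrow>
    (AE t in lebesgue_on {0<..<T}. w t \<in> H2 \<inter> H10) \<and>
    (\<exists>s. (\<forall>n. simple_function (lebesgue_on {0<..<T}) (s n)) \<and>
      (\<forall>n. \<forall>t\<in>{0<..<T}. s n t \<in> H2 \<inter> H10) \<and>
      (AE t in lebesgue_on {0<..<T}. (\<lambda>n. H2_norm (w t - s n t)) \<longlonglongrightarrow> 0)) \<and>
    integrable (lebesgue_on {0<..<T}) (\<lambda>t. H2_norm (w t))"

section \<open>Functions of time\<close>

definition abs_continuous_on :: "real \<Rightarrow> real \<Rightarrow> (real \<Rightarrow> real) \<Rightarrow> bool"
  where "abs_continuous_on a b f \<longleftrightarrow>
    (\<forall>e>0. \<exists>r>0. \<forall>(n::nat) l u.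
      (\<forall>i<n. a \<le> l i \<and> l i \<le> u i \<and> u i \<le> b) \<and>
      (\<forall>i<n. \<forall>j<n. i \<noteq> j \<longrightarrow> {l i<..<u i} \<inter> {l j<..<u j} = {}) \<and>
      (\<Sum>i<n. u i - l i) < r \<longrightarrow>
      (\<Sum>i<n. \<bar>f (u i) - f (l i)\<bar>) < e)"

definition loc_abs_continuous :: "(real \<Rightarrow> real) \<Rightarrow> bool"
  where "loc_abs_continuous f \<longleftrightarrow> (\<forall>T>0. abs_continuous_on 0 T f)"

definition C1_halfline :: "(real \<Rightarrow> real) \<Rightarrow> bool"
  where "C1_halfline f \<longleftrightarrow> (\<exists>f'. continuous_on {0..} f' \<and>
    (\<forall>t\<ge>0. (f has_real_derivative f' t) (at t within {0..})))"

text \<open>Since \<open>L2\<close> is separable, Borel measurability agrees with strong measurability.\<close>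

definition L_infinity :: "(real \<Rightarrow> 'a::real_normed_vector) \<Rightarrow> bool"
  where "L_infinity f \<longleftrightarrow> f \<in> borel_measurable (lebesgue_on {0..}) \<and>
    esssup (lebesgue_on {0..}) (\<lambda>t. ereal (norm (f t))) < \<infinity>"

definition Linf_norm :: "(real \<Rightarrow> 'a::real_normed_vector) \<Rightarrow> real"
  where "Linf_norm f = real_of_ereal (esssup (lebesgue_on {0..}) (\<lambda>t. ereal (norm (f t))))"

text \<open>The dual of \<^const>\<open>esssup\<close> on the half-line.\<close>

definition essinf_halfline :: "(real \<Rightarrow> real) \<Rightarrow> ereal"
  where "essinf_halfline f = Liminf (ae_filter (lebesgue_on {0..})) (\<lambda>t. ereal (f t))"

text \<open>The inputs are only determined up to null sets. Limits along the following filter are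
  limits for \<open>t\<close> tending to infinity that disregard null sets, and \<^const>\<open>Limsup\<close> and
  \<^const>\<open>Liminf\<close> along it are the essential upper and lower limits.\<close>

definition ess_at_top :: "real filter"
  where "ess_at_top = inf at_top (ae_filter lebesgue)"

lemma eventually_ess_at_top:
  "eventually P ess_at_top \<longleftrightarrow> (\<exists>T. AE t in lebesgue. t \<ge> T \<longrightarrow> P t)"
proof
  assume "eventually P ess_at_top"
  then obtain A B where A: "eventually A at_top" and B: "AE t in lebesgue. B t"
    and P: "\<And>t. A t \<Longrightarrow> B t \<Longrightarrow> P t"
    unfolding ess_at_top_def eventually_inf by auto
  from A obtain T where "\<And>t. t \<ge> T \<Longrightarrow> A t"
    unfolding eventually_at_top_linorder by auto
  with B P have "AE t in lebesgue. t \<ge> T \<longrightarrow> P t"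
    by (auto elim!: eventually_mono)
  then show "\<exists>T. AE t in lebesgue. t \<ge> T \<longrightarrow> P t" ..
next
  assume "\<exists>T. AE t in lebesgue. t \<ge> T \<longrightarrow> P t"
  then obtain T where "AE t in lebesgue. t \<ge> T \<longrightarrow> P t" ..
  then show "eventually P ess_at_top"
    unfolding ess_at_top_def eventually_inf
    by (intro exI[of _ "\<lambda>t. t \<ge> T"] exI[of _ "\<lambda>t. t \<ge> T \<longrightarrow> P t"])
      (auto simp: eventually_ge_at_top)
qed

end

theory Submission
  imports Defs
begin

text \<open>The proof is a Lyapunov argument for \<open>W = \<parallel>w\<parallel>\<^sup>2 / (2 p) + y\<^sup>2 / 2\<close>. The sharp Poincare
  inequality (constant \<open>\<pi>\<^sup>2\<close>) gives the dissipation of the heat equation. In the equation for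
  \<open>y\<close> every term that exceeds what the gain \<open>q = \<kappa> + exp z\<close> can handle is split by Young's
  inequality into \<open>a / q\<close> times the square of an excess (of \<open>\<theta>\<^sub>1\<close>, \<open>\<theta>\<^sub>2\<close> or \<open>1 / b\<close> over
  \<open>q\<close>) and a polynomial in \<open>y\<close>, which the feedback dominates by the choice of \<open>P1\<close>, \<open>P2\<close>,
  \<open>P3\<close>. Hence \<open>W' \<le> Z - \<mu> W\<close>. Since \<open>exp z\<close> grows at the rate \<open>\<Gamma> (y\<^sup>2 / 2 - \<epsilon>)\<^sup>+\<close> and the
  perturbation of \<open>y\<close> decreases like \<open>1 / q\<close>, \<open>z\<close> stays bounded, so that rate is integrable and
  \<open>y\<^sup>2 / 2\<close> is eventually close to \<open>[0, \<epsilon>]\<close>. If the parameters do not exceed the limit of \<open>q\<close>,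
  all excesses tend to zero, and so does \<open>W\<close>.\<close>

section \<open>Absolutely continuous functions\<close>

text \<open>The shape of the feedback comes from a possibly small \<open>b\<close>: a term
  \<open>T\<close> cannot be cancelled by \<open>b q T\<close> alone, but with
  \<open>1 \<le> b (q + h)\<close> Young's inequality shows that
  \<open>b q (T + T^2 / (4 a))\<close> suffices up to a multiple of \<open>h^2 / q\<close>. The
  terms \<open>T\<close> have order at most 3 in \<open>q\<close> and are multiples of
  \<open>y^2\<close> or \<open>y^4\<close>, so their squares reach \<open>q^6\<close> and
  \<open>y^8\<close>. Hence the exponent 7 of the gain and the powers \<open>y^2\<close> and
  \<open>y^6\<close> beside \<open>P2\<close> and \<open>P3\<close>. The obstacle is the coupling
  through \<open>L\<close>, which perturbs \<open>y\<close> by the norm of \<open>w\<close>, a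
  quantity that a large gain does not make small. The derivative of \<open>y^2 / 2\<close> is
  therefore estimated twice. With a Young weight independent of \<open>q\<close> the coupling costs
  the fraction \<open>a / (2 \<kappa>)\<close> of the dissipation of the heat equation, whence
  \<open>2 \<kappa> > a\<close>, and \<open>W\<close> is bounded. With a weight proportional to
  \<open>q\<close> it becomes \<open>a / q\<close> times a multiple of the squared norm of
  \<open>w\<close>, which is bounded by then; only this second form decays with the gain, as the
  bound on \<open>z\<close> demands.\<close>

lemma abs_continuous_on_finite_family:
  assumes f: "abs_continuous_on a b f" and "e > 0"
  shows "\<exists>r>0. \<forall>(q :: 'i set) l u. finite q \<longrightarrow> (\<forall>k\<in>q. a \<le> l k \<and> l k \<le> u k \<and> u k \<le> b) \<longrightarrow>
    (\<forall>k\<in>q. \<forall>k'\<in>q. k \<noteq> k' \<longrightarrow> {l k<..<u k} \<inter> {l k'<..<u k'} = {}) \<longrightarrow>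
    (\<Sum>k\<in>q. u k - l k) < r \<longrightarrow> (\<Sum>k\<in>q. \<bar>f (u k) - f (l k)\<bar>) < e"
proof -
  from f \<open>e > 0\<close> obtain r where r: "r > 0" and *: "\<forall>(n::nat) l u.
      (\<forall>i<n. a \<le> l i \<and> l i \<le> u i \<and> u i \<le> b) \<and>
      (\<forall>i<n. \<forall>j<n. i \<noteq> j \<longrightarrow> {l i<..<u i} \<inter> {l j<..<u j} = {}) \<and>
      (\<Sum>i<n. u i - l i) < r \<longrightarrow> (\<Sum>i<n. \<bar>f (u i) - f (l i)\<bar>) < e"
    unfolding abs_continuous_on_def by (elim allE[of _ e] impE exE conjE)
  have "(\<Sum>k\<in>q. \<bar>f (u k) - f (l k)\<bar>) < e"
    if q: "finite q" and b: "\<forall>k\<in>q. a \<le> l k \<and> l k \<le> u k \<and> u k \<le> b"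
      and d: "\<forall>k\<in>q. \<forall>k'\<in>q. k \<noteq> k' \<longrightarrow> {l k<..<u k} \<inter> {l k'<..<u k'} = {}"
      and s: "(\<Sum>k\<in>q. u k - l k) < r" for q :: "'i set" and l u
  proof -
    \<comment> \<open>Absolute continuity is defined for intervals numbered by naturals, whereas a
      tagged division is a set of pairs. Renumbering lets the same \<open>r\<close> serve every
      finite index set.\<close>
    obtain h where h: "bij_betw h {..<card q} q"
      using ex_bij_betw_nat_finite[OF q] by (auto simp: atLeast0LessThan)
    have hq: "h i \<in> q" if "i < card q" for i
      using h that by (auto simp: bij_betw_def)
    have "(\<Sum>i<card q. \<bar>f (u (h i)) - f (l (h i))\<bar>) < e"
    proof (rule *[rule_format], intro conjI)
      show "\<forall>i<card q. a \<le> l (h i) \<and> l (h i) \<le> u (h i) \<and> u (h i) \<le> b"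
        using b hq by blast
      show "\<forall>i<card q. \<forall>j<card q. i \<noteq> j \<longrightarrow> {l (h i)<..<u (h i)} \<inter> {l (h j)<..<u (h j)} = {}"
      proof (intro allI impI)
        fix i j assume ij: "i < card q" "j < card q" "i \<noteq> j"
        then have "h i \<noteq> h j" using h by (auto simp: bij_betw_def inj_on_def)
        then show "{l (h i)<..<u (h i)} \<inter> {l (h j)<..<u (h j)} = {}" using d hq ij by blast
      qed
      show "(\<Sum>i<card q. u (h i) - l (h i)) < r"
        using s sum.reindex_bij_betw[OF h, of "\<lambda>k. u k - l k"] by simp
    qed
    then show ?thesis
      using sum.reindex_bij_betw[OF h, of "\<lambda>k. \<bar>f (u k) - f (l k)\<bar>"] by simp
  qed
  with r show ?thesis by blast
qed

text \<open>Cousin's lemma with a gauge that puts the intervals tagged in the null set into an open set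
  of small measure; absolute continuity bounds the increments over those intervals.\<close>

lemma abs_continuous_decreasing:
  assumes "a \<le> b" and f: "abs_continuous_on a b f" and N: "N \<in> null_sets lebesgue"
    and good: "\<And>x e. x \<in> {a..b} \<Longrightarrow> x \<notin> N \<Longrightarrow> e > 0 \<Longrightarrow>
      \<exists>s>0. \<forall>u v. a \<le> u \<and> u \<le> x \<and> x \<le> v \<and> v \<le> b \<and> x - u < s \<and> v - x < s \<longrightarrow> f v - f u \<le> e * (v - u)"
  shows "f b \<le> f a"
proof (rule field_le_epsilon)
  fix e' :: real assume "e' > 0"
  \<comment> \<open>Error budget: \<open>e\<close> for the intervals tagged in \<open>N\<close> and
    \<open>e * (b - a)\<close> for all the others.\<close>
  define e where "e = e' / (1 + (b - a))"
  have e: "e > 0" using \<open>e' > 0\<close> \<open>a \<le> b\<close> by (simp add: e_def)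
  have "e * (1 + (b - a)) = e'" using \<open>a \<le> b\<close> by (simp add: e_def)
  then have e': "e + e * (b - a) = e'" by (simp add: distrib_left)
  obtain r where "r > 0" and r: "\<forall>(q :: (real \<times> real set) set) l u. finite q \<longrightarrow>
      (\<forall>k\<in>q. a \<le> l k \<and> l k \<le> u k \<and> u k \<le> b) \<longrightarrow>
      (\<forall>k\<in>q. \<forall>k'\<in>q. k \<noteq> k' \<longrightarrow> {l k<..<u k} \<inter> {l k'<..<u k'} = {}) \<longrightarrow>
      (\<Sum>k\<in>q. u k - l k) < r \<longrightarrow> (\<Sum>k\<in>q. \<bar>f (u k) - f (l k)\<bar>) < e"
    using abs_continuous_on_finite_family[OF f e] by (elim exE conjE)
  obtain U where U: "open U" "N \<subseteq> U" "U - N \<in> lmeasurable" "emeasure lebesgue (U - N) < ennreal r"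
    using sets_lebesgue_outer_open[OF _ \<open>r > 0\<close>] N by blast
  have U_eq: "(U - N) \<union> N = U" using U by blast
  have "emeasure lebesgue ((U - N) \<union> N) = emeasure lebesgue (U - N)"
    by (rule emeasure_Un_null_set[OF fmeasurableD[OF U(3)] N])
  then have U_em: "emeasure lebesgue U = emeasure lebesgue (U - N)" by (simp only: U_eq)
  have U_meas: "U \<in> lmeasurable"
    using U(1,4) U_em by (intro fmeasurableI) (auto simp: order_less_trans[OF _ ennreal_less_top])
  have U_less: "measure lebesgue U < r"
    using U(4) U_em emeasure_eq_measure2[OF U_meas] by (metis ennreal_less_iff measure_nonneg)
  have "\<forall>x. \<exists>s>0. (x \<in> N \<longrightarrow> ball x s \<subseteq> U) \<and> (x \<in> {a..b} - N \<longrightarrow> (\<forall>u v.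
      a \<le> u \<and> u \<le> x \<and> x \<le> v \<and> v \<le> b \<and> x - u < s \<and> v - x < s \<longrightarrow> f v - f u \<le> e * (v - u)))"
  proof
    fix x
    show "\<exists>s>0. (x \<in> N \<longrightarrow> ball x s \<subseteq> U) \<and> (x \<in> {a..b} - N \<longrightarrow> (\<forall>u v.
      a \<le> u \<and> u \<le> x \<and> x \<le> v \<and> v \<le> b \<and> x - u < s \<and> v - x < s \<longrightarrow> f v - f u \<le> e * (v - u)))"
    proof (cases "x \<in> N")
      case True
      then show ?thesis using U by (auto simp: open_contains_ball subset_iff)
    next
      case False
      show ?thesis
      proof (cases "x \<in> {a..b}")
        case True
        then show ?thesis using good[OF True False e] False by auto
      next
        case no: False
        then show ?thesis using False by (auto intro!: exI[of _ 1])
      qed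
    qed
  qed
  then obtain s where s: "\<And>x. s x > 0" "\<And>x. x \<in> N \<Longrightarrow> ball x (s x) \<subseteq> U"
    "\<And>x u v. x \<in> {a..b} \<Longrightarrow> x \<notin> N \<Longrightarrow> a \<le> u \<Longrightarrow> u \<le> x \<Longrightarrow> x \<le> v \<Longrightarrow> v \<le> b \<Longrightarrow>
      x - u < s x \<Longrightarrow> v - x < s x \<Longrightarrow> f v - f u \<le> e * (v - u)"
    by (metis DiffI)
  have "gauge (\<lambda>x. ball x (s x))"
    using s(1) by (simp add: gauge_def)
  then obtain p where p: "p tagged_division_of {a..b}" and fine: "(\<lambda>x. ball x (s x)) fine p"
    by (rule fine_division_exists_real)
  have fin: "finite p" using p by auto
  define l u where "l = (\<lambda>k::real \<times> real set. Inf (snd k))" and "u = (\<lambda>k::real \<times> real set. Sup (snd k))"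
  have pk: "K = {l (x,K)..u (x,K)} \<and> a \<le> l (x,K) \<and> l (x,K) \<le> x \<and> x \<le> u (x,K) \<and> u (x,K) \<le> b
      \<and> K \<subseteq> ball x (s x)" if "(x, K) \<in> p" for x K
  proof -
    note xK = that
    obtain c d where cd: "K = cbox c d" using tagged_division_ofD(4)[OF p xK] by blast
    have "x \<in> K" "K \<subseteq> {a..b}" using tagged_division_ofD(2,3)[OF p xK] by auto
    moreover have "K \<subseteq> ball x (s x)" using fine that by (auto simp: fine_def)
    moreover have "c \<le> d" using cd \<open>x \<in> K\<close> by auto
    ultimately show ?thesis using cd by (auto simp: l_def u_def)
  qed
  define q where "q = {k \<in> p. fst k \<in> N}"
  have qp: "q \<subseteq> p" and finq: "finite q" using fin by (auto simp: q_def)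
  have tel: "(\<Sum>k\<in>p. h (u k) - h (l k)) = h b - h a" for h :: "real \<Rightarrow> real"
    using additive_tagged_division_1[OF \<open>a \<le> b\<close> p, of h] by (simp add: l_def u_def case_prod_beta)
  \<comment> \<open>\<open>h\<close> is monotone, and over an interval inside \<open>U\<close> it
    grows by exactly the length of that interval. Telescoping it over the whole division bounds the
    total length of the intervals tagged in \<open>N\<close> by the measure of
    \<open>U\<close>.\<close>
  define h where "h = (\<lambda>x. measure lebesgue (U \<inter> {a..x}))"
  have h_mono: "h x \<le> h x'" if "x \<le> x'" for x x'
    unfolding h_def using U_meas that
    by (intro measure_mono_fmeasurable) (auto intro: fmeasurable_Int_fmeasurable fmeasurableD)
  have h_diff: "h x' - h x = x' - x" if "a \<le> x" "x \<le> x'" "{x..x'} \<subseteq> U" for x x'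
  proof -
    have eq: "U \<inter> {a..x'} = (U \<inter> {a..x}) \<union> {x<..x'}" using that by auto
    have Ioc: "{x<..x'} \<in> lmeasurable" using that by (intro fmeasurableI) auto
    have "{x<..x'} - U \<inter> {a..x} = {x<..x'}" by auto
    then have "h x' = h x + measure lebesgue {x<..x'}"
      unfolding h_def eq using U_meas Ioc
      by (subst measure_Un2) (auto intro!: fmeasurable_Int_fmeasurable)
    then show ?thesis using that by simp
  qed
  have "(\<Sum>k\<in>q. u k - l k) = (\<Sum>k\<in>q. h (u k) - h (l k))"
  proof (intro sum.cong refl)
    fix k assume "k \<in> q"
    then obtain x K where k: "k = (x, K)" "(x, K) \<in> p" "x \<in> N" by (cases k) (auto simp: q_def)
    then show "u k - l k = h (u k) - h (l k)"
      using pk[OF k(2)] s(2)[of x] by (subst h_diff) auto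
  qed
  also have "\<dots> \<le> (\<Sum>k\<in>p. h (u k) - h (l k))"
    using fin qp by (intro sum_mono2) (auto dest!: pk intro!: h_mono)
  also have "\<dots> = h b - h a" by (rule tel)
  also have "\<dots> \<le> measure lebesgue U"
  proof -
    have "h b \<le> measure lebesgue U"
      unfolding h_def using U_meas by (intro measure_mono_fmeasurable sets.Int fmeasurableD) auto
    moreover have "h a \<ge> 0" by (simp add: h_def)
    ultimately show ?thesis by linarith
  qed
  also have "\<dots> < r" by (rule U_less)
  finally have "(\<Sum>k\<in>q. \<bar>f (u k) - f (l k)\<bar>) < e"
  proof (intro r[rule_format] finq)
    fix k assume "k \<in> q"
    then show "a \<le> l k \<and> l k \<le> u k \<and> u k \<le> b" using pk[of "fst k" "snd k"] qp by auto
  next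
    fix k k' assume kk: "k \<in> q" "k' \<in> q" "k \<noteq> k'"
    then have "k \<in> p" "k' \<in> p" using qp by auto
    moreover have "interior (snd k) \<inter> interior (snd k') = {}"
      using tagged_division_ofD(5)[OF p, of "fst k" "snd k" "fst k'" "snd k'"] calculation kk(3) by simp
    ultimately show "{l k<..<u k} \<inter> {l k'<..<u k'} = {}"
      using pk[of "fst k" "snd k"] pk[of "fst k'" "snd k'"] interior_atLeastAtMost_real
      by (metis prod.collapse)
  qed
  then have bad: "(\<Sum>k\<in>q. f (u k) - f (l k)) \<le> e"
    using sum_mono[of q "\<lambda>k. f (u k) - f (l k)" "\<lambda>k. \<bar>f (u k) - f (l k)\<bar>"] by force
  have "(\<Sum>k\<in>p - q. f (u k) - f (l k)) \<le> (\<Sum>k\<in>p - q. e * (u k - l k))"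
  proof (rule sum_mono)
    fix k assume "k \<in> p - q"
    then obtain x K where k: "k = (x, K)" "(x, K) \<in> p" "x \<notin> N" by (cases k) (auto simp: q_def)
    note * = pk[OF k(2)]
    have "l k \<in> {l k..u k}" "u k \<in> {l k..u k}" using * unfolding k by auto
    moreover have "{l k..u k} \<subseteq> ball x (s x)" using * unfolding k by metis
    ultimately have "l k \<in> ball x (s x)" "u k \<in> ball x (s x)" by blast+
    then show "f (u k) - f (l k) \<le> e * (u k - l k)"
      using * k by (intro s(3)) (auto simp: dist_real_def)
  qed
  also have "\<dots> \<le> (\<Sum>k\<in>p. e * (u k - l k))"
    using fin e by (intro sum_mono2) (auto dest!: pk)
  also have "\<dots> = e * (b - a)" using tel[of "\<lambda>x. x"] by (simp add: sum_distrib_left[symmetric])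
  finally have "(\<Sum>k\<in>p. f (u k) - f (l k)) \<le> e + e * (b - a)"
    using bad sum.subset_diff[OF qp fin, of "\<lambda>k. f (u k) - f (l k)"] by linarith
  then show "f b \<le> f a + e'" using tel[of f] e' by linarith
qed

text \<open>The straddle argument: for \<open>u \<le> x \<le> v\<close> the linear approximation at
  \<open>x\<close> is applied at both ends and the two estimates are added, which is the local
  condition of \<open>abs_continuous_decreasing\<close> off the exceptional null set.\<close>

lemma abs_continuous_deriv_nonpos:
  assumes "a \<le> b" and f: "abs_continuous_on a b f"
    and deriv: "AE x in lebesgue. x \<in> {a..b} \<longrightarrow>
      (\<exists>D. (f has_real_derivative D) (at x within {a..b}) \<and> D \<le> 0)"
  shows "f b \<le> f a"
proof -
  obtain N where N: "N \<in> null_sets lebesgue" and *: "\<And>x. x \<notin> N \<Longrightarrow> x \<in> {a..b} \<longrightarrow>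
      (\<exists>D. (f has_real_derivative D) (at x within {a..b}) \<and> D \<le> 0)"
    using AE_E3[OF deriv] by auto
  show ?thesis
  proof (rule abs_continuous_decreasing[OF assms(1,2) N])
  fix x e :: real assume x: "x \<in> {a..b}" "x \<notin> N" and e: "e > 0"
  obtain D where D: "(f has_real_derivative D) (at x within {a..b})" "D \<le> 0"
    using *[OF x(2)] x(1) by blast
  from D(1) have "(f has_derivative (\<lambda>h. D * h)) (at x within {a..b})"
    by (simp add: has_field_derivative_def)
  then obtain s where s: "s > 0" and D_lin: "\<And>y. y \<in> {a..b} \<Longrightarrow> \<bar>y - x\<bar> < s \<Longrightarrow>
      \<bar>f y - f x - D * (y - x)\<bar> \<le> e * \<bar>y - x\<bar>"
    using e unfolding has_derivative_within_alt by (auto simp: real_norm_def)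
  have "f v - f u \<le> e * (v - u)"
    if "a \<le> u" "u \<le> x" "x \<le> v" "v \<le> b" "x - u < s" "v - x < s" for u v
  proof -
    have "f v - f x \<le> D * (v - x) + e * (v - x)" using D_lin[of v] that x by auto
    moreover have "f x - f u \<le> D * (x - u) + e * (x - u)" using D_lin[of u] that x 
      by (auto simp: algebra_simps abs_le_iff)
    moreover have "D * (v - x) \<le> 0" "D * (x - u) \<le> 0"
      using D(2) that by (auto intro: mult_nonpos_nonneg)
    ultimately show ?thesis by (auto simp: algebra_simps)
  qed
  then show "\<exists>s>0. \<forall>u v. a \<le> u \<and> u \<le> x \<and> x \<le> v \<and> v \<le> b \<and> x - u < s \<and> v - x < s \<longrightarrow> f v - f u \<le> e * (v - u)"
    using s by blast
qed
qed

section \<open>Closure properties of absolute continuity\<close>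

lemma abs_continuous_on_subset:
  assumes "abs_continuous_on a b f" "a \<le> c" "d \<le> b"
  shows "abs_continuous_on c d f"
  unfolding abs_continuous_on_def
proof (intro allI impI)
  fix e :: real assume "e > 0"
  then obtain r where r: "r > 0" and *: "\<forall>(n::nat) l u.
      (\<forall>i<n. a \<le> l i \<and> l i \<le> u i \<and> u i \<le> b) \<and>
      (\<forall>i<n. \<forall>j<n. i \<noteq> j \<longrightarrow> {l i<..<u i} \<inter> {l j<..<u j} = {}) \<and>
      (\<Sum>i<n. u i - l i) < r \<longrightarrow> (\<Sum>i<n. \<bar>f (u i) - f (l i)\<bar>) < e"
    using assms(1) unfolding abs_continuous_on_def by (elim allE[of _ e] impE exE conjE)
  show "\<exists>r>0. \<forall>(n::nat) l u. (\<forall>i<n. c \<le> l i \<and> l i \<le> u i \<and> u i \<le> d) \<and>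
      (\<forall>i<n. \<forall>j<n. i \<noteq> j \<longrightarrow> {l i<..<u i} \<inter> {l j<..<u j} = {}) \<and>
      (\<Sum>i<n. u i - l i) < r \<longrightarrow> (\<Sum>i<n. \<bar>f (u i) - f (l i)\<bar>) < e"
  proof (intro exI[of _ r] conjI r allI impI)
    fix n :: nat and l u
    assume A: "(\<forall>i<n. c \<le> l i \<and> l i \<le> u i \<and> u i \<le> d) \<and>
      (\<forall>i<n. \<forall>j<n. i \<noteq> j \<longrightarrow> {l i<..<u i} \<inter> {l j<..<u j} = {}) \<and> (\<Sum>i<n. u i - l i) < r"
    show "(\<Sum>i<n. \<bar>f (u i) - f (l i)\<bar>) < e"
      by (rule *[rule_format]) (use A assms(2,3) in \<open>auto intro: order_trans\<close>)
  qed
qed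

text \<open>A single domination principle behind the rules that follow: sums, multiples and products
  are compared with their constituents, Lipschitz functions with the identity.\<close>

lemma abs_continuous_on_dominated:
  assumes f: "abs_continuous_on a b f" and g: "abs_continuous_on a b g"
    and dom: "\<And>u v. a \<le> u \<Longrightarrow> u \<le> v \<Longrightarrow> v \<le> b \<Longrightarrow> \<bar>h v - h u\<bar> \<le> M * (\<bar>f v - f u\<bar> + \<bar>g v - g u\<bar>)"
  shows "abs_continuous_on a b h"
  unfolding abs_continuous_on_def
proof (intro allI impI)
  fix e :: real assume e: "e > 0"
  \<comment> \<open>The sign of \<open>M\<close> is open, and the final strict inequality needs a
    positive factor, hence \<open>\<bar>M\<bar> + 1\<close>; the 2 shares the budget between
    \<open>f\<close> and \<open>g\<close>.\<close>
  define e' where "e' = e / (2 * (\<bar>M\<bar> + 1))"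
  have e': "e' > 0" using e by (simp add: e'_def)
  have e'_sum: "(\<bar>M\<bar> + 1) * (e' + e') = e" by (simp add: e'_def divide_simps)
  obtain r1 where r1: "r1 > 0" and *: "\<forall>(n::nat) l u.
      (\<forall>i<n. a \<le> l i \<and> l i \<le> u i \<and> u i \<le> b) \<and>
      (\<forall>i<n. \<forall>j<n. i \<noteq> j \<longrightarrow> {l i<..<u i} \<inter> {l j<..<u j} = {}) \<and>
      (\<Sum>i<n. u i - l i) < r1 \<longrightarrow> (\<Sum>i<n. \<bar>f (u i) - f (l i)\<bar>) < e'"
    using f e' unfolding abs_continuous_on_def by (elim allE[of _ e'] impE exE conjE)
  obtain r2 where r2: "r2 > 0" and **: "\<forall>(n::nat) l u.
      (\<forall>i<n. a \<le> l i \<and> l i \<le> u i \<and> u i \<le> b) \<and>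
      (\<forall>i<n. \<forall>j<n. i \<noteq> j \<longrightarrow> {l i<..<u i} \<inter> {l j<..<u j} = {}) \<and>
      (\<Sum>i<n. u i - l i) < r2 \<longrightarrow> (\<Sum>i<n. \<bar>g (u i) - g (l i)\<bar>) < e'"
    using g e' unfolding abs_continuous_on_def by (elim allE[of _ e'] impE exE conjE)
  show "\<exists>r>0. \<forall>(n::nat) l u. (\<forall>i<n. a \<le> l i \<and> l i \<le> u i \<and> u i \<le> b) \<and>
      (\<forall>i<n. \<forall>j<n. i \<noteq> j \<longrightarrow> {l i<..<u i} \<inter> {l j<..<u j} = {}) \<and>
      (\<Sum>i<n. u i - l i) < r \<longrightarrow> (\<Sum>i<n. \<bar>h (u i) - h (l i)\<bar>) < e"
  proof (intro exI[of _ "min r1 r2"] conjI allI impI)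
    fix n :: nat and l u
    assume A: "(\<forall>i<n. a \<le> l i \<and> l i \<le> u i \<and> u i \<le> b) \<and>
      (\<forall>i<n. \<forall>j<n. i \<noteq> j \<longrightarrow> {l i<..<u i} \<inter> {l j<..<u j} = {}) \<and> (\<Sum>i<n. u i - l i) < min r1 r2"
    have F: "(\<Sum>i<n. \<bar>f (u i) - f (l i)\<bar>) < e'" by (rule *[rule_format]) (use A in auto)
    have G: "(\<Sum>i<n. \<bar>g (u i) - g (l i)\<bar>) < e'" by (rule **[rule_format]) (use A in auto)
    have "(\<Sum>i<n. \<bar>h (u i) - h (l i)\<bar>)
        \<le> (\<Sum>i<n. (\<bar>M\<bar> + 1) * (\<bar>f (u i) - f (l i)\<bar> + \<bar>g (u i) - g (l i)\<bar>))"
    proof (rule sum_mono)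
      fix i assume "i \<in> {..<n}"
      then have "\<bar>h (u i) - h (l i)\<bar> \<le> M * (\<bar>f (u i) - f (l i)\<bar> + \<bar>g (u i) - g (l i)\<bar>)"
        using A by (intro dom) auto
      also have "\<dots> \<le> (\<bar>M\<bar> + 1) * (\<bar>f (u i) - f (l i)\<bar> + \<bar>g (u i) - g (l i)\<bar>)"
        by (intro mult_right_mono) auto
      finally show "\<bar>h (u i) - h (l i)\<bar> \<le> (\<bar>M\<bar> + 1) * (\<bar>f (u i) - f (l i)\<bar> + \<bar>g (u i) - g (l i)\<bar>)" .
    qed
    also have "\<dots> = (\<bar>M\<bar> + 1) * ((\<Sum>i<n. \<bar>f (u i) - f (l i)\<bar>) + (\<Sum>i<n. \<bar>g (u i) - g (l i)\<bar>))"
      by (simp add: sum.distrib sum_distrib_left[symmetric])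
    also have "\<dots> < (\<bar>M\<bar> + 1) * (e' + e')"
      using F G by (intro mult_strict_left_mono) auto
    finally show "(\<Sum>i<n. \<bar>h (u i) - h (l i)\<bar>) < e" using e'_sum by simp
  qed (use r1 r2 in auto)
qed

lemma abs_continuous_on_ident: "abs_continuous_on a b (\<lambda>x. x)"
  unfolding abs_continuous_on_def
proof (intro allI impI)
  fix e :: real assume "e > 0"
  then show "\<exists>r>0. \<forall>(n::nat) l u. (\<forall>i<n. a \<le> l i \<and> l i \<le> u i \<and> u i \<le> b) \<and>
      (\<forall>i<n. \<forall>j<n. i \<noteq> j \<longrightarrow> {l i<..<u i} \<inter> {l j<..<u j} = {}) \<and>
      (\<Sum>i<n. u i - l i) < r \<longrightarrow> (\<Sum>i<n. \<bar>u i - l i\<bar>) < e"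
    by (intro exI[of _ e]) auto
qed

lemma abs_continuous_on_lipschitz:
  assumes "\<And>u v. a \<le> u \<Longrightarrow> u \<le> v \<Longrightarrow> v \<le> b \<Longrightarrow> \<bar>f v - f u\<bar> \<le> M * (v - u)"
  shows "abs_continuous_on a b f"
proof (rule abs_continuous_on_dominated[OF abs_continuous_on_ident abs_continuous_on_ident])
  fix u v assume uv: "a \<le> u" "u \<le> v" "v \<le> b"
  then have "\<bar>f v - f u\<bar> \<le> M * (v - u)" by (rule assms)
  also have "\<dots> = M / 2 * (\<bar>v - u\<bar> + \<bar>v - u\<bar>)" using uv by simp
  finally show "\<bar>f v - f u\<bar> \<le> M / 2 * (\<bar>v - u\<bar> + \<bar>v - u\<bar>)" .
qed

lemma abs_continuous_on_C1:
  assumes f: "\<And>x. x \<in> {a..b} \<Longrightarrow> (f has_real_derivative f' x) (at x within {a..b})"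
    and f': "continuous_on {a..b} f'"
  shows "abs_continuous_on a b f"
proof -
  have "bounded (f' ` {a..b})"
    by (intro compact_imp_bounded compact_continuous_image f' compact_Icc)
  then obtain M where M: "\<And>x. x \<in> {a..b} \<Longrightarrow> \<bar>f' x\<bar> \<le> M"
    unfolding bounded_iff real_norm_def by blast
  show ?thesis
  proof (rule abs_continuous_on_lipschitz[where M = M])
    fix u v assume "a \<le> u" "u \<le> v" "v \<le> b"
    then show "\<bar>f v - f u\<bar> \<le> M * (v - u)"
      using field_differentiable_bound[OF convex_real_interval(5) f, of M v u] M
      by (auto simp: real_norm_def)
  qed
qed

lemma abs_continuous_on_add:
  assumes "abs_continuous_on a b f" "abs_continuous_on a b g"
  shows "abs_continuous_on a b (\<lambda>x. f x + g x)"
  by (rule abs_continuous_on_dominated[OF assms, where M = 1]) (simp add: abs_if)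

lemma abs_continuous_on_cmult:
  assumes "abs_continuous_on a b f"
  shows "abs_continuous_on a b (\<lambda>x. c * f x)"
proof (rule abs_continuous_on_dominated[OF assms assms, where M = "\<bar>c\<bar>"])
  fix u v
  have "\<bar>c * f v - c * f u\<bar> = \<bar>c\<bar> * \<bar>f v - f u\<bar>"
    by (simp add: abs_mult[symmetric] right_diff_distrib)
  then show "\<bar>c * f v - c * f u\<bar> \<le> \<bar>c\<bar> * (\<bar>f v - f u\<bar> + \<bar>f v - f u\<bar>)"
    by (simp add: mult_left_mono)
qed

lemma abs_continuous_on_mult:
  assumes "abs_continuous_on a b f" "abs_continuous_on a b g"
    and cont: "continuous_on {a..b} f" "continuous_on {a..b} g"
  shows "abs_continuous_on a b (\<lambda>x. f x * g x)"
proof -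
  have "bounded (f ` {a..b})" "bounded (g ` {a..b})"
    by (intro compact_imp_bounded compact_continuous_image cont compact_Icc)+
  then obtain M1 M2 where M: "\<And>x. x \<in> {a..b} \<Longrightarrow> \<bar>f x\<bar> \<le> M1" "\<And>x. x \<in> {a..b} \<Longrightarrow> \<bar>g x\<bar> \<le> M2"
    unfolding bounded_iff real_norm_def by blast
  show ?thesis
  proof (rule abs_continuous_on_dominated[OF assms(1,2), where M = "max M1 M2"])
    fix u v assume uv: "a \<le> u" "u \<le> v" "v \<le> b"
    have "\<bar>f v * g v - f u * g u\<bar> = \<bar>g v * (f v - f u) + f u * (g v - g u)\<bar>"
      by (simp add: algebra_simps)
    also have "\<dots> \<le> \<bar>g v\<bar> * \<bar>f v - f u\<bar> + \<bar>f u\<bar> * \<bar>g v - g u\<bar>"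
      by (metis abs_mult abs_triangle_ineq)
    also have "\<dots> \<le> max M1 M2 * \<bar>f v - f u\<bar> + max M1 M2 * \<bar>g v - g u\<bar>"
      using M(1)[of u] M(2)[of v] uv by (intro add_mono mult_right_mono) auto
    finally show "\<bar>f v * g v - f u * g u\<bar> \<le> max M1 M2 * (\<bar>f v - f u\<bar> + \<bar>g v - g u\<bar>)"
      by (simp add: distrib_left)
  qed
qed

text \<open>\<open>c / m\<close> is the equilibrium of the comparison equation. After subtracting
  it, the integrating factor \<open>exp (m * (x - a))\<close> gives a function with nonpositive
  derivative almost everywhere.\<close>

lemma abs_continuous_gronwall:
  assumes ab: "a \<le> b" and f: "abs_continuous_on a b f" "continuous_on {a..b} f" and m: "m > 0"
    and deriv: "AE x in lebesgue. x \<in> {a..b} \<longrightarrow>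
      (\<exists>D. (f has_real_derivative D) (at x within {a..b}) \<and> D \<le> c - m * f x)"
  shows "f b \<le> exp (- m * (b - a)) * (f a - c / m) + c / m"
proof -
  define F where "F = (\<lambda>x. exp (m * (x - a)) * (f x + - (c / m)))"
  have "F b \<le> F a"
  proof (rule abs_continuous_deriv_nonpos[OF ab])
    show "abs_continuous_on a b F" unfolding F_def
    proof (rule abs_continuous_on_mult)
      show "abs_continuous_on a b (\<lambda>x. exp (m * (x - a)))"
        by (rule abs_continuous_on_C1[where f' = "\<lambda>x. m * exp (m * (x - a))"])
          (auto intro!: derivative_eq_intros continuous_intros)
      show "abs_continuous_on a b (\<lambda>x. f x + - (c / m))"
        by (intro abs_continuous_on_add f abs_continuous_on_lipschitz[where M = 0]) simp
    qed (auto intro!: continuous_intros f)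
    show "AE x in lebesgue. x \<in> {a..b} \<longrightarrow>
      (\<exists>D. (F has_real_derivative D) (at x within {a..b}) \<and> D \<le> 0)"
      using deriv
    proof (eventually_elim, intro impI)
      fix x assume "x \<in> {a..b} \<longrightarrow>
        (\<exists>D. (f has_real_derivative D) (at x within {a..b}) \<and> D \<le> c - m * f x)" "x \<in> {a..b}"
      then obtain D where D: "(f has_real_derivative D) (at x within {a..b})" "D \<le> c - m * f x"
        by blast
      have "(F has_real_derivative exp (m * (x - a)) * (D - (c - m * f x))) (at x within {a..b})"
        unfolding F_def using m D(1)
        by (auto intro!: derivative_eq_intros simp: field_simps)
      moreover have "exp (m * (x - a)) * (D - (c - m * f x)) \<le> 0"
        using D(2) by (intro mult_nonneg_nonpos) auto
      ultimately show "\<exists>D. (F has_real_derivative D) (at x within {a..b}) \<and> D \<le> 0" by blast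
    qed
  qed
  then have "exp (m * (b - a)) * (f b - c / m) \<le> f a - c / m" by (simp add: F_def)
  then have "exp (- (m * (b - a))) * (exp (m * (b - a)) * (f b - c / m))
      \<le> exp (- (m * (b - a))) * (f a - c / m)"
    by (intro mult_left_mono) auto
  then show ?thesis by (simp add: mult.assoc[symmetric] exp_minus)
qed

section \<open>Monotonicity and Gronwall estimates on the half-line\<close>

lemma AE_halfline:
  "(AE t in lebesgue_on {0..}. P t) \<longleftrightarrow> (AE t in lebesgue. 0 \<le> (t::real) \<longrightarrow> P t)"
  by (simp add: AE_restrict_space_iff)

lemma loc_abs_continuousD:
  assumes "loc_abs_continuous f" "0 \<le> s"
  shows "abs_continuous_on s t f"
proof -
  have "abs_continuous_on 0 (max t 1) f" using assms by (simp add: loc_abs_continuous_def)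
  then show ?thesis by (rule abs_continuous_on_subset) (use assms in auto)
qed

lemma loc_abs_continuous_add:
  "loc_abs_continuous f \<Longrightarrow> loc_abs_continuous g \<Longrightarrow> loc_abs_continuous (\<lambda>x. f x + g x)"
  by (simp add: loc_abs_continuous_def abs_continuous_on_add)

lemma loc_abs_continuous_cmult:
  "loc_abs_continuous f \<Longrightarrow> loc_abs_continuous (\<lambda>x. c * f x)"
  by (simp add: loc_abs_continuous_def abs_continuous_on_cmult)

lemma loc_abs_continuous_ident: "loc_abs_continuous (\<lambda>x. x)"
  by (simp add: loc_abs_continuous_def abs_continuous_on_ident)

lemma loc_abs_continuous_mult:
  assumes "loc_abs_continuous f" "loc_abs_continuous g" "continuous_on {0..} f" "continuous_on {0..} g"
  shows "loc_abs_continuous (\<lambda>x. f x * g x)"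
  using assms unfolding loc_abs_continuous_def
  by (auto intro!: abs_continuous_on_mult intro: continuous_on_subset)

lemma loc_abs_continuous_decreasing:
  assumes "loc_abs_continuous f" "0 \<le> s" "s \<le> t"
    and "AE x in lebesgue. s \<le> x \<and> x \<le> t \<longrightarrow>
      (\<exists>D. (f has_real_derivative D) (at x within {0..}) \<and> D \<le> 0)"
  shows "f t \<le> f s"
proof (rule abs_continuous_deriv_nonpos[where f = f and a = s and b = t])
  show "abs_continuous_on s t f" using assms by (intro loc_abs_continuousD)
  show "AE x in lebesgue. x \<in> {s..t} \<longrightarrow>
      (\<exists>D. (f has_real_derivative D) (at x within {s..t}) \<and> D \<le> 0)"
    using assms(4)
  proof eventually_elim
    case (elim x)
    have "{s..t} \<subseteq> {0..}" using assms by auto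
    then show ?case using elim by (meson DERIV_subset atLeastAtMost_iff)
  qed
qed (use assms in auto)

lemma loc_abs_continuous_gronwall:
  assumes "loc_abs_continuous f" "continuous_on {0..} f" "m > 0" "0 \<le> s" "s \<le> t"
    and "AE x in lebesgue. s \<le> x \<and> x \<le> t \<longrightarrow>
      (\<exists>D. (f has_real_derivative D) (at x within {0..}) \<and> D \<le> c - m * f x)"
  shows "f t \<le> exp (- m * (t - s)) * (f s - c / m) + c / m"
proof (rule abs_continuous_gronwall[where f = f and a = s and b = t])
  show "abs_continuous_on s t f" using assms by (intro loc_abs_continuousD)
  show "continuous_on {s..t} f" using assms by (auto intro: continuous_on_subset)
  show "AE x in lebesgue. x \<in> {s..t} \<longrightarrow>
      (\<exists>D. (f has_real_derivative D) (at x within {s..t}) \<and> D \<le> c - m * f x)"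
    using assms(6)
  proof eventually_elim
    case (elim x)
    have "{s..t} \<subseteq> {0..}" using assms by auto
    then show ?case using elim by (meson DERIV_subset atLeastAtMost_iff)
  qed
qed (use assms in auto)

lemma filterlim_shift: "filterlim (\<lambda>t::real. t - c) at_top at_top"
  unfolding filterlim_at_top
proof
  fix Z
  show "\<forall>\<^sub>F t in at_top. Z \<le> t - c" using eventually_ge_at_top[of "Z + c"] by eventually_elim simp
qed

text \<open>The inequality is required only from some time \<open>T\<close> on, because the value
  \<open>f T\<close> is forgotten exponentially. Both the upper limit of the norm of
  \<open>w\<close> and the convergence of \<open>W\<close> to zero rest on this.\<close>

lemma gronwall_eventually_le:
  assumes f: "loc_abs_continuous f" "continuous_on {0..} f" and m: "m > 0" and T: "0 \<le> T"
    and deriv: "AE x in lebesgue. T \<le> x \<longrightarrow>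
      (\<exists>D. (f has_real_derivative D) (at x within {0..}) \<and> D \<le> c - m * f x)"
    and e: "e > 0"
  shows "\<forall>\<^sub>F t in at_top. f t \<le> c / m + e"
proof -
  have "filterlim (\<lambda>t. m * (t - T)) at_top at_top"
    by (rule filterlim_tendsto_pos_mult_at_top[OF tendsto_const m filterlim_shift])
  then have "((\<lambda>t. inverse (exp (m * (t - T))) * (f T - c / m)) \<longlongrightarrow> 0 * (f T - c / m)) at_top"
    by (intro tendsto_mult tendsto_const tendsto_inverse_0_at_top filterlim_compose[OF exp_at_top])
  then have "((\<lambda>t. exp (- m * (t - T)) * (f T - c / m)) \<longlongrightarrow> 0 * (f T - c / m)) at_top"
    by (simp add: exp_minus)
  then have "\<forall>\<^sub>F t in at_top. exp (- m * (t - T)) * (f T - c / m) < e"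
    using e by (intro order_tendstoD(2)) simp_all
  then show ?thesis
    using eventually_ge_at_top[of T]
  proof eventually_elim
    case (elim t)
    have "f t \<le> exp (- m * (t - T)) * (f T - c / m) + c / m"
      by (rule loc_abs_continuous_gronwall[OF f m T]) (use elim deriv in \<open>auto elim: eventually_mono\<close>)
    then show ?case using elim by simp
  qed
qed

section \<open>The heat equation in L2\<close>

lemma C_infinityD:
  assumes "C_infinity f"
  shows "(f has_real_derivative deriv f x) (at x)"
    and "continuous_on S f" and "continuous_on S (deriv f)"
proof -
  have "(deriv ^^ 0) f differentiable (at x)" "(deriv ^^ 1) f differentiable (at x)" for x
    using assms unfolding C_infinity_def by blast+
  then have *: "f differentiable (at x)" "deriv f differentiable (at x)" for x by simp_all
  show "(f has_real_derivative deriv f x) (at x)"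
    using *(1) by (simp add: DERIV_deriv_iff_real_differentiable)
  show "continuous_on S f" "continuous_on S (deriv f)"
    using * by (auto intro!: continuous_at_imp_continuous_on differentiable_imp_continuous_within)
qed

lemma test_functionE:
  assumes "test_function \<phi>"
  obtains a b where "0 < a" "a \<le> b" "b < 1" "\<And>x. x \<notin> {a<..<b} \<Longrightarrow> \<phi> x = 0 \<and> deriv \<phi> x = 0"
proof -
  obtain a b where ab: "0 < a" "b < 1" and z: "\<And>x. x \<notin> {a..b} \<Longrightarrow> \<phi> x = 0"
    using assms by (auto simp: test_function_def)
  have d: "deriv \<phi> x = 0" if "x \<notin> {a..b}" for x
  proof -
    have "open (- {a..b})" by (simp add: open_Compl)
    then have "\<forall>\<^sub>F u in nhds x. \<phi> u = 0"
      using z that by (auto simp: eventually_nhds intro!: exI[of _ "- {a..b}"])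
    then have "deriv \<phi> x = deriv (\<lambda>_. 0) x" by (intro deriv_cong_ev) auto
    then show ?thesis by simp
  qed
  \<comment> \<open>Halving the distances to 0 and 1 makes the function and its derivative vanish
    already at the new endpoints, so boundary terms disappear. The value 1/2 ensures
    \<open>a' \<le> b'\<close> even when \<open>{a..b}\<close> is empty.\<close>
  define a' b' where "a' = min (a / 2) (1 / 2)" and "b' = max ((b + 1) / 2) (1 / 2)"
  have "0 < a'" "a' \<le> b'" "b' < 1" and "\<And>x. x \<notin> {a'<..<b'} \<Longrightarrow> x \<notin> {a..b}"
    using ab by (auto simp: a'_def b'_def)
  then show ?thesis using z d by (intro that[of a' b']) blast+
qed

lemma sq_int_continuous:
  assumes f: "continuous_on {0..1} f"
  shows "sq_int f"
proof -
  have "bounded (f ` {0..1})" by (intro compact_imp_bounded compact_continuous_image f compact_Icc)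
  then obtain M where M: "\<And>x. x \<in> {0..1} \<Longrightarrow> \<bar>f x\<bar> \<le> M"
    unfolding bounded_iff real_norm_def by blast
  have meas: "f \<in> borel_measurable unit_meas"
    using f by (intro continuous_imp_measurable_on_sets_lebesgue) (auto elim: continuous_on_subset)
  interpret finite_measure unit_meas by (rule finite_measure_lebesgue_on) simp
  have "integrable unit_meas (\<lambda>x. (f x)\<^sup>2)"
  proof (rule integrable_const_bound)
    show "AE x in unit_meas. norm ((f x)\<^sup>2) \<le> M\<^sup>2"
    proof (rule AE_I2)
      fix x assume "x \<in> space unit_meas"
      then have "\<bar>f x\<bar> \<le> M" by (intro M) auto
      then show "norm ((f x)\<^sup>2) \<le> M\<^sup>2" using power_mono[of "\<bar>f x\<bar>" M 2] by simp
    qed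
  qed (use meas in auto)
  with meas show ?thesis by (simp add: sq_int_def)
qed

lemma sq_int_test_function:
  assumes "test_function \<phi>"
  shows "sq_int \<phi>" "sq_int (deriv \<phi>)"
  using assms by (auto simp: test_function_def intro!: sq_int_continuous C_infinityD)

text \<open>The difference of the two sides is the integral of \<open>(\<phi>' - \<pi> cot(\<pi> x) \<phi>)\<^sup>2\<close>, since
  \<open>\<pi> cot(\<pi> x) \<phi>\<^sup>2\<close> vanishes near the endpoints.\<close>

lemma wirtinger_test_function:
  assumes \<phi>: "test_function \<phi>"
  shows "pi\<^sup>2 * (LINT x|unit_meas. (\<phi> x)\<^sup>2) \<le> (LINT x|unit_meas. (deriv \<phi> x)\<^sup>2)"
proof -
  obtain a b where ab: "0 < a" "a \<le> b" "b < 1"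
    and z: "\<And>x. x \<notin> {a<..<b} \<Longrightarrow> \<phi> x = 0 \<and> deriv \<phi> x = 0"
    using test_functionE[OF \<phi>] by metis
  have C: "C_infinity \<phi>" using \<phi> by (simp add: test_function_def)
  define F where "F = (\<lambda>x. (deriv \<phi> x)\<^sup>2 - pi\<^sup>2 * (\<phi> x)\<^sup>2)"
  define S where "S = (\<lambda>x. (deriv \<phi> x - pi * cot (pi * x) * \<phi> x)\<^sup>2)"
  define D where "D = (\<lambda>x. - (pi\<^sup>2 * (1 + (cot (pi * x))\<^sup>2) * (\<phi> x)\<^sup>2)
    + 2 * pi * cot (pi * x) * \<phi> x * deriv \<phi> x)"
  have sin: "sin (pi * x) > 0" if "x \<in> {a..b}" for x
    using that ab by (intro sin_gt_zero) auto
  have "((\<lambda>x. pi * cot (pi * x) * (\<phi> x)\<^sup>2) has_real_derivative D x) (at x within {a..b})"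
    if x: "x \<in> {a..b}" for x
  proof -
    have "inverse ((sin (pi * x))\<^sup>2) = 1 + (cot (pi * x))\<^sup>2"
      using sin[OF x] sin_cos_squared_add[of "pi * x"]
      by (simp add: cot_def field_simps)
    then have cot: "((\<lambda>x. cot (pi * x)) has_real_derivative - (1 + (cot (pi * x))\<^sup>2) * pi) (at x within {a..b})"
      using sin[OF x] by (intro DERIV_chain2[where f = cot]) (auto intro!: DERIV_cot[THEN DERIV_cong] derivative_eq_intros)
    show ?thesis
      using DERIV_mult'[OF DERIV_cmult[OF cot, of pi]
          DERIV_power[OF DERIV_subset[OF C_infinityD(1)[OF C] subset_UNIV], where n = 2]]
      by (rule DERIV_cong) (simp_all add: D_def algebra_simps power2_eq_square)
  qed
  then have "(D has_integral pi * cot (pi * b) * (\<phi> b)\<^sup>2 - pi * cot (pi * a) * (\<phi> a)\<^sup>2) {a..b}"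
    using ab by (intro fundamental_theorem_of_calculus)
      (auto simp: has_real_derivative_iff_has_vector_derivative)
  then have D: "(D has_integral 0) {a..b}" using z[of a] z[of b] by simp
  have "continuous_on {a..b} S"
    unfolding S_def using sin by (auto intro!: continuous_intros C_infinityD[OF C] simp: less_imp_neq[symmetric])
  then have S: "(S has_integral integral {a..b} S) {a..b}"
    by (intro integrable_integral integrable_continuous_interval)
  \<comment> \<open>Expanding the square in \<open>S\<close>, all terms with the cotangent cancel
    against \<open>D\<close>; the \<open>1\<close> in \<open>1 + cot^2\<close>, which stems from the
    derivative of the cotangent, leaves the term with \<open>pi^2\<close>.\<close>
  have "F = (\<lambda>x. S x + D x)"
    by (rule ext) (simp add: F_def S_def D_def power2_eq_square algebra_simps)
  then have "(F has_integral integral {a..b} S) {a..b}"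
    using has_integral_add[OF S D] by simp
  then have F1: "(F has_integral integral {a..b} S) {0<..<1}"
    by (rule has_integral_on_superset) (use z ab in \<open>auto simp: F_def\<close>)
  have int: "integrable unit_meas (\<lambda>x. (\<phi> x)\<^sup>2)" "integrable unit_meas (\<lambda>x. (deriv \<phi> x)\<^sup>2)"
    using sq_int_test_function[OF \<phi>] by (auto simp: sq_int_def)
  then have "integrable unit_meas F" by (auto simp: F_def)
  then have "(F has_integral integral\<^sup>L unit_meas F) {0<..<1}"
    by (intro has_integral_integral_lebesgue_on) auto
  with F1 have "integral\<^sup>L unit_meas F = integral {a..b} S" by (rule has_integral_unique[symmetric])
  also have "\<dots> \<ge> 0" using S by (rule has_integral_nonneg) (simp add: S_def)
  finally have "0 \<le> integral\<^sup>L unit_meas F" .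
  also have "integral\<^sup>L unit_meas F
      = (LINT x|unit_meas. (deriv \<phi> x)\<^sup>2) - pi\<^sup>2 * (LINT x|unit_meas. (\<phi> x)\<^sup>2)"
    unfolding F_def using int by simp
  finally show ?thesis by simp
qed

section \<open>From representatives to elements of L2 and weak derivatives\<close>

lemma sq_int_rep_L2: "sq_int (rep_L2 f)"
  using Quotient_rep_reflp[OF Quotient_L2, of f] by (simp add: L2_rel_def)

lemma abs_rep_L2: "abs_L2 (rep_L2 f) = f"
  by (rule Quotient_abs_rep[OF Quotient_L2])

lemma inner_abs_L2:
  assumes "sq_int f" "sq_int g"
  shows "inner (abs_L2 f) (abs_L2 g) = (LINT x|unit_meas. f x * g x)"
  using assms by (intro inner_L2.abs_eq) (auto simp: L2_rel_def)

lemma inner_rep_abs_L2: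
  assumes "sq_int g"
  shows "inner f (abs_L2 g) = (LINT x|unit_meas. rep_L2 f x * g x)"
  using inner_abs_L2[OF sq_int_rep_L2 assms, of f] by (simp add: abs_rep_L2)

lemma norm_abs_L2:
  assumes "sq_int f"
  shows "(norm (abs_L2 f))\<^sup>2 = (LINT x|unit_meas. (f x)\<^sup>2)"
  using inner_abs_L2[OF assms assms] unfolding power2_norm_eq_inner by (simp add: power2_eq_square)

lemma has_weak_deriv_weak_deriv:
  assumes "f \<in> H1"
  shows "has_weak_deriv f (weak_deriv f)"
  using assms someI_ex[of "has_weak_deriv f"] by (auto simp: H1_def weak_deriv_def)

lemma inner_has_weak_deriv:
  assumes "has_weak_deriv f g" "test_function \<phi>"
  shows "inner f (abs_L2 (deriv \<phi>)) = - inner g (abs_L2 \<phi>)"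
  using assms sq_int_test_function[OF assms(2)] by (simp add: inner_rep_abs_L2 has_weak_deriv_def)

text \<open>Passage to the limit from test functions: both sides are continuous along the sequence
  that witnesses membership in \<open>H10\<close>.\<close>

lemma wirtinger_H10:
  assumes "f \<in> H10"
  shows "pi\<^sup>2 * (norm f)\<^sup>2 \<le> (norm (weak_deriv f))\<^sup>2"
proof -
  obtain \<phi> where \<phi>: "\<And>n. test_function (\<phi> n)"
    and lim: "(\<lambda>n. abs_L2 (\<phi> n)) \<longlonglongrightarrow> f" "(\<lambda>n. abs_L2 (deriv (\<phi> n))) \<longlonglongrightarrow> weak_deriv f"
    using assms by (auto simp: H10_def)
  show ?thesis
  proof (rule LIMSEQ_le)
    show "(\<lambda>n. pi\<^sup>2 * (norm (abs_L2 (\<phi> n)))\<^sup>2) \<longlonglongrightarrow> pi\<^sup>2 * (norm f)\<^sup>2"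
      by (intro tendsto_intros lim)
    show "(\<lambda>n. (norm (abs_L2 (deriv (\<phi> n))))\<^sup>2) \<longlonglongrightarrow> (norm (weak_deriv f))\<^sup>2"
      by (intro tendsto_intros lim)
    show "\<exists>N. \<forall>n\<ge>N. pi\<^sup>2 * (norm (abs_L2 (\<phi> n)))\<^sup>2 \<le> (norm (abs_L2 (deriv (\<phi> n))))\<^sup>2"
      using wirtinger_test_function[OF \<phi>] sq_int_test_function[OF \<phi>] by (simp add: norm_abs_L2)
  qed
qed

text \<open>Integration by parts without boundary traces: the weak derivative of
  \<open>weak_deriv f\<close> is tested against the functions approximating \<open>f\<close> in
  \<open>H10\<close>, and both sides converge.\<close>

lemma inner_weak_laplacian:
  assumes "f \<in> H2 \<inter> H10"
  shows "inner f (weak_deriv (weak_deriv f)) = - (norm (weak_deriv f))\<^sup>2"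
proof -
  obtain \<phi> where \<phi>: "\<And>n. test_function (\<phi> n)"
    and lim: "(\<lambda>n. abs_L2 (\<phi> n)) \<longlonglongrightarrow> f" "(\<lambda>n. abs_L2 (deriv (\<phi> n))) \<longlonglongrightarrow> weak_deriv f"
    using assms by (auto simp: H10_def)
  have wd: "has_weak_deriv (weak_deriv f) (weak_deriv (weak_deriv f))"
    using assms by (auto simp: H2_def intro: has_weak_deriv_weak_deriv)
  have "(\<lambda>n. - inner (weak_deriv (weak_deriv f)) (abs_L2 (\<phi> n)))
      \<longlonglongrightarrow> inner (weak_deriv f) (weak_deriv f)"
    using tendsto_inner[OF tendsto_const lim(2), of "weak_deriv f"]
    by (simp add: inner_has_weak_deriv[OF wd \<phi>])
  moreover have "(\<lambda>n. - inner (weak_deriv (weak_deriv f)) (abs_L2 (\<phi> n)))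
      \<longlonglongrightarrow> - inner (weak_deriv (weak_deriv f)) f"
    by (intro tendsto_intros lim)
  ultimately have "inner (weak_deriv f) (weak_deriv f) = - inner (weak_deriv (weak_deriv f)) f"
    by (rule LIMSEQ_unique)
  then show ?thesis by (simp add: power2_norm_eq_inner inner_commute)
qed

lemma sq_int_abs:
  assumes "sq_int f"
  shows "sq_int (\<lambda>x. \<bar>f x\<bar>)"
  using assms by (auto simp: sq_int_def)

text \<open>The absolute values stand inside the integral because the reaction term is controlled
  only through a pointwise bound on its modulus.\<close>

lemma LINT_abs_mult_le:
  "(LINT x|unit_meas. \<bar>rep_L2 f x\<bar> * \<bar>rep_L2 g x\<bar>) \<le> norm f * norm g"
proof -
  have norm: "norm (abs_L2 (\<lambda>x. \<bar>rep_L2 h x\<bar>)) = norm h" for h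
  proof -
    have "(norm (abs_L2 (\<lambda>x. \<bar>rep_L2 h x\<bar>)))\<^sup>2 = (norm (abs_L2 (rep_L2 h)))\<^sup>2"
      by (simp add: norm_abs_L2 sq_int_abs sq_int_rep_L2)
    then show ?thesis by (simp add: abs_rep_L2 power2_eq_iff_nonneg)
  qed
  show ?thesis
    using norm_cauchy_schwarz[of "abs_L2 (\<lambda>x. \<bar>rep_L2 f x\<bar>)" "abs_L2 (\<lambda>x. \<bar>rep_L2 g x\<bar>)"]
    by (simp add: norm inner_abs_L2 sq_int_abs sq_int_rep_L2)
qed

text \<open>The factor \<open>k\<close> need not be measurable, which is why the reaction term is first expressed
  through the other terms of the equation.\<close>

lemma heat_energy_estimate:
  assumes f: "f \<in> H2 \<inter> H10" and p: "p \<ge> 0"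
    and eq: "AE x in unit_meas. rep_L2 wt x =
      p * rep_L2 (weak_deriv (weak_deriv f)) x + rep_L2 \<theta> x * k x + rep_L2 \<delta> x"
    and k: "\<And>x. x \<in> {0..1} \<Longrightarrow> \<bar>k x\<bar> \<le> c"
  shows "inner f wt \<le> - p * pi\<^sup>2 * (norm f)\<^sup>2 + c * norm f * norm \<theta> + norm f * norm \<delta>"
proof -
  define f2 where "f2 = weak_deriv (weak_deriv f)"
  define h where "h = (\<lambda>x. rep_L2 wt x + (- p) * rep_L2 f2 x + (- 1) * rep_L2 \<delta> x)"
  have h: "sq_int h"
    unfolding h_def by (intro sq_int_add sq_int_scale sq_int_rep_L2)
  have h_le: "AE x in unit_meas. \<bar>h x\<bar> \<le> c * \<bar>rep_L2 \<theta> x\<bar>"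
    using eq AE_space
  proof eventually_elim
    fix x assume x: "rep_L2 wt x =
        p * rep_L2 (weak_deriv (weak_deriv f)) x + rep_L2 \<theta> x * k x + rep_L2 \<delta> x" "x \<in> space unit_meas"
    then have "h x = k x * rep_L2 \<theta> x" by (simp add: h_def f2_def)
    then show "\<bar>h x\<bar> \<le> c * \<bar>rep_L2 \<theta> x\<bar>"
      using k[of x] x(2) by (simp add: abs_mult mult_right_mono)
  qed
  have int: "integrable unit_meas (\<lambda>x. rep_L2 f x * g x)" if "sq_int g" for g
    using sq_int_mult[OF sq_int_rep_L2 that] .
  have "inner f wt = (LINT x|unit_meas. p * (rep_L2 f x * rep_L2 f2 x) + rep_L2 f x * h x
      + rep_L2 f x * rep_L2 \<delta> x)"
    unfolding inner_L2.rep_eq by (intro Bochner_Integration.integral_cong) (auto simp: h_def algebra_simps)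
  also have "\<dots> = p * inner f f2 + (LINT x|unit_meas. rep_L2 f x * h x) + inner f \<delta>"
    by (simp add: int h sq_int_rep_L2 inner_L2.rep_eq)
  finally have eq2: "inner f wt = p * inner f f2 + (LINT x|unit_meas. rep_L2 f x * h x) + inner f \<delta>" .
  have "(LINT x|unit_meas. rep_L2 f x * h x)
      \<le> (LINT x|unit_meas. c * (\<bar>rep_L2 f x\<bar> * \<bar>rep_L2 \<theta> x\<bar>))"
  proof (rule integral_mono_AE)
    show "integrable unit_meas (\<lambda>x. rep_L2 f x * h x)" by (rule int[OF h])
    show "integrable unit_meas (\<lambda>x. c * (\<bar>rep_L2 f x\<bar> * \<bar>rep_L2 \<theta> x\<bar>))"
      by (intro integrable_mult_right sq_int_mult sq_int_abs sq_int_rep_L2)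
    show "AE x in unit_meas. rep_L2 f x * h x \<le> c * (\<bar>rep_L2 f x\<bar> * \<bar>rep_L2 \<theta> x\<bar>)"
      using h_le
    proof eventually_elim
      fix x assume "\<bar>h x\<bar> \<le> c * \<bar>rep_L2 \<theta> x\<bar>"
      then have "\<bar>rep_L2 f x\<bar> * \<bar>h x\<bar> \<le> \<bar>rep_L2 f x\<bar> * (c * \<bar>rep_L2 \<theta> x\<bar>)"
        by (rule mult_left_mono) simp
      then show "rep_L2 f x * h x \<le> c * (\<bar>rep_L2 f x\<bar> * \<bar>rep_L2 \<theta> x\<bar>)"
        using abs_ge_self[of "rep_L2 f x * h x"] by (simp add: abs_mult mult.left_commute)
    qed
  qed
  also have "\<dots> = c * (LINT x|unit_meas. \<bar>rep_L2 f x\<bar> * \<bar>rep_L2 \<theta> x\<bar>)" by simp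
  also have "\<dots> \<le> c * (norm f * norm \<theta>)"
    \<comment> \<open>The bound at \<open>0\<close> serves to obtain
      \<open>c \<ge> 0\<close>.\<close>
    using k[of 0] by (intro mult_left_mono LINT_abs_mult_le) auto
  finally have *: "(LINT x|unit_meas. rep_L2 f x * h x) \<le> c * norm f * norm \<theta>"
    by (simp add: mult.assoc)
  have "p * inner f f2 \<le> - p * pi\<^sup>2 * (norm f)\<^sup>2"
    using inner_weak_laplacian[OF f] wirtinger_H10[of f] f p
    by (simp add: f2_def mult.assoc mult_left_mono)
  moreover have "inner f \<delta> \<le> norm f * norm \<delta>" by (rule norm_cauchy_schwarz)
  ultimately show ?thesis using eq2 * by linarith
qed

section \<open>The feedback gains\<close>

text \<open>Completion of the square. With an excess as \<open>u\<close>, the weight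
  \<open>a / q\<close> is the factor \<open>a / (\<kappa> + exp z)\<close> of the perturbations in
  \<open>Z\<close>, while the cost in \<open>v\<close> grows with \<open>q\<close> and is left to
  the feedback.\<close>

lemma young:
  fixes a q :: real
  assumes "a > 0" "q > 0"
  shows "u * v \<le> a / q * u\<^sup>2 + q / (4 * a) * v\<^sup>2"
proof -
  have "a / q * u\<^sup>2 + q / (4 * a) * v\<^sup>2 - u * v = (2 * a * u - q * v)\<^sup>2 / (4 * a * q)"
    using assms by (simp add: field_simps power2_eq_square)
  also have "\<dots> \<ge> 0" using assms by simp
  finally show ?thesis by simp
qed

text \<open>If the gain \<open>\<beta>\<close> is too small for \<open>1 \<le> \<beta> q\<close>, the deficit is measured by \<open>h\<close> and
  paid for by a higher order term.\<close>

lemma gain_deficit: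
  fixes a q \<beta> :: real
  assumes "a > 0" "q > 0" "\<beta> > 0" "1 \<le> \<beta> * (q + h)" "T \<ge> 0"
  shows "T \<le> \<beta> * q * (T + T\<^sup>2 / (4 * a)) + a / q * (\<beta> * h\<^sup>2)"
proof -
  have "T \<le> \<beta> * (q + h) * T" using assms mult_right_mono[of 1 "\<beta> * (q + h)" T] by simp
  also have "\<dots> = \<beta> * q * T + \<beta> * (h * T)" by (simp add: algebra_simps)
  also have "\<dots> \<le> \<beta> * q * T + \<beta> * (a / q * h\<^sup>2 + q / (4 * a) * T\<^sup>2)"
    using assms young[of a q h T] by (simp add: mult_left_mono)
  also have "\<dots> = \<beta> * q * (T + T\<^sup>2 / (4 * a)) + a / q * (\<beta> * h\<^sup>2)"
    by (simp add: algebra_simps)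
  finally show ?thesis .
qed

text \<open>\<open>f\<close>, \<open>p1\<close>, \<open>p2\<close>, \<open>p3\<close> stand for the
  values of \<open>\<phi>\<close>, \<open>P1\<close>, \<open>P2\<close>, \<open>P3\<close> at one
  fixed argument, which turns the design conditions into algebra of real numbers.\<close>

locale feedback_gains =
  fixes \<kappa> a C f p1 p2 p3 :: real
  assumes pos: "\<kappa> > 0" "a > 0" "C > 0" and f: "f \<ge> 0"
    and p1: "p1 \<ge> 1 / (4 * a * \<kappa>^6) *
      (\<kappa> + 4 * a * C + 4 * \<kappa>^3 + 4 * a * \<kappa> * f + 8 * a * \<kappa>^2)"
    and p2: "p2 \<ge> 1 / (4 * a^3 * \<kappa>^5) *
      (1 / (16 * \<kappa>) * (\<kappa> + 4 * a * C + 4 * \<kappa>^3 + 4 * a * \<kappa> * f)^2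
        + \<kappa>^2 + a^2 * f^2 + 4 * a^2 * (\<kappa>^3 + 1))"
    and p3: "p3 \<ge> 1 / (64 * a^7 * \<kappa>^4) * ((\<kappa>^2 + a^2 * f^2)^2 + 16 * a^4)"
begin

text \<open>\<open>\<alpha>\<close> and \<open>\<Delta>\<close> collect, at
  \<open>q = \<kappa>\<close>, the coefficients of \<open>y^2\<close> and \<open>y^4\<close> to be
  dominated apart from those due to \<open>\<theta>1\<close>. In \<open>\<alpha>\<close>,
  \<open>C\<close> is the decay demanded, \<open>\<kappa> / (4 * a)\<close> pays for
  \<open>d\<close>, \<open>\<kappa> * f\<close> for \<open>\<phi>\<close> times the part of
  \<open>\<theta>2\<close> below the gain, and \<open>\<kappa>^3 / a\<close> for the coupling with
  \<open>w\<close>. The two summands of \<open>\<Delta>\<close> pay for the excess of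
  \<open>\<theta>2\<close> in the last two products.\<close>

definition \<alpha> where "\<alpha> = C + \<kappa> / (4 * a) + \<kappa> * f + \<kappa>^3 / a"
definition \<Delta> where "\<Delta> = \<kappa> * (f\<^sup>2 / (4 * a) + \<kappa>\<^sup>2 / (4 * a^3))"

lemma \<alpha>_nonneg: "\<alpha> \<ge> 0" and \<Delta>_nonneg: "\<Delta> \<ge> 0"
  using pos f by (simp_all add: \<alpha>_def \<Delta>_def)

text \<open>\<open>gain1\<close>, \<open>gain2\<close> and \<open>gain3\<close> decode the
  conditions on \<open>P1\<close>, \<open>P2\<close>, \<open>P3\<close>. The additions
  \<open>2 * \<kappa>\<^sup>2\<close> and \<open>\<kappa> / a\<close> are due to
  \<open>\<theta>1\<close> below and above the gain. The quotients by \<open>4 * a\<close> are the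
  terms \<open>T\<^sup>2 / (4 * a)\<close> of \<open>gain_deficit\<close> for the four monomials
  with coefficients \<open>\<alpha>\<close>, \<open>2 * \<kappa>\<^sup>2\<close> (in
  \<open>gain2\<close>) and \<open>\<Delta>\<close>, \<open>\<kappa> / a\<close> (in
  \<open>gain3\<close>).\<close>

lemma gain1: "\<kappa>^6 * p1 \<ge> \<alpha> + 2 * \<kappa>\<^sup>2"
proof -
  have "\<kappa>^6 * p1 \<ge> \<kappa>^6 * (1 / (4 * a * \<kappa>^6) *
      (\<kappa> + 4 * a * C + 4 * \<kappa>^3 + 4 * a * \<kappa> * f + 8 * a * \<kappa>^2))"
    using p1 pos by (intro mult_left_mono) auto
  also have "\<kappa>^6 * (1 / (4 * a * \<kappa>^6) *
      (\<kappa> + 4 * a * C + 4 * \<kappa>^3 + 4 * a * \<kappa> * f + 8 * a * \<kappa>^2)) = \<alpha> + 2 * \<kappa>\<^sup>2"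
    using pos by (simp add: \<alpha>_def field_simps)
  finally show ?thesis .
qed

lemma gain2: "\<kappa>^6 * p2 \<ge> \<Delta> + \<kappa> / a + (\<alpha>\<^sup>2 + 4 * \<kappa>^4) / (4 * a)"
proof -
  have \<alpha>: "\<kappa> + 4 * a * C + 4 * \<kappa>^3 + 4 * a * \<kappa> * f = 4 * a * \<alpha>"
    using pos by (simp add: \<alpha>_def field_simps)
  have "\<kappa>^6 * p2 \<ge> \<kappa>^6 * (1 / (4 * a^3 * \<kappa>^5) *
      (1 / (16 * \<kappa>) * (4 * a * \<alpha>)^2 + \<kappa>^2 + a^2 * f^2 + 4 * a^2 * (\<kappa>^3 + 1)))"
    using p2 pos unfolding \<alpha> by (intro mult_left_mono) auto
  also have "\<kappa>^6 * (1 / (4 * a^3 * \<kappa>^5) *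
      (1 / (16 * \<kappa>) * (4 * a * \<alpha>)^2 + \<kappa>^2 + a^2 * f^2 + 4 * a^2 * (\<kappa>^3 + 1)))
      = \<Delta> + \<kappa> / a + (\<alpha>\<^sup>2 + 4 * \<kappa>^4) / (4 * a)"
    using pos by (simp add: \<Delta>_def field_simps power2_eq_square power3_eq_cube eval_nat_numeral)
  finally show ?thesis .
qed

lemma gain3: "\<kappa>^6 * p3 \<ge> (\<Delta>\<^sup>2 + \<kappa>\<^sup>2 / a\<^sup>2) / (4 * a)"
proof -
  have "\<kappa>^6 * p3 \<ge> \<kappa>^6 * (1 / (64 * a^7 * \<kappa>^4) * ((\<kappa>^2 + a^2 * f^2)^2 + 16 * a^4))"
    using p3 pos by (intro mult_left_mono) auto
  also have "\<kappa>^6 * (1 / (64 * a^7 * \<kappa>^4) * ((\<kappa>^2 + a^2 * f^2)^2 + 16 * a^4))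
      = (\<Delta>\<^sup>2 + \<kappa>\<^sup>2 / a\<^sup>2) / (4 * a)"
    using pos by (simp add: \<Delta>_def field_simps power2_eq_square power3_eq_cube eval_nat_numeral)
  finally show ?thesis .
qed

lemma scale_le:
  assumes "q \<ge> \<kappa>" "x \<ge> 0" "n \<le> 3"
  shows "(q / \<kappa>)^n * x \<le> (q / \<kappa>)^3 * x"
  using assms pos by (intro mult_right_mono power_increasing) auto

text \<open>All coefficients are polynomials of degree at most 6 in \<open>q = \<rho> \<kappa>\<close> with \<open>\<rho> \<ge> 1\<close>, so it
  suffices to compare them at \<open>q = \<kappa>\<close>.\<close>

lemma gain_dominates:
  assumes q: "q \<ge> \<kappa>" and \<beta>: "\<beta> > 0" and h: "1 \<le> \<beta> * (q + h)" and Y: "Y \<ge> 0"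
    and A: "0 \<le> A" "A \<le> (q / \<kappa>)^3 * \<alpha>" and D: "0 \<le> D" "D \<le> (q / \<kappa>)^3 * \<Delta>"
  shows "(A + 2 * q\<^sup>2) * Y + (D + q / a) * Y\<^sup>2
      \<le> \<beta> * q^7 * (p1 + p2 * Y + p3 * Y^3) * Y + a / q * (4 * \<beta> * h\<^sup>2)"
    and "A * Y + D * Y\<^sup>2 \<le> \<beta> * q^7 * (p1 + p2 * Y + p3 * Y^3) * Y + a / q * (2 * \<beta> * h\<^sup>2)"
proof -
  define \<rho> where "\<rho> = q / \<kappa>"
  have \<rho>: "\<rho> \<ge> 1" and q_eq: "q = \<rho> * \<kappa>" using q pos by (auto simp: \<rho>_def)
  have q0: "q > 0" using q pos by simp
  have \<rho>_pow: "\<rho> ^ n * x \<le> \<rho> ^ 6 * x" if "n \<le> 6" "x \<ge> 0" for n x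
    using that \<rho> by (intro mult_right_mono power_increasing) auto
  have A2: "A\<^sup>2 \<le> \<rho>^6 * \<alpha>\<^sup>2" and D2: "D\<^sup>2 \<le> \<rho>^6 * \<Delta>\<^sup>2"
    using power_mono[OF A(2,1), of 2] power_mono[OF D(2,1), of 2]
    by (simp_all add: \<rho>_def power_mult_distrib flip: power_mult)
  have A1: "A \<le> \<rho>^6 * \<alpha>" and D1: "D \<le> \<rho>^6 * \<Delta>"
    using A(2) D(2) \<rho>_pow[OF _ \<alpha>_nonneg, of 3] \<rho>_pow[OF _ \<Delta>_nonneg, of 3] by (auto simp: \<rho>_def)
  have q_pow: "q^2 \<le> \<rho>^6 * \<kappa>^2" "q^4 \<le> \<rho>^6 * \<kappa>^4" "q \<le> \<rho>^6 * \<kappa>"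
    using \<rho>_pow[of 2 "\<kappa>^2"] \<rho>_pow[of 4 "\<kappa>^4"] \<rho>_pow[of 1 \<kappa>] pos by (auto simp: q_eq power_mult_distrib)
  have q6: "q^6 * p = \<rho>^6 * (\<kappa>^6 * p)" for p by (simp add: q_eq power_mult_distrib)
  have "q^6 * p1 \<ge> \<rho>^6 * (\<alpha> + 2 * \<kappa>\<^sup>2)" unfolding q6 using gain1 \<rho> by (intro mult_left_mono) auto
  then have c1: "A + 2 * q\<^sup>2 \<le> q^6 * p1" using A1 q_pow by (simp add: algebra_simps)
  have "D + q / a + (A\<^sup>2 + 4 * q^4) / (4 * a)
      \<le> \<rho>^6 * \<Delta> + \<rho>^6 * \<kappa> / a + (\<rho>^6 * \<alpha>\<^sup>2 + 4 * (\<rho>^6 * \<kappa>^4)) / (4 * a)"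
    using D1 A2 q_pow pos by (intro add_mono divide_right_mono mult_left_mono) auto
  also have "\<dots> = \<rho>^6 * (\<Delta> + \<kappa> / a + (\<alpha>\<^sup>2 + 4 * \<kappa>^4) / (4 * a))"
    by (simp add: algebra_simps add_divide_distrib)
  also have "\<dots> \<le> q^6 * p2" unfolding q6 using gain2 \<rho> by (intro mult_left_mono) auto
  finally have c2: "D + q / a + (A\<^sup>2 + 4 * q^4) / (4 * a) \<le> q^6 * p2" .
  have "(D\<^sup>2 + q\<^sup>2 / a\<^sup>2) / (4 * a) \<le> (\<rho>^6 * \<Delta>\<^sup>2 + \<rho>^6 * \<kappa>\<^sup>2 / a\<^sup>2) / (4 * a)"
    using D2 q_pow pos by (intro add_mono divide_right_mono) auto
  also have "\<dots> = \<rho>^6 * ((\<Delta>\<^sup>2 + \<kappa>\<^sup>2 / a\<^sup>2) / (4 * a))"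
    by (simp add: algebra_simps add_divide_distrib)
  also have "\<dots> \<le> q^6 * p3" unfolding q6 using gain3 \<rho> by (intro mult_left_mono) auto
  finally have c3: "(D\<^sup>2 + q\<^sup>2 / a\<^sup>2) / (4 * a) \<le> q^6 * p3" .
  note deficit = gain_deficit[OF pos(2) q0 \<beta> h]
  have bq: "\<beta> * q \<ge> 0" using \<beta> q0 by simp
  \<comment> \<open>\<open>gain_deficit\<close> is applied to the four monomials one by one:
    squaring their sum would create a term in \<open>Y^3\<close>, which the feedback does not
    provide. This is the origin of the factor 4 before \<open>\<beta> * h\<^sup>2\<close>; the
    second claim has two monomials, hence the factor 2.\<close>
  have "(A + 2 * q\<^sup>2) * Y + (D + q / a) * Y\<^sup>2
      = A * Y + (2 * q\<^sup>2) * Y + D * Y\<^sup>2 + q / a * Y\<^sup>2" by (simp add: algebra_simps)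
  also have "\<dots> \<le> \<beta> * q * (A * Y + (A * Y)\<^sup>2 / (4 * a)) + a / q * (\<beta> * h\<^sup>2)
      + (\<beta> * q * (2 * q\<^sup>2 * Y + (2 * q\<^sup>2 * Y)\<^sup>2 / (4 * a)) + a / q * (\<beta> * h\<^sup>2))
      + (\<beta> * q * (D * Y\<^sup>2 + (D * Y\<^sup>2)\<^sup>2 / (4 * a)) + a / q * (\<beta> * h\<^sup>2))
      + (\<beta> * q * (q / a * Y\<^sup>2 + (q / a * Y\<^sup>2)\<^sup>2 / (4 * a)) + a / q * (\<beta> * h\<^sup>2))"
    using A D Y q0 pos by (intro add_mono deficit) auto
  also have "\<dots> = \<beta> * q * ((A + 2 * q\<^sup>2) * Y + (D + q / a + (A\<^sup>2 + 4 * q^4) / (4 * a)) * Y\<^sup>2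
      + (D\<^sup>2 + q\<^sup>2 / a\<^sup>2) / (4 * a) * Y^4) + a / q * (4 * \<beta> * h\<^sup>2)"
    by (simp add: algebra_simps add_divide_distrib power_mult_distrib power_divide flip: power_mult)
  also have "\<dots> \<le> \<beta> * q * (q^6 * p1 * Y + q^6 * p2 * Y\<^sup>2 + q^6 * p3 * Y^4) + a / q * (4 * \<beta> * h\<^sup>2)"
    using bq c1 c2 c3 Y by (intro add_mono mult_left_mono mult_right_mono order_refl) auto
  also have "\<dots> = \<beta> * q^7 * (p1 + p2 * Y + p3 * Y^3) * Y + a / q * (4 * \<beta> * h\<^sup>2)"
    by (simp add: algebra_simps eval_nat_numeral)
  finally show "(A + 2 * q\<^sup>2) * Y + (D + q / a) * Y\<^sup>2
      \<le> \<beta> * q^7 * (p1 + p2 * Y + p3 * Y^3) * Y + a / q * (4 * \<beta> * h\<^sup>2)" .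
  have "A * Y + D * Y\<^sup>2 \<le> \<beta> * q * (A * Y + (A * Y)\<^sup>2 / (4 * a)) + a / q * (\<beta> * h\<^sup>2)
      + (\<beta> * q * (D * Y\<^sup>2 + (D * Y\<^sup>2)\<^sup>2 / (4 * a)) + a / q * (\<beta> * h\<^sup>2))"
    using A D Y q0 pos by (intro add_mono deficit) auto
  also have "\<dots> = \<beta> * q * (A * Y + (D + A\<^sup>2 / (4 * a)) * Y\<^sup>2 + D\<^sup>2 / (4 * a) * Y^4)
      + a / q * (2 * \<beta> * h\<^sup>2)"
    by (simp add: algebra_simps add_divide_distrib power_mult_distrib power_divide flip: power_mult)
  also have "\<dots> \<le> \<beta> * q * (q^6 * p1 * Y + q^6 * p2 * Y\<^sup>2 + q^6 * p3 * Y^4) + a / q * (2 * \<beta> * h\<^sup>2)"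
  proof (intro add_mono mult_left_mono mult_right_mono order_refl bq Y)
    show "A \<le> q^6 * p1" using c1 zero_le_power2[of q] by linarith
    have "A\<^sup>2 / (4 * a) \<le> (A\<^sup>2 + 4 * q^4) / (4 * a)" "q / a \<ge> 0"
      using pos q0 by (auto intro: divide_right_mono)
    then show "D + A\<^sup>2 / (4 * a) \<le> q^6 * p2" using c2 by linarith
    have "D\<^sup>2 / (4 * a) \<le> (D\<^sup>2 + q\<^sup>2 / a\<^sup>2) / (4 * a)" using pos by (intro divide_right_mono) auto
    then show "D\<^sup>2 / (4 * a) \<le> q^6 * p3" using c3 by linarith
  qed (use Y pos q0 \<beta> in auto)
  also have "\<dots> = \<beta> * q^7 * (p1 + p2 * Y + p3 * Y^3) * Y + a / q * (2 * \<beta> * h\<^sup>2)"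
    by (simp add: algebra_simps eval_nat_numeral)
  finally show "A * Y + D * Y\<^sup>2
      \<le> \<beta> * q^7 * (p1 + p2 * Y + p3 * Y^3) * Y + a / q * (2 * \<beta> * h\<^sup>2)" .
qed

section \<open>Pointwise bounds on the derivative of half the square of y\<close>

context
  fixes q \<beta> h \<theta> s y n v d b :: real
  assumes q: "q \<ge> \<kappa>" and \<beta>: "\<beta> > 0" "\<beta> \<le> b" and h: "1 \<le> \<beta> * (q + h)"
    and \<theta>: "\<bar>\<theta>\<bar> \<le> q + s" and s: "s \<ge> 0" and n: "n \<ge> 0" and v: "\<bar>v\<bar> \<le> n + f * \<bar>y\<bar>"
begin

text \<open>The common start of the two estimates below. The product
  \<open>\<bar>\<theta>\<bar> * \<bar>y\<bar> * n\<close> is left intact because they split it with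
  different Young weights.\<close>

lemma rate_le:
  "y * (b * - (q^7 * (p1 + p2 * y^2 + p3 * y^6) * y) + \<theta> * v + d)
    \<le> - (\<beta> * q^7 * (p1 + p2 * y\<^sup>2 + p3 * (y\<^sup>2)^3) * y\<^sup>2)
    + \<bar>\<theta>\<bar> * \<bar>y\<bar> * n + f * q * y\<^sup>2 + a / q * s\<^sup>2 + q / (4 * a) * f\<^sup>2 * (y\<^sup>2)\<^sup>2
    + a / q * d\<^sup>2 + q / (4 * a) * y\<^sup>2"
proof -
  have q0: "q > 0" using q pos by simp
  have gains: "p1 \<ge> 0" "p2 \<ge> 0" "p3 \<ge> 0"
    using gain1 gain2 gain3 \<alpha>_nonneg \<Delta>_nonneg pos
      zero_le_mult_iff[of "\<kappa>^6" p1] zero_le_mult_iff[of "\<kappa>^6" p2] zero_le_mult_iff[of "\<kappa>^6" p3]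
    by (auto intro: order_trans[rotated] simp: add_nonneg_nonneg)
  define F where "F = q^7 * (p1 + p2 * y\<^sup>2 + p3 * (y\<^sup>2)^3) * y\<^sup>2"
  have F: "F \<ge> 0" using gains q0 by (simp add: F_def)
  have "y * (b * - (q^7 * (p1 + p2 * y^2 + p3 * y^6) * y) + \<theta> * v + d) = - (b * F) + y * \<theta> * v + y * d"
    by (simp add: F_def algebra_simps eval_nat_numeral)
  also have "- (b * F) \<le> - (\<beta> * F)" using \<beta> F by (simp add: mult_right_mono)
  also have "y * \<theta> * v \<le> \<bar>y\<bar> * \<bar>\<theta>\<bar> * \<bar>v\<bar>" by (metis abs_ge_self abs_mult)
  also have "\<bar>y\<bar> * \<bar>\<theta>\<bar> * \<bar>v\<bar> \<le> \<bar>y\<bar> * \<bar>\<theta>\<bar> * (n + f * \<bar>y\<bar>)" using v by (intro mult_left_mono) auto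
  also have "\<bar>y\<bar> * \<bar>\<theta>\<bar> * (n + f * \<bar>y\<bar>) = \<bar>\<theta>\<bar> * \<bar>y\<bar> * n + \<bar>\<theta>\<bar> * (f * (\<bar>y\<bar> * \<bar>y\<bar>))"
    by (simp only: algebra_simps)
  also have "\<bar>y\<bar> * \<bar>y\<bar> = y\<^sup>2" by (simp add: power2_eq_square)
  also have "\<bar>\<theta>\<bar> * (f * y\<^sup>2) \<le> (q + s) * (f * y\<^sup>2)" using \<theta> f by (intro mult_right_mono) auto
  also have "(q + s) * (f * y\<^sup>2) = f * q * y\<^sup>2 + s * (f * y\<^sup>2)" by (simp add: algebra_simps)
  also have "s * (f * y\<^sup>2) \<le> a / q * s\<^sup>2 + q / (4 * a) * (f * y\<^sup>2)\<^sup>2" using pos q0 by (intro young)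
  also have "y * d \<le> a / q * d\<^sup>2 + q / (4 * a) * y\<^sup>2" using young[OF pos(2) q0, of d y] by (simp add: mult.commute)
  finally show ?thesis by (simp add: F_def power_mult_distrib algebra_simps)
qed

lemma \<theta>_square: "\<theta>\<^sup>2 \<le> 2 * q\<^sup>2 + 2 * s\<^sup>2"
proof -
  have "\<theta>\<^sup>2 \<le> (q + s)\<^sup>2" using power_mono[OF \<theta>, of 2] by simp
  also have "\<dots> \<le> 2 * q\<^sup>2 + 2 * s\<^sup>2" using sum_squares_bound[of q s] by (simp add: power2_sum)
  finally show ?thesis .
qed

text \<open>The version for \<open>W\<close>; \<open>\<tau>\<^sup>2 * y\<^sup>2\<close> is the
  reaction term inherited from the heat equation. The coupling is split with the constant weight
  \<open>2 * \<kappa>\<close>, so \<open>n\<^sup>2\<close> receives the coefficient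
  \<open>a / (2 * \<kappa>) < 1\<close> under the assumption \<open>2 * \<kappa> > a\<close>, which
  the dissipation can absorb.\<close>

lemma rate_le_full:
  assumes r: "\<bar>\<tau>\<bar> \<le> q + r" "r \<ge> 0"
  shows "\<tau>\<^sup>2 * y\<^sup>2 + y * (b * - (q^7 * (p1 + p2 * y^2 + p3 * y^6) * y) + \<theta> * v + d)
      \<le> a / (2 * \<kappa>) * n\<^sup>2 - C * y\<^sup>2
      + a / q * (d\<^sup>2 + s\<^sup>2 + (s\<^sup>2)\<^sup>2 + 4 * \<beta> * h\<^sup>2 + (r\<^sup>2)\<^sup>2)"
proof -
  have q0: "q > 0" using q pos by simp
  define Y where "Y = y\<^sup>2"
  define rate where "rate = y * (b * - (q^7 * (p1 + p2 * y^2 + p3 * y^6) * y) + \<theta> * v + d)"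
  have Y: "Y \<ge> 0" by (simp add: Y_def)
  have "n * (\<bar>\<theta>\<bar> * \<bar>y\<bar>) \<le> a / (2 * \<kappa>) * n\<^sup>2 + (2 * \<kappa>) / (4 * a) * (\<bar>\<theta>\<bar> * \<bar>y\<bar>)\<^sup>2"
    using pos by (intro young) auto
  also have "(2 * \<kappa>) / (4 * a) * (\<bar>\<theta>\<bar> * \<bar>y\<bar>)\<^sup>2 = \<kappa> / (2 * a) * (\<theta>\<^sup>2 * Y)"
    by (simp add: Y_def power_mult_distrib)
  also have "\<dots> \<le> \<kappa> / (2 * a) * ((2 * q\<^sup>2 + 2 * s\<^sup>2) * Y)"
    using \<theta>_square pos Y by (intro mult_left_mono mult_right_mono) auto
  also have "\<dots> = \<kappa> / a * q\<^sup>2 * Y + s\<^sup>2 * (\<kappa> / a * Y)" using pos by (simp add: field_simps)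
  \<comment> \<open>The squared excess \<open>s\<^sup>2\<close> itself plays the part of
    \<open>u\<close> here, which is why fourth powers of the excesses, i.e. squares of
    \<open>g\<close>, occur in \<open>Z\<close>.\<close>
  also have "s\<^sup>2 * (\<kappa> / a * Y) \<le> a / q * (s\<^sup>2)\<^sup>2 + q / (4 * a) * (\<kappa> / a * Y)\<^sup>2"
    using pos q0 by (intro young)
  finally have L: "\<bar>\<theta>\<bar> * \<bar>y\<bar> * n \<le> a / (2 * \<kappa>) * n\<^sup>2 + \<kappa> / a * q\<^sup>2 * Y
      + a / q * (s\<^sup>2)\<^sup>2 + q / (4 * a) * (\<kappa> / a * Y)\<^sup>2" by (simp add: mult.commute)
  have "\<tau>\<^sup>2 \<le> (q + r)\<^sup>2" using power_mono[OF r(1), of 2] by simp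
  also have "\<dots> \<le> 2 * q\<^sup>2 + 2 * r\<^sup>2" using sum_squares_bound[of q r] by (simp add: power2_sum)
  finally have "\<tau>\<^sup>2 * Y \<le> (2 * q\<^sup>2 + 2 * r\<^sup>2) * Y" using Y by (rule mult_right_mono)
  also have "\<dots> = 2 * q\<^sup>2 * Y + r\<^sup>2 * (2 * Y)" by (simp add: algebra_simps)
  also have "r\<^sup>2 * (2 * Y) \<le> a / q * (r\<^sup>2)\<^sup>2 + q / (4 * a) * (2 * Y)\<^sup>2" using pos q0 by (intro young)
  finally have T: "\<tau>\<^sup>2 * Y \<le> 2 * q\<^sup>2 * Y + a / q * (r\<^sup>2)\<^sup>2 + q / (4 * a) * (2 * Y)\<^sup>2" by simp
  define A where "A = C + q / (4 * a) + f * q + \<kappa> / a * q\<^sup>2"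
  define D where "D = q / (4 * a) * f\<^sup>2 + q / (4 * a) * (\<kappa> / a)\<^sup>2"
  note scale = scale_le[OF q, of _ 0, unfolded power_0 mult_1]
    scale_le[OF q, of _ 1, unfolded power_one_right] scale_le[OF q, of _ 2]
  \<comment> \<open>Each summand becomes a power of \<open>q / \<kappa>\<close> times the matching
    summand of \<open>\<alpha>\<close>; since \<open>q / \<kappa> \<ge> 1\<close>, all powers can be
    raised to the third.\<close>
  have A_eq: "A = C + q / \<kappa> * (\<kappa> / (4 * a)) + q / \<kappa> * (\<kappa> * f) + (q / \<kappa>)^2 * (\<kappa>^3 / a)"
    using pos by (simp add: A_def power_divide eval_nat_numeral)
  have A: "0 \<le> A" "A \<le> (q / \<kappa>)^3 * \<alpha>"
  proof -
    show "0 \<le> A" using pos f q0 by (simp add: A_def)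
    have "C \<ge> 0" "\<kappa> / (4 * a) \<ge> 0" "\<kappa> * f \<ge> 0" "\<kappa>^3 / a \<ge> 0" using pos f by simp_all
    then show "A \<le> (q / \<kappa>)^3 * \<alpha>"
      using scale(1)[of C] scale(2)[of "\<kappa> / (4 * a)"] scale(2)[of "\<kappa> * f"] scale(3)[of "\<kappa>^3 / a"]
      unfolding A_eq \<alpha>_def distrib_left by linarith
  qed
  have D_eq: "D = q / \<kappa> * \<Delta>"
    using pos by (simp add: D_def \<Delta>_def power_divide distrib_left eval_nat_numeral)
  have D: "0 \<le> D" "D \<le> (q / \<kappa>)^3 * \<Delta>"
    using scale(2)[of \<Delta>] \<Delta>_nonneg pos q0 by (simp_all add: D_eq)
  have "A * Y + D * Y\<^sup>2 + 2 * q\<^sup>2 * Y + q / a * Y\<^sup>2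
      \<le> \<beta> * q^7 * (p1 + p2 * Y + p3 * Y^3) * Y + a / q * (4 * \<beta> * h\<^sup>2)"
    using gain_dominates(1)[OF q \<beta>(1) h Y A D] by (simp add: algebra_simps)
  moreover have "A * Y + D * Y\<^sup>2 + 2 * q\<^sup>2 * Y + q / a * Y\<^sup>2 = C * Y + q / (4 * a) * Y + f * q * Y
      + \<kappa> / a * q\<^sup>2 * Y + q / (4 * a) * f\<^sup>2 * Y\<^sup>2 + q / (4 * a) * (\<kappa> / a * Y)\<^sup>2 + 2 * q\<^sup>2 * Y
      + q / (4 * a) * (2 * Y)\<^sup>2"
    by (simp add: A_def D_def algebra_simps power_mult_distrib power_divide)
  moreover have "rate \<le> - (\<beta> * q^7 * (p1 + p2 * Y + p3 * Y^3) * Y)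
    + \<bar>\<theta>\<bar> * \<bar>y\<bar> * n + f * q * Y + a / q * s\<^sup>2 + q / (4 * a) * f\<^sup>2 * Y\<^sup>2
    + a / q * d\<^sup>2 + q / (4 * a) * Y"
    using rate_le by (simp add: Y_def rate_def)
  moreover have "a / q * (d\<^sup>2 + s\<^sup>2 + (s\<^sup>2)\<^sup>2 + 4 * \<beta> * h\<^sup>2 + (r\<^sup>2)\<^sup>2)
      = a / q * d\<^sup>2 + a / q * s\<^sup>2 + a / q * (s\<^sup>2)\<^sup>2 + a / q * (4 * \<beta> * h\<^sup>2) + a / q * (r\<^sup>2)\<^sup>2"
    by (simp add: distrib_left)
  ultimately show ?thesis
    using L T unfolding rate_def[symmetric] unfolding Y_def[symmetric] by linarith
qed

text \<open>The version for the adaptation: with the weight \<open>2 * q\<close> even the coupling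
  with \<open>n\<close> carries the factor \<open>a / q\<close> and fades as the gain grows. The
  price is a coefficient \<open>q^3 / a\<close>, the highest power of \<open>q\<close> that the
  feedback has to match.\<close>

lemma rate_le_decoupled:
  "y * (b * - (q^7 * (p1 + p2 * y^2 + p3 * y^6) * y) + \<theta> * v + d)
    \<le> - C * y\<^sup>2 + a / q * (n\<^sup>2 / 2 + s\<^sup>2 + d\<^sup>2 + (s\<^sup>2)\<^sup>2 + 2 * \<beta> * h\<^sup>2)"
proof -
  have q0: "q > 0" using q pos by simp
  define Y where "Y = y\<^sup>2"
  define rate where "rate = y * (b * - (q^7 * (p1 + p2 * y^2 + p3 * y^6) * y) + \<theta> * v + d)"
  have Y: "Y \<ge> 0" by (simp add: Y_def)
  have "n * (\<bar>\<theta>\<bar> * \<bar>y\<bar>) \<le> a / (2 * q) * n\<^sup>2 + (2 * q) / (4 * a) * (\<bar>\<theta>\<bar> * \<bar>y\<bar>)\<^sup>2"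
    using pos q0 by (intro young) auto
  also have "(2 * q) / (4 * a) * (\<bar>\<theta>\<bar> * \<bar>y\<bar>)\<^sup>2 = q / (2 * a) * (\<theta>\<^sup>2 * Y)"
    by (simp add: Y_def power_mult_distrib)
  also have "\<dots> \<le> q / (2 * a) * ((2 * q\<^sup>2 + 2 * s\<^sup>2) * Y)"
    using \<theta>_square pos q0 Y by (intro mult_left_mono mult_right_mono) auto
  also have "\<dots> = q^3 / a * Y + s\<^sup>2 * (q / a * Y)" using pos by (simp add: field_simps eval_nat_numeral)
  also have "s\<^sup>2 * (q / a * Y) \<le> a / q * (s\<^sup>2)\<^sup>2 + q / (4 * a) * (q / a * Y)\<^sup>2"
    using pos q0 by (intro young)
  finally have L: "\<bar>\<theta>\<bar> * \<bar>y\<bar> * n \<le> a / q * (n\<^sup>2 / 2) + q^3 / a * Y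
      + a / q * (s\<^sup>2)\<^sup>2 + q / (4 * a) * (q / a * Y)\<^sup>2" by (simp add: mult.commute)
  define A where "A = C + q / (4 * a) + f * q + q^3 / a"
  define D where "D = q / (4 * a) * f\<^sup>2 + q / (4 * a) * (q / a)\<^sup>2"
  note scale = scale_le[OF q, of _ 0, unfolded power_0 mult_1]
    scale_le[OF q, of _ 1, unfolded power_one_right]
  have A_eq: "A = C + q / \<kappa> * (\<kappa> / (4 * a)) + q / \<kappa> * (\<kappa> * f) + (q / \<kappa>)^3 * (\<kappa>^3 / a)"
    using pos by (simp add: A_def power_divide eval_nat_numeral)
  have A: "0 \<le> A" "A \<le> (q / \<kappa>)^3 * \<alpha>"
  proof -
    show "0 \<le> A" using pos f q0 by (simp add: A_def)
    have "C \<ge> 0" "\<kappa> / (4 * a) \<ge> 0" "\<kappa> * f \<ge> 0" "\<kappa>^3 / a \<ge> 0" using pos f by simp_all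
    then show "A \<le> (q / \<kappa>)^3 * \<alpha>"
      using scale(1)[of C] scale(2)[of "\<kappa> / (4 * a)"] scale(2)[of "\<kappa> * f"]
      unfolding A_eq \<alpha>_def distrib_left by linarith
  qed
  have D_eq: "D = q / \<kappa> * (\<kappa> * (f\<^sup>2 / (4 * a))) + (q / \<kappa>)^3 * (\<kappa> * (\<kappa>\<^sup>2 / (4 * a^3)))"
    using pos by (simp add: D_def power_divide eval_nat_numeral)
  have D: "0 \<le> D" "D \<le> (q / \<kappa>)^3 * \<Delta>"
    using scale(2)[of "\<kappa> * (f\<^sup>2 / (4 * a))"] pos q0
    unfolding D_eq \<Delta>_def distrib_left by simp_all
  have "A * Y + D * Y\<^sup>2 \<le> \<beta> * q^7 * (p1 + p2 * Y + p3 * Y^3) * Y + a / q * (2 * \<beta> * h\<^sup>2)"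
    by (rule gain_dominates(2)[OF q \<beta>(1) h Y A D])
  moreover have "A * Y + D * Y\<^sup>2 = C * Y + q / (4 * a) * Y + f * q * Y
      + q^3 / a * Y + q / (4 * a) * f\<^sup>2 * Y\<^sup>2 + q / (4 * a) * (q / a * Y)\<^sup>2"
    by (simp add: A_def D_def algebra_simps power_mult_distrib power_divide)
  moreover have "rate \<le> - (\<beta> * q^7 * (p1 + p2 * Y + p3 * Y^3) * Y)
    + \<bar>\<theta>\<bar> * \<bar>y\<bar> * n + f * q * Y + a / q * s\<^sup>2 + q / (4 * a) * f\<^sup>2 * Y\<^sup>2
    + a / q * d\<^sup>2 + q / (4 * a) * Y"
    using rate_le by (simp add: Y_def rate_def)
  moreover have "a / q * (n\<^sup>2 / 2 + s\<^sup>2 + d\<^sup>2 + (s\<^sup>2)\<^sup>2 + 2 * \<beta> * h\<^sup>2)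
      = a / q * (n\<^sup>2 / 2) + a / q * s\<^sup>2 + a / q * d\<^sup>2 + a / q * (s\<^sup>2)\<^sup>2 + a / q * (2 * \<beta> * h\<^sup>2)"
    by (simp only: distrib_left)
  ultimately show ?thesis
    using L unfolding rate_def[symmetric] unfolding Y_def[symmetric] by linarith
qed

end

end

section \<open>Dynamics of the closed loop\<close>

text \<open>As long as \<open>1 + E < c / (2 C \<epsilon>)\<close> there is nothing to prove. Afterwards
  \<open>X' \<le> - 2 C (X - \<epsilon>)\<close>, so the increase of \<open>E\<close> is paid for by the decrease of \<open>X\<close>
  until \<open>X\<close> enters \<open>[0, \<epsilon>]\<close>, which it does not leave again.\<close>

lemma adaptation_bound:
  fixes X E :: "real \<Rightarrow> real"
  assumes pos: "\<epsilon> > 0" "\<Gamma> > 0" "C > 0" "c \<ge> 0" and X0: "X 0 \<ge> 0" and E0: "E 0 \<ge> 0"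
    and X: "loc_abs_continuous X" "continuous_on {0..} X"
    and E: "loc_abs_continuous E" "continuous_on {0..} E"
    and E_eq: "AE t in lebesgue. 0 \<le> t \<longrightarrow>
      (E has_real_derivative \<Gamma> * max (X t - \<epsilon>) 0) (at t within {0..})"
    and E_mono: "\<And>s t. 0 \<le> s \<Longrightarrow> s \<le> t \<Longrightarrow> E s \<le> E t"
    and X_eq: "AE t in lebesgue. 0 \<le> t \<longrightarrow>
      (\<exists>D. (X has_real_derivative D) (at t within {0..}) \<and> D \<le> c / (1 + E t) - 2 * C * X t)"
    and t: "t \<ge> 0"
  shows "E t \<le> E 0 + \<Gamma> / (2 * C) * X 0
    + c * ((2 * C * (1 + E 0) + \<epsilon> * \<Gamma>) / (4 * C\<^sup>2 * \<epsilon> * (1 + E 0)))"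
proof -
  \<comment> \<open>The first summand is the level \<open>E\<close> may reach before the decay of
    \<open>X\<close> is guaranteed; the second is \<open>\<Gamma> / (2 * C)\<close> times the
    largest possible gain of \<open>X\<close> over \<open>X 0\<close>.\<close>
  have rhs: "c * ((2 * C * (1 + E 0) + \<epsilon> * \<Gamma>) / (4 * C\<^sup>2 * \<epsilon> * (1 + E 0)))
      = c / (2 * C * \<epsilon>) + \<Gamma> / (2 * C) * (c / (2 * C * (1 + E 0)))"
  proof -
    have "c * ((2 * C * u + \<epsilon> * \<Gamma>) / (4 * C\<^sup>2 * \<epsilon> * u))
        = c / (2 * C * \<epsilon>) + \<Gamma> / (2 * C) * (c / (2 * C * u))" if "u > 0" for u
      using pos that by (simp add: field_simps power2_eq_square)
    then show ?thesis using E0 by (simp add: add_pos_nonneg)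
  qed
  have X_le: "X s \<le> X 0 + c / (2 * C * (1 + E 0))" if s: "s \<ge> 0" for s
  proof -
    have "X s \<le> exp (- (2 * C) * (s - 0)) * (X 0 - c / (1 + E 0) / (2 * C)) + c / (1 + E 0) / (2 * C)"
    proof (rule loc_abs_continuous_gronwall[OF X _ _ s])
      show "AE x in lebesgue. 0 \<le> x \<and> x \<le> s \<longrightarrow>
        (\<exists>D. (X has_real_derivative D) (at x within {0..}) \<and> D \<le> c / (1 + E 0) - 2 * C * X x)"
        using X_eq
      proof (eventually_elim, intro impI)
        fix x assume *: "0 \<le> x \<longrightarrow> (\<exists>D. (X has_real_derivative D) (at x within {0..}) \<and>
          D \<le> c / (1 + E x) - 2 * C * X x)" and x: "0 \<le> x \<and> x \<le> s"
        have "c / (1 + E x) \<le> c / (1 + E 0)"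
          using pos E0 E_mono[of 0 x] x by (intro divide_left_mono) auto
        then show "\<exists>D. (X has_real_derivative D) (at x within {0..}) \<and> D \<le> c / (1 + E 0) - 2 * C * X x"
          using * x by force
      qed
    qed (use pos in auto)
    also have "\<dots> \<le> 1 * X 0 + c / (1 + E 0) / (2 * C)"
    proof -
      have "exp (- (2 * C) * (s - 0)) * X 0 \<le> 1 * X 0"
        using X0 pos s by (intro mult_right_mono) auto
      moreover have "exp (- (2 * C) * (s - 0)) * (c / (1 + E 0) / (2 * C)) \<ge> 0"
        using pos E0 by simp
      ultimately show ?thesis by (simp add: right_diff_distrib)
    qed
    finally show ?thesis by (simp add: mult.commute)
  qed
  \<comment> \<open>\<open>c / (2 * C * \<epsilon>)\<close> is the value of \<open>1 + E\<close> at
    which the forcing \<open>c / (1 + E)\<close> drops to \<open>2 * C * \<epsilon>\<close>. The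
    maximum with \<open>1 + E 0\<close> puts the level above the initial value, so that the
    intermediate value theorem applies.\<close>
  define M where "M = max (1 + E 0) (c / (2 * C * \<epsilon>))"
  have M_le: "M \<le> 1 + E 0 + c / (2 * C * \<epsilon>)" using pos E0 by (simp add: M_def)
  have c_le: "c \<le> 2 * C * \<epsilon> * M"
  proof -
    have "c / (2 * C * \<epsilon>) \<le> M" by (simp add: M_def)
    then show ?thesis using pos by (simp add: pos_divide_le_eq mult.commute)
  qed
  have frac: "\<Gamma> / (2 * C) * X 0 \<ge> 0" "\<Gamma> / (2 * C) * (c / (2 * C * (1 + E 0))) \<ge> 0"
    using pos X0 E0 by simp_all
  show ?thesis
  proof (cases "1 + E t \<le> M")
    case True
    then show ?thesis unfolding rhs using M_le frac by linarith
  next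
    case False
    have "\<exists>x\<ge>0. x \<le> t \<and> E x = M - 1"
      using False t by (intro IVT') (auto simp: M_def intro: continuous_on_subset[OF E(2)])
    then obtain \<tau> where \<tau>: "0 \<le> \<tau>" "\<tau> \<le> t" "E \<tau> = M - 1" by blast
    have decay: "AE x in lebesgue. \<tau> \<le> x \<longrightarrow>
        (\<exists>D. (X has_real_derivative D) (at x within {0..}) \<and> D \<le> 2 * C * \<epsilon> - 2 * C * X x)"
      using X_eq
    proof (eventually_elim, intro impI)
      fix x assume *: "0 \<le> x \<longrightarrow> (\<exists>D. (X has_real_derivative D) (at x within {0..}) \<and>
        D \<le> c / (1 + E x) - 2 * C * X x)" and x: "\<tau> \<le> x"
      have "1 + E x \<ge> M" using E_mono[of \<tau> x] x \<tau> by simp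
      moreover have "M > 0" using E0 by (simp add: M_def less_max_iff_disj)
      ultimately have "c / (1 + E x) \<le> c / M" using pos by (intro divide_left_mono) auto
      also have "\<dots> \<le> 2 * C * \<epsilon>" using c_le \<open>M > 0\<close> by (simp add: divide_le_eq)
      finally show "\<exists>D. (X has_real_derivative D) (at x within {0..}) \<and> D \<le> 2 * C * \<epsilon> - 2 * C * X x"
        using * x \<tau> by force
    qed
    have decay_le: "X x' - \<epsilon> \<le> exp (- (2 * C) * (x' - x)) * (X x - \<epsilon>)" if "\<tau> \<le> x" "x \<le> x'" for x x'
    proof -
      have "X x' \<le> exp (- (2 * C) * (x' - x)) * (X x - 2 * C * \<epsilon> / (2 * C)) + 2 * C * \<epsilon> / (2 * C)"
        by (rule loc_abs_continuous_gronwall[OF X])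
          (use that \<tau> pos decay in \<open>auto elim!: eventually_mono\<close>)
      then show ?thesis using pos by simp
    qed
    have stays: "X x' \<le> \<epsilon>" if "\<tau> \<le> x" "x \<le> x'" "X x \<le> \<epsilon>" for x x'
    proof -
      have "exp (- (2 * C) * (x' - x)) * (X x - \<epsilon>) \<le> 0"
        using that by (intro mult_nonneg_nonpos) auto
      then show ?thesis using decay_le[OF that(1,2)] by linarith
    qed
    have rest: "E t \<le> E x" if "\<tau> \<le> x" "x \<le> t" "X x \<le> \<epsilon>" for x
    proof (rule loc_abs_continuous_decreasing[OF E(1)])
      show "AE s in lebesgue. x \<le> s \<and> s \<le> t \<longrightarrow>
        (\<exists>D. (E has_real_derivative D) (at s within {0..}) \<and> D \<le> 0)"
        using E_eq
      proof (eventually_elim, intro impI)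
        fix s assume *: "0 \<le> s \<longrightarrow> (E has_real_derivative \<Gamma> * max (X s - \<epsilon>) 0) (at s within {0..})"
          and s: "x \<le> s \<and> s \<le> t"
        then have "X s \<le> \<epsilon>" using stays[of x s] that by auto
        then show "\<exists>D. (E has_real_derivative D) (at s within {0..}) \<and> D \<le> 0"
          using * s that \<tau> by (intro exI[of _ "\<Gamma> * max (X s - \<epsilon>) 0"]) (auto simp: max_def)
      qed
    qed (use that \<tau> in auto)
    have pay: "E x + \<Gamma> / (2 * C) * X x \<le> E \<tau> + \<Gamma> / (2 * C) * X \<tau>"
      if x: "\<tau> \<le> x" and above: "\<And>s. \<tau> \<le> s \<Longrightarrow> s \<le> x \<Longrightarrow> X s \<ge> \<epsilon>" for x
    proof (rule loc_abs_continuous_decreasing[where f = "\<lambda>x. E x + \<Gamma> / (2 * C) * X x"])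
      show "loc_abs_continuous (\<lambda>x. E x + \<Gamma> / (2 * C) * X x)"
        by (intro loc_abs_continuous_add loc_abs_continuous_cmult E X)
      show "AE s in lebesgue. \<tau> \<le> s \<and> s \<le> x \<longrightarrow>
        (\<exists>D. ((\<lambda>x. E x + \<Gamma> / (2 * C) * X x) has_real_derivative D) (at s within {0..}) \<and> D \<le> 0)"
        using E_eq decay
      proof (eventually_elim, intro impI)
        fix s assume *: "0 \<le> s \<longrightarrow> (E has_real_derivative \<Gamma> * max (X s - \<epsilon>) 0) (at s within {0..})"
          and **: "\<tau> \<le> s \<longrightarrow> (\<exists>D. (X has_real_derivative D) (at s within {0..}) \<and>
            D \<le> 2 * C * \<epsilon> - 2 * C * X s)"
          and s: "\<tau> \<le> s \<and> s \<le> x"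
        obtain D where D: "(X has_real_derivative D) (at s within {0..})" "D \<le> 2 * C * \<epsilon> - 2 * C * X s"
          using ** s by blast
        have "\<Gamma> / (2 * C) * D \<le> \<Gamma> / (2 * C) * (2 * C * \<epsilon> - 2 * C * X s)"
          using D(2) pos by (intro mult_left_mono) auto
        also have "\<dots> = - (\<Gamma> * (X s - \<epsilon>))" using pos by (simp add: field_simps)
        finally have "\<Gamma> * max (X s - \<epsilon>) 0 + \<Gamma> / (2 * C) * D \<le> 0"
          using above[of s] s by (subst max_absorb1) simp_all
        moreover have "((\<lambda>x. E x + \<Gamma> / (2 * C) * X x) has_real_derivative
            \<Gamma> * max (X s - \<epsilon>) 0 + \<Gamma> / (2 * C) * D) (at s within {0..})"
          using * s \<tau> by (intro DERIV_add DERIV_cmult D(1)) auto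
        ultimately show "\<exists>D. ((\<lambda>x. E x + \<Gamma> / (2 * C) * X x) has_real_derivative D) (at s within {0..}) \<and> D \<le> 0"
          by blast
      qed
    qed (use x \<tau> in auto)
    have "E t \<le> E \<tau> + \<Gamma> / (2 * C) * X \<tau> \<or> E t \<le> E \<tau>"
    proof (cases "\<exists>x. \<tau> \<le> x \<and> x \<le> t \<and> X x < \<epsilon>")
      case False
      then have "E t + \<Gamma> / (2 * C) * X t \<le> E \<tau> + \<Gamma> / (2 * C) * X \<tau>"
        using \<tau> by (intro pay) force+
      moreover have "\<Gamma> / (2 * C) * X t \<ge> 0" using False \<tau> pos by (intro mult_nonneg_nonneg) force+
      ultimately show ?thesis by linarith
    next
      case True
      then obtain x where x: "\<tau> \<le> x" "x \<le> t" "X x < \<epsilon>" by blast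
      show ?thesis
      proof (cases "X \<tau> \<le> \<epsilon>")
        case True
        then show ?thesis using rest[of \<tau>] \<tau> by simp
      next
        case False
        have "\<exists>s\<ge>\<tau>. s \<le> x \<and> X s = \<epsilon>"
          using False x \<tau> by (intro IVT2') (auto intro: continuous_on_subset[OF X(2)])
        then obtain s where s: "\<tau> \<le> s" "s \<le> x" "X s = \<epsilon>" by blast
        \<comment> \<open>\<open>s\<close> need not be chosen as the first time at the level
          \<open>\<epsilon>\<close>: a value strictly below \<open>\<epsilon>\<close> forces all
          later values strictly below it, so none can occur before \<open>s\<close>.\<close>
        have "X r \<ge> \<epsilon>" if r: "\<tau> \<le> r" "r \<le> s" for r
        proof (rule ccontr)
          assume "\<not> X r \<ge> \<epsilon>"
          then have "exp (- (2 * C) * (s - r)) * (X r - \<epsilon>) < 0" by (intro mult_pos_neg) auto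
          then show False using decay_le[OF r] s by simp
        qed
        then have "E s + \<Gamma> / (2 * C) * X s \<le> E \<tau> + \<Gamma> / (2 * C) * X \<tau>" using s by (intro pay)
        moreover have "\<Gamma> / (2 * C) * X s \<ge> 0" using pos s by simp
        moreover have "E t \<le> E s" using rest[of s] s x by simp
        ultimately show ?thesis by linarith
      qed
    qed
    moreover have "\<Gamma> / (2 * C) * X \<tau> \<le> \<Gamma> / (2 * C) * (X 0 + c / (2 * C * (1 + E 0)))"
      using X_le[OF \<tau>(1)] pos by (intro mult_left_mono) auto
    ultimately show ?thesis
      unfolding rhs using \<tau>(3) M_le frac by (auto simp: distrib_left)
  qed
qed

text \<open>A one-sided version of Barbalat's lemma: each visit of \<open>X\<close> to a level above \<open>\<epsilon> + e\<close>
  is preceded by an interval of fixed length on which \<open>X \<ge> \<epsilon> + e / 2\<close>, and this increases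
  the bounded function \<open>E\<close> by a fixed amount.\<close>

lemma eventually_le_deadzone:
  fixes X E :: "real \<Rightarrow> real"
  assumes pos: "\<Gamma> > 0" "c > 0"
    and X: "loc_abs_continuous X" and E: "loc_abs_continuous E"
    and E_eq: "AE t in lebesgue. 0 \<le> t \<longrightarrow>
      (E has_real_derivative \<Gamma> * max (X t - \<epsilon>) 0) (at t within {0..})"
    and lim: "(E \<longlongrightarrow> l) at_top"
    and X_eq: "AE t in lebesgue. 0 \<le> t \<longrightarrow>
      (\<exists>D. (X has_real_derivative D) (at t within {0..}) \<and> D \<le> c)"
    and e: "e > 0"
  shows "\<forall>\<^sub>F t in at_top. X t \<le> \<epsilon> + e"
proof -
  \<comment> \<open>\<open>X\<close> can climb by at most \<open>e / 2\<close> during the time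
    \<open>\<sigma>\<close>. Meanwhile \<open>E\<close> gains at least \<open>g\<close>, but two
    values within \<open>g / 2\<close> of \<open>l\<close> differ by less than
    \<open>g\<close>.\<close>
  define \<sigma> where "\<sigma> = e / (2 * c)"
  have \<sigma>: "\<sigma> > 0" "c * \<sigma> = e / 2" using e pos by (auto simp: \<sigma>_def)
  define g where "g = \<Gamma> * (e / 2) * \<sigma>"
  have g: "g > 0" using \<sigma> pos e by (simp add: g_def)
  have near: "\<forall>\<^sub>F t in at_top. dist (E t) l < g / 2"
    using g by (intro tendstoD[OF lim]) simp
  then have near': "\<forall>\<^sub>F t in at_top. dist (E (t - \<sigma>)) l < g / 2"
    using filterlim_shift[of \<sigma>] unfolding filterlim_iff by blast
  show ?thesis
    using near near' eventually_ge_at_top[of \<sigma>]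
  proof eventually_elim
    case (elim t)
    show ?case
    proof (rule ccontr)
      assume "\<not> X t \<le> \<epsilon> + e"
      then have Xt: "X t > \<epsilon> + e" by simp
      have Xs: "X s \<ge> \<epsilon> + e / 2" if s: "t - \<sigma> \<le> s" "s \<le> t" for s
      proof -
        have "X t + (- c) * t \<le> X s + (- c) * s"
        proof (rule loc_abs_continuous_decreasing[where f = "\<lambda>s. X s + (- c) * s"])
          show "loc_abs_continuous (\<lambda>s. X s + (- c) * s)"
            by (intro loc_abs_continuous_add loc_abs_continuous_cmult X loc_abs_continuous_ident)
          show "AE x in lebesgue. s \<le> x \<and> x \<le> t \<longrightarrow>
            (\<exists>D. ((\<lambda>s. X s + (- c) * s) has_real_derivative D) (at x within {0..}) \<and> D \<le> 0)"
            using X_eq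
          proof (eventually_elim, intro impI)
            fix x assume *: "0 \<le> x \<longrightarrow> (\<exists>D. (X has_real_derivative D) (at x within {0..}) \<and> D \<le> c)"
              and x: "s \<le> x \<and> x \<le> t"
            then obtain D where "(X has_real_derivative D) (at x within {0..})" "D \<le> c"
              using s elim(3) by auto
            then show "\<exists>D. ((\<lambda>s. X s + (- c) * s) has_real_derivative D) (at x within {0..}) \<and> D \<le> 0"
              by (intro exI[of _ "D - c"]) (auto intro!: derivative_eq_intros)
          qed
        qed (use s elim(3) in auto)
        moreover have "c * (t - s) \<le> c * \<sigma>" using s pos by (intro mult_left_mono) auto
        ultimately show ?thesis using Xt \<sigma> by (simp add: algebra_simps)
      qed
      have "(- 1) * E t + \<Gamma> * (e / 2) * t \<le> (- 1) * E (t - \<sigma>) + \<Gamma> * (e / 2) * (t - \<sigma>)"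
      proof (rule loc_abs_continuous_decreasing[where f = "\<lambda>s. (- 1) * E s + \<Gamma> * (e / 2) * s"])
        show "loc_abs_continuous (\<lambda>s. (- 1) * E s + \<Gamma> * (e / 2) * s)"
          by (intro loc_abs_continuous_add loc_abs_continuous_cmult E loc_abs_continuous_ident)
        show "AE x in lebesgue. t - \<sigma> \<le> x \<and> x \<le> t \<longrightarrow> (\<exists>D. ((\<lambda>s. (- 1) * E s + \<Gamma> * (e / 2) * s)
            has_real_derivative D) (at x within {0..}) \<and> D \<le> 0)"
          using E_eq
        proof (eventually_elim, intro impI)
          fix x assume *: "0 \<le> x \<longrightarrow> (E has_real_derivative \<Gamma> * max (X x - \<epsilon>) 0) (at x within {0..})"
            and x: "t - \<sigma> \<le> x \<and> x \<le> t"
          have "\<Gamma> * (e / 2) \<le> \<Gamma> * max (X x - \<epsilon>) 0"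
          proof (rule mult_left_mono)
            show "e / 2 \<le> max (X x - \<epsilon>) 0" using Xs[of x] x by (simp add: le_max_iff_disj)
          qed (use pos in simp)
          moreover have "((\<lambda>s. (- 1) * E s + \<Gamma> * (e / 2) * s) has_real_derivative
              (- 1) * (\<Gamma> * max (X x - \<epsilon>) 0) + \<Gamma> * (e / 2) * 1) (at x within {0..})"
            using * x elim(3) by (intro DERIV_add DERIV_cmult DERIV_ident) auto
          ultimately show "\<exists>D. ((\<lambda>s. (- 1) * E s + \<Gamma> * (e / 2) * s)
            has_real_derivative D) (at x within {0..}) \<and> D \<le> 0" by force
        qed
      qed (use \<sigma> elim(3) in auto)
      then have "E t \<ge> E (t - \<sigma>) + g" by (simp add: g_def algebra_simps)
      then show False using elim(1,2) unfolding dist_real_def by linarith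
    qed
  qed
qed

lemma bounded_mono_tendsto_at_top:
  fixes f :: "real \<Rightarrow> real"
  assumes mono: "\<And>s t. 0 \<le> s \<Longrightarrow> s \<le> t \<Longrightarrow> f s \<le> f t" and le: "\<And>t. 0 \<le> t \<Longrightarrow> f t \<le> B"
  shows "\<exists>l. (f \<longlongrightarrow> l) at_top \<and> (\<forall>t\<ge>0. f t \<le> l)"
proof (intro exI conjI allI impI)
  have bdd: "bdd_above (f ` {0..})" using le by (intro bdd_aboveI[of _ B]) auto
  show le_Sup: "f t \<le> Sup (f ` {0..})" if "0 \<le> t" for t
    using that by (intro cSup_upper bdd) auto
  show "(f \<longlongrightarrow> Sup (f ` {0..})) at_top"
  proof (rule order_tendstoI)
    fix x assume "x < Sup (f ` {0..})"
    then obtain s where s: "s \<ge> 0" "x < f s" using less_cSup_iff[OF _ bdd, of x] by auto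
    show "\<forall>\<^sub>F t in at_top. x < f t"
      using eventually_ge_at_top[of s]
    proof eventually_elim
      case (elim t)
      then show ?case using mono[OF s(1) elim] s(2) by simp
    qed
  next
    fix x assume x: "Sup (f ` {0..}) < x"
    show "\<forall>\<^sub>F t in at_top. f t < x"
      using eventually_ge_at_top[of 0]
    proof eventually_elim
      case (elim t)
      then show ?case using le_Sup[OF elim] x by simp
    qed
  qed
qed

lemma Limsup_ereal_leI:
  assumes "\<And>c. c > B \<Longrightarrow> \<forall>\<^sub>F x in F. f x < c"
  shows "Limsup F (\<lambda>x. ereal (f x)) \<le> ereal B"
  unfolding Limsup_le_iff
proof (intro allI impI)
  fix y assume y: "ereal B < y"
  show "\<forall>\<^sub>F x in F. ereal (f x) < y"
    using y assms by (cases y) auto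
qed

text \<open>The closed loop after elimination of the spatial variable: \<open>n\<close>, \<open>\<theta>\<close> and \<open>\<delta>\<close>
  stand for the \<open>L2\<close> norms of \<open>w\<close>, \<open>\<theta>\<^sub>1\<close> and \<open>\<delta>\<close>, and \<open>v\<close> for \<open>L(w, y)\<close>.\<close>

locale closed_loop =
  fixes p \<epsilon> \<Gamma> \<kappa> a C :: real and \<phi> P1 P2 P3 n \<theta> \<delta> y z d \<theta>2 b v :: "real \<Rightarrow> real"
  assumes p: "p > 0"
    and constants: "\<epsilon> > 0" "\<Gamma> > 0" "\<kappa> > 0" "a > 0" "C > 0" "2 * \<kappa> > a"
    and gains: "\<And>r. feedback_gains \<kappa> a C (\<phi> r) (P1 r) (P2 r) (P3 r)"
    and n_nonneg: "\<And>t. n t \<ge> 0" and \<theta>_nonneg: "\<And>t. \<theta> t \<ge> 0" and \<delta>_nonneg: "\<And>t. \<delta> t \<ge> 0"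
    and n_cont: "continuous_on {0..} n" and n_ac: "loc_abs_continuous (\<lambda>t. (n t)\<^sup>2)"
    and y_cont: "continuous_on {0..} y" and y_ac: "loc_abs_continuous y"
    and z_C1: "C1_halfline z"
    and n_eq: "AE t in lebesgue. 0 \<le> t \<longrightarrow>
      (\<exists>D. ((\<lambda>t. (n t)\<^sup>2) has_real_derivative D) (at t within {0..}) \<and>
        D \<le> 2 * (- p * pi\<^sup>2 * (n t)\<^sup>2 + \<bar>y t\<bar> * n t * \<theta> t + n t * \<delta> t))"
    and y_eq: "AE t in lebesgue. 0 \<le> t \<longrightarrow>
      (y has_real_derivative
        b t * - ((\<kappa> + exp (z t))^7 * (P1 (y t) + P2 (y t) * (y t)^2 + P3 (y t) * (y t)^6) * y t)
        + \<theta>2 t * v t + d t) (at t within {0..}) \<and> \<bar>v t\<bar> \<le> n t + \<phi> (y t) * \<bar>y t\<bar>"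
    and z_eq: "AE t in lebesgue. 0 \<le> t \<longrightarrow>
      (z has_real_derivative \<Gamma> * exp (- z t) * max (1/2 * (y t)^2 - \<epsilon>) 0) (at t within {0..})"
begin

text \<open>In this variable the adaptation law loses the factor \<open>exp (- z)\<close>: the rate
  of \<open>E\<close> depends on \<open>X\<close> alone, and the gain is
  \<open>\<kappa> + E\<close>.\<close>

definition E where "E t = exp (z t)"
definition X where "X t = (y t)\<^sup>2 / 2"
definition W where "W t = (n t)\<^sup>2 / (2 * p) + X t"
definition G where "G = 1 / (p\<^sup>2 * (4 * pi\<^sup>2 - 5))"
text \<open>The first entry is \<open>(2 * \<kappa> - a) / (2 * \<kappa> * k2)\<close> for
  \<open>k2 = 1 / (2 * p)\<close>: the decay rate of \<open>n\<^sup>2 / (2 * p)\<close> after the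
  coupling has taken its share. The second is the decay rate of \<open>X\<close>.\<close>

definition \<mu> where "\<mu> = min ((2 * \<kappa> - a) * p / \<kappa>) (2 * C)"

lemma E_pos: "E t > 0" by (simp add: E_def)

lemma X_nonneg: "X t \<ge> 0" by (simp add: X_def)

lemma W_nonneg: "W t \<ge> 0" using p X_nonneg by (simp add: W_def)

lemma \<mu>_pos: "\<mu> > 0" using constants p by (simp add: \<mu>_def)

lemma G_nonneg: "G \<ge> 0"
proof -
  have "2\<^sup>2 \<le> pi\<^sup>2" by (intro power_mono pi_ge_two) simp
  then show ?thesis by (simp add: G_def)
qed

lemma n_sq_cont: "continuous_on {0..} (\<lambda>t. (n t)\<^sup>2)"
  by (intro continuous_intros n_cont)

lemma X_ac: "loc_abs_continuous X"
  using loc_abs_continuous_cmult[OF loc_abs_continuous_mult[OF y_ac y_ac y_cont y_cont], of "1 / 2"]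
  by (simp add: X_def[abs_def] power2_eq_square)

lemma X_cont: "continuous_on {0..} X"
  unfolding X_def[abs_def] by (intro continuous_intros y_cont) simp

lemma W_ac: "loc_abs_continuous W"
  using loc_abs_continuous_add[OF loc_abs_continuous_cmult[OF n_ac, of "1 / (2 * p)"] X_ac]
  by (simp add: W_def[abs_def])

lemma W_cont: "continuous_on {0..} W"
  unfolding W_def[abs_def] using p by (intro continuous_intros n_cont X_cont) simp

lemma z_cont: "continuous_on {0..} z"
proof -
  obtain z' where "\<And>t. t \<ge> 0 \<Longrightarrow> (z has_real_derivative z' t) (at t within {0..})"
    using z_C1 unfolding C1_halfline_def by blast
  then show ?thesis by (intro DERIV_continuous_on) auto
qed

lemma E_cont: "continuous_on {0..} E"
  unfolding E_def[abs_def] by (intro continuous_intros z_cont)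

text \<open>The differential equation holds only almost everywhere and cannot give absolute
  continuity; the assumption that \<open>z\<close> is continuously differentiable does.\<close>

lemma E_ac: "loc_abs_continuous E"
  unfolding loc_abs_continuous_def
proof (intro allI impI)
  fix T :: real assume "T > 0"
  obtain z' where z': "continuous_on {0..} z'" "\<And>t. t \<ge> 0 \<Longrightarrow> (z has_real_derivative z' t) (at t within {0..})"
    using z_C1 unfolding C1_halfline_def by blast
  show "abs_continuous_on 0 T E"
  proof (rule abs_continuous_on_C1)
    show "continuous_on {0..T} (\<lambda>t. exp (z t) * z' t)"
      by (intro continuous_intros continuous_on_subset[OF z_cont] continuous_on_subset[OF z'(1)]) auto
    fix t assume t: "t \<in> {0..T}"
    have "(z has_real_derivative z' t) (at t within {0..T})"
      by (rule DERIV_subset[OF z'(2)]) (use t in auto)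
    then show "(E has_real_derivative exp (z t) * z' t) (at t within {0..T})"
      unfolding E_def[abs_def] by (auto intro!: derivative_eq_intros)
  qed
qed

lemma E_eq: "AE t in lebesgue. 0 \<le> t \<longrightarrow>
  (E has_real_derivative \<Gamma> * max (X t - \<epsilon>) 0) (at t within {0..})"
  using z_eq
proof (eventually_elim, intro impI)
  fix t :: real
  assume *: "0 \<le> t \<longrightarrow> (z has_real_derivative \<Gamma> * exp (- z t) * max (1/2 * (y t)^2 - \<epsilon>) 0) (at t within {0..})"
    and t: "0 \<le> t"
  have "(E has_real_derivative exp (z t) * (\<Gamma> * exp (- z t) * max (1/2 * (y t)^2 - \<epsilon>) 0)) (at t within {0..})"
    unfolding E_def[abs_def] using * t by (auto intro!: derivative_eq_intros)
  moreover have "exp (z t) * (\<Gamma> * exp (- z t) * max (1/2 * (y t)^2 - \<epsilon>) 0) = \<Gamma> * max (X t - \<epsilon>) 0"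
    by (simp add: X_def exp_minus)
  ultimately show "(E has_real_derivative \<Gamma> * max (X t - \<epsilon>) 0) (at t within {0..})" by (simp only:)
qed

lemma E_mono:
  assumes "0 \<le> s" "s \<le> t"
  shows "E s \<le> E t"
proof -
  have "(- 1) * E t \<le> (- 1) * E s"
  proof (rule loc_abs_continuous_decreasing[where f = "\<lambda>t. (- 1) * E t", OF _ assms])
    show "loc_abs_continuous (\<lambda>t. (- 1) * E t)" by (intro loc_abs_continuous_cmult E_ac)
    show "AE x in lebesgue. s \<le> x \<and> x \<le> t \<longrightarrow>
      (\<exists>D. ((\<lambda>t. (- 1) * E t) has_real_derivative D) (at x within {0..}) \<and> D \<le> 0)"
      using E_eq
    proof (eventually_elim, intro impI)
      fix x assume *: "0 \<le> x \<longrightarrow> (E has_real_derivative \<Gamma> * max (X x - \<epsilon>) 0) (at x within {0..})"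
        and x: "s \<le> x \<and> x \<le> t"
      have "((\<lambda>t. (- 1) * E t) has_real_derivative (- 1) * (\<Gamma> * max (X x - \<epsilon>) 0)) (at x within {0..})"
        using * x assms by (intro DERIV_cmult) auto
      moreover have "(- 1) * (\<Gamma> * max (X x - \<epsilon>) 0) \<le> 0" using constants by simp
      ultimately show "\<exists>D. ((\<lambda>t. (- 1) * E t) has_real_derivative D) (at x within {0..}) \<and> D \<le> 0"
        by blast
    qed
  qed
  then show ?thesis by simp
qed

text \<open>The splitting \<open>\<pi>\<^sup>2 = 1 + 1/4 + (4 \<pi>\<^sup>2 - 5) / 4\<close> leaves the coefficient \<open>1\<close>
  for the dissipation of \<open>n\<^sup>2\<close> after both cross terms have been absorbed.\<close>

lemma n_rate: "AE t in lebesgue. 0 \<le> t \<longrightarrow>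
  (\<exists>D. ((\<lambda>t. (n t)\<^sup>2) has_real_derivative D) (at t within {0..}) \<and>
    D / (2 * p) \<le> - (n t)\<^sup>2 + (\<theta> t / p)\<^sup>2 * (y t)\<^sup>2 + G * (\<delta> t)\<^sup>2)"
  using n_eq
proof (eventually_elim, intro impI)
  fix t :: real
  assume "0 \<le> t \<longrightarrow> (\<exists>D. ((\<lambda>t. (n t)\<^sup>2) has_real_derivative D) (at t within {0..}) \<and>
        D \<le> 2 * (- p * pi\<^sup>2 * (n t)\<^sup>2 + \<bar>y t\<bar> * n t * \<theta> t + n t * \<delta> t))" and "0 \<le> t"
  then obtain D where D: "((\<lambda>t. (n t)\<^sup>2) has_real_derivative D) (at t within {0..})"
    "D \<le> 2 * (- p * pi\<^sup>2 * (n t)\<^sup>2 + \<bar>y t\<bar> * n t * \<theta> t + n t * \<delta> t)" by blast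
  define P where "P = 4 * pi\<^sup>2 - 5"
  have "2\<^sup>2 \<le> pi\<^sup>2" by (intro power_mono pi_ge_two) simp
  then have P: "P > 0" by (simp add: P_def)
  have "D / (2 * p) \<le> (2 * (- p * pi\<^sup>2 * (n t)\<^sup>2 + \<bar>y t\<bar> * n t * \<theta> t + n t * \<delta> t)) / (2 * p)"
    using D(2) p by (intro divide_right_mono) auto
  also have "\<dots> = - pi\<^sup>2 * (n t)\<^sup>2 + (\<theta> t / p * \<bar>y t\<bar>) * n t + \<delta> t / p * n t"
    using p by (simp add: field_simps)
  \<comment> \<open>The weight \<open>4 * pi\<^sup>2 - 5\<close> is all the dissipation left for
    \<open>\<delta>\<close>; its reciprocal, divided by \<open>p\<^sup>2\<close>, is
    \<open>G\<close>.\<close>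
  also have "\<delta> t / p * n t \<le> 1 / P * (\<delta> t / p)\<^sup>2 + P / (4 * 1) * (n t)\<^sup>2"
    by (rule young) (use P in auto)
  also have "(\<theta> t / p * \<bar>y t\<bar>) * n t \<le> 1 / 1 * (\<theta> t / p * \<bar>y t\<bar>)\<^sup>2 + 1 / (4 * 1) * (n t)\<^sup>2"
    by (rule young) auto
  finally have "D / (2 * p) \<le> - pi\<^sup>2 * (n t)\<^sup>2 + ((\<theta> t / p * \<bar>y t\<bar>)\<^sup>2 + 1 / 4 * (n t)\<^sup>2)
      + (1 / P * (\<delta> t / p)\<^sup>2 + P / 4 * (n t)\<^sup>2)" by simp
  also have "P / 4 * (n t)\<^sup>2 = pi\<^sup>2 * (n t)\<^sup>2 - 5 / 4 * (n t)\<^sup>2"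
    by (simp add: P_def algebra_simps diff_divide_distrib)
  also have "- pi\<^sup>2 * (n t)\<^sup>2 + ((\<theta> t / p * \<bar>y t\<bar>)\<^sup>2 + 1 / 4 * (n t)\<^sup>2)
      + (1 / P * (\<delta> t / p)\<^sup>2 + (pi\<^sup>2 * (n t)\<^sup>2 - 5 / 4 * (n t)\<^sup>2))
      = - (n t)\<^sup>2 + (\<theta> t / p)\<^sup>2 * (y t)\<^sup>2 + G * (\<delta> t)\<^sup>2"
    by (simp add: G_def power_mult_distrib power_divide flip: P_def)
  finally show "\<exists>D. ((\<lambda>t. (n t)\<^sup>2) has_real_derivative D) (at t within {0..}) \<and>
    D / (2 * p) \<le> - (n t)\<^sup>2 + (\<theta> t / p)\<^sup>2 * (y t)\<^sup>2 + G * (\<delta> t)\<^sup>2"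
    using D(1) by blast
qed

lemma X_eq: "AE t in lebesgue. 0 \<le> t \<longrightarrow>
  (X has_real_derivative y t * (b t * - ((\<kappa> + E t)^7 * (P1 (y t) + P2 (y t) * (y t)^2
    + P3 (y t) * (y t)^6) * y t) + \<theta>2 t * v t + d t)) (at t within {0..})
    \<and> \<bar>v t\<bar> \<le> n t + \<phi> (y t) * \<bar>y t\<bar>"
  using y_eq
proof (eventually_elim, intro impI conjI)
  fix t :: real
  define Y where "Y = b t * - ((\<kappa> + E t)^7 * (P1 (y t) + P2 (y t) * (y t)^2
    + P3 (y t) * (y t)^6) * y t) + \<theta>2 t * v t + d t"
  assume *: "0 \<le> t \<longrightarrow> (y has_real_derivative
        b t * - ((\<kappa> + exp (z t))^7 * (P1 (y t) + P2 (y t) * (y t)^2 + P3 (y t) * (y t)^6) * y t)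
        + \<theta>2 t * v t + d t) (at t within {0..}) \<and> \<bar>v t\<bar> \<le> n t + \<phi> (y t) * \<bar>y t\<bar>" and t: "0 \<le> t"
  then have "(y has_real_derivative Y) (at t within {0..})" by (simp add: Y_def E_def)
  then have "(X has_real_derivative y t * Y) (at t within {0..})"
    unfolding X_def[abs_def] by (auto intro!: derivative_eq_intros)
  then show "(X has_real_derivative y t * (b t * - ((\<kappa> + E t)^7 * (P1 (y t) + P2 (y t) * (y t)^2
    + P3 (y t) * (y t)^6) * y t) + \<theta>2 t * v t + d t)) (at t within {0..})" by (simp only: Y_def)
  show "\<bar>v t\<bar> \<le> n t + \<phi> (y t) * \<bar>y t\<bar>" using * t by blast
qed

text \<open>The excesses are measured against the gain at time \<open>T\<close> and remain valid
  later because \<open>E\<close> is nondecreasing. \<open>T = 0\<close> yields the global bounds, a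
  late \<open>T\<close> the convergence to zero.\<close>

context
  fixes T \<beta> h s r dd \<delta>\<delta> :: real
  assumes T: "0 \<le> T" and \<beta>: "\<beta> > 0" and h: "1 \<le> \<beta> * (\<kappa> + E T + h)" and s: "s \<ge> 0" and r: "r \<ge> 0"
    and dd: "dd \<ge> 0" and \<delta>\<delta>: "\<delta>\<delta> \<ge> 0"
    and bounds: "AE t in lebesgue. T \<le> t \<longrightarrow> \<beta> \<le> b t \<and> \<bar>\<theta>2 t\<bar> \<le> \<kappa> + E T + s \<and>
      \<theta> t / p \<le> \<kappa> + E T + r \<and> \<bar>d t\<bar> \<le> dd \<and> \<delta> t \<le> \<delta>\<delta>"
begin

text \<open>Adds \<open>n_rate\<close> to \<open>rate_le_full\<close> with
  \<open>\<theta> x / p\<close> as \<open>\<tau>\<close>. Freezing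
  \<open>a / (\<kappa> + E x)\<close> at the larger value for \<open>T\<close> makes the forcing
  constant. The differential form is stated too, because the asymptotic argument starts from
  it.\<close>

lemma W_decay:
  assumes t: "T \<le> t"
  defines "Z \<equiv> G * \<delta>\<delta>\<^sup>2 + a / (\<kappa> + E T) * (dd\<^sup>2 + s\<^sup>2 + (s\<^sup>2)\<^sup>2 + 4 * \<beta> * h\<^sup>2 + (r\<^sup>2)\<^sup>2)"
  shows "W t \<le> exp (- \<mu> * (t - T)) * (W T - Z / \<mu>) + Z / \<mu>"
    and "AE x in lebesgue. T \<le> x \<longrightarrow>
      (\<exists>D. (W has_real_derivative D) (at x within {0..}) \<and> D \<le> Z - \<mu> * W x)"
proof -
  show *: "AE x in lebesgue. T \<le> x \<longrightarrow>
      (\<exists>D. (W has_real_derivative D) (at x within {0..}) \<and> D \<le> Z - \<mu> * W x)"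
    using n_rate X_eq bounds
  proof (eventually_elim, intro impI)
    fix x
    let ?Y = "y x * (b x * - ((\<kappa> + E x)^7 * (P1 (y x) + P2 (y x) * (y x)^2
      + P3 (y x) * (y x)^6) * y x) + \<theta>2 x * v x + d x)"
    assume 1: "0 \<le> x \<longrightarrow> (\<exists>D. ((\<lambda>t. (n t)\<^sup>2) has_real_derivative D) (at x within {0..}) \<and>
        D / (2 * p) \<le> - (n x)\<^sup>2 + (\<theta> x / p)\<^sup>2 * (y x)\<^sup>2 + G * (\<delta> x)\<^sup>2)"
      and 2: "0 \<le> x \<longrightarrow> (X has_real_derivative ?Y) (at x within {0..}) \<and> \<bar>v x\<bar> \<le> n x + \<phi> (y x) * \<bar>y x\<bar>"
      and 3: "T \<le> x \<longrightarrow> \<beta> \<le> b x \<and> \<bar>\<theta>2 x\<bar> \<le> \<kappa> + E T + s \<and>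
        \<theta> x / p \<le> \<kappa> + E T + r \<and> \<bar>d x\<bar> \<le> dd \<and> \<delta> x \<le> \<delta>\<delta>" and x: "T \<le> x"
    define Y where "Y = ?Y"
    obtain D where D: "((\<lambda>t. (n t)\<^sup>2) has_real_derivative D) (at x within {0..})"
      "D / (2 * p) \<le> - (n x)\<^sup>2 + (\<theta> x / p)\<^sup>2 * (y x)\<^sup>2 + G * (\<delta> x)\<^sup>2"
      using 1 x T by auto
    have Y: "(X has_real_derivative Y) (at x within {0..})" "\<bar>v x\<bar> \<le> n x + \<phi> (y x) * \<bar>y x\<bar>"
      using 2 x T by (auto simp: Y_def)
    have E: "E T \<le> E x" using T x by (rule E_mono)
    have "1 \<le> \<beta> * (\<kappa> + E T + h)" by (rule h)
    also have "\<dots> \<le> \<beta> * (\<kappa> + E x + h)" using \<beta> E by simp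
    finally have hx: "1 \<le> \<beta> * (\<kappa> + E x + h)" .
    define S where "S = (d x)\<^sup>2 + s\<^sup>2 + (s\<^sup>2)\<^sup>2 + 4 * \<beta> * h\<^sup>2 + (r\<^sup>2)\<^sup>2"
    have "(\<theta> x / p)\<^sup>2 * (y x)\<^sup>2 + Y \<le> a / (2 * \<kappa>) * (n x)\<^sup>2 - C * (y x)\<^sup>2 + a / (\<kappa> + E x) * S"
      unfolding Y_def S_def using 3 x E E_pos[of x] Y(2) n_nonneg[of x] \<theta>_nonneg[of x] p \<beta> s r
      by (intro feedback_gains.rate_le_full[OF gains, OF _ _ _ hx]) auto
    moreover have "a / (\<kappa> + E x) * S \<le> a / (\<kappa> + E T) * (dd\<^sup>2 + s\<^sup>2 + (s\<^sup>2)\<^sup>2 + 4 * \<beta> * h\<^sup>2 + (r\<^sup>2)\<^sup>2)"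
    proof (intro mult_mono divide_left_mono)
      have "(d x)\<^sup>2 \<le> dd\<^sup>2" using 3 x power_mono[of "\<bar>d x\<bar>" dd 2] by simp
      then show "S \<le> dd\<^sup>2 + s\<^sup>2 + (s\<^sup>2)\<^sup>2 + 4 * \<beta> * h\<^sup>2 + (r\<^sup>2)\<^sup>2" by (simp add: S_def)
      show "0 \<le> S" using \<beta> by (simp add: S_def)
    qed (use E constants E_pos[of T] E_pos[of x] in \<open>auto intro!: mult_pos_pos add_pos_pos\<close>)
    moreover have "G * (\<delta> x)\<^sup>2 \<le> G * \<delta>\<delta>\<^sup>2"
      using 3 x \<delta>_nonneg[of x] G_nonneg by (intro mult_left_mono power_mono) auto
    ultimately have "D / (2 * p) + Y \<le> - (n x)\<^sup>2 + a / (2 * \<kappa>) * (n x)\<^sup>2 - C * (y x)\<^sup>2 + Z"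
      using D(2) unfolding Z_def by linarith
    also have "- (n x)\<^sup>2 + a / (2 * \<kappa>) * (n x)\<^sup>2 - C * (y x)\<^sup>2
        = - ((2 * \<kappa> - a) * p / \<kappa> * ((n x)\<^sup>2 / (2 * p)) + 2 * C * X x)"
      using p constants by (simp add: X_def field_simps)
    also have "\<dots> \<le> - (\<mu> * ((n x)\<^sup>2 / (2 * p)) + \<mu> * X x)"
      unfolding neg_le_iff_le using p X_nonneg by (intro add_mono mult_right_mono) (auto simp: \<mu>_def)
    finally have "D / (2 * p) + Y \<le> Z - \<mu> * W x" by (simp add: W_def distrib_left)
    moreover have "(W has_real_derivative D / (2 * p) + Y) (at x within {0..})"
      unfolding W_def[abs_def] by (intro DERIV_add DERIV_cdivide D Y)
    ultimately show "\<exists>D. (W has_real_derivative D) (at x within {0..}) \<and> D \<le> Z - \<mu> * W x" by blast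
  qed
  show "W t \<le> exp (- \<mu> * (t - T)) * (W T - Z / \<mu>) + Z / \<mu>"
    by (rule loc_abs_continuous_gronwall[OF W_ac W_cont \<mu>_pos T t])
      (use * in \<open>auto elim!: eventually_mono\<close>)
qed

text \<open>With an a priori bound \<open>M\<close> for the coupling, the forcing takes the form
  \<open>c / (1 + E t)\<close> required by \<open>adaptation_bound\<close>. The comparison
  \<open>min 1 \<kappa> * (1 + E t) \<le> \<kappa> + E t\<close> brings the minimum into the bound
  for \<open>z\<close>.\<close>

lemma X_rate:
  assumes M: "\<And>t. t \<ge> T \<Longrightarrow> (n t)\<^sup>2 / 2 \<le> M"
  shows "AE t in lebesgue. T \<le> t \<longrightarrow> (\<exists>D. (X has_real_derivative D) (at t within {0..}) \<and>
    D \<le> a * (M + s\<^sup>2 + dd\<^sup>2 + (s\<^sup>2)\<^sup>2 + 2 * \<beta> * h\<^sup>2) / min 1 \<kappa> / (1 + E t) - 2 * C * X t)"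
  using X_eq bounds
proof (eventually_elim, intro impI)
  fix x
  let ?Y = "y x * (b x * - ((\<kappa> + E x)^7 * (P1 (y x) + P2 (y x) * (y x)^2
    + P3 (y x) * (y x)^6) * y x) + \<theta>2 x * v x + d x)"
  let ?M = "M + s\<^sup>2 + dd\<^sup>2 + (s\<^sup>2)\<^sup>2 + 2 * \<beta> * h\<^sup>2"
  assume 2: "0 \<le> x \<longrightarrow> (X has_real_derivative ?Y) (at x within {0..}) \<and> \<bar>v x\<bar> \<le> n x + \<phi> (y x) * \<bar>y x\<bar>"
    and 3: "T \<le> x \<longrightarrow> \<beta> \<le> b x \<and> \<bar>\<theta>2 x\<bar> \<le> \<kappa> + E T + s \<and>
      \<theta> x / p \<le> \<kappa> + E T + r \<and> \<bar>d x\<bar> \<le> dd \<and> \<delta> x \<le> \<delta>\<delta>" and x: "T \<le> x"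
  define Y where "Y = ?Y"
  have Y: "(X has_real_derivative Y) (at x within {0..})" "\<bar>v x\<bar> \<le> n x + \<phi> (y x) * \<bar>y x\<bar>"
    using 2 x T by (auto simp: Y_def)
  have E: "E T \<le> E x" using T x by (rule E_mono)
  have "1 \<le> \<beta> * (\<kappa> + E T + h)" by (rule h)
  also have "\<dots> \<le> \<beta> * (\<kappa> + E x + h)" using \<beta> E by simp
  finally have hx: "1 \<le> \<beta> * (\<kappa> + E x + h)" .
  define S where "S = (n x)\<^sup>2 / 2 + s\<^sup>2 + (d x)\<^sup>2 + (s\<^sup>2)\<^sup>2 + 2 * \<beta> * h\<^sup>2"
  have "Y \<le> - C * (y x)\<^sup>2 + a / (\<kappa> + E x) * S"
    unfolding Y_def S_def using 3 x E E_pos[of x] Y(2) n_nonneg[of x] \<beta> s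
    by (intro feedback_gains.rate_le_decoupled[OF gains, OF _ _ _ hx]) auto
  moreover have "a / (\<kappa> + E x) * S \<le> a / (min 1 \<kappa> * (1 + E x)) * ?M"
  proof (intro mult_mono divide_left_mono)
    have "(d x)\<^sup>2 \<le> dd\<^sup>2" using 3 x power_mono[of "\<bar>d x\<bar>" dd 2] by simp
    then show "S \<le> ?M" using M[OF x] by (simp add: S_def)
    show "0 \<le> S" using \<beta> by (simp add: S_def)
    have "min 1 \<kappa> * 1 \<le> \<kappa>" "min 1 \<kappa> * E x \<le> 1 * E x"
      using E_pos[of x] by (auto intro: mult_right_mono)
    then show "min 1 \<kappa> * (1 + E x) \<le> \<kappa> + E x" by (simp add: distrib_left)
  qed (use constants E_pos[of x] in \<open>auto intro!: mult_pos_pos add_pos_pos divide_nonneg_nonneg mult_nonneg_nonneg\<close>)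
  moreover have "- C * (y x)\<^sup>2 + a / (min 1 \<kappa> * (1 + E x)) * ?M = a * ?M / min 1 \<kappa> / (1 + E x) - 2 * C * X x"
    by (simp add: X_def)
  ultimately have "Y \<le> a * ?M / min 1 \<kappa> / (1 + E x) - 2 * C * X x" by linarith
  then show "\<exists>D. (X has_real_derivative D) (at x within {0..}) \<and>
      D \<le> a * ?M / min 1 \<kappa> / (1 + E x) - 2 * C * X x"
    using Y(1) by (intro exI[of _ Y] conjI)
qed

end

end

section \<open>Upper limits and convergence of the state\<close>

context closed_loop
begin

lemma Limsup_y_le:
  assumes "\<And>e. e > 0 \<Longrightarrow> \<forall>\<^sub>F t in at_top. X t \<le> \<epsilon> + e"
  shows "Limsup at_top (\<lambda>t. ereal \<bar>y t\<bar>) \<le> ereal (sqrt (2 * \<epsilon>))"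
proof (rule Limsup_ereal_leI)
  fix c assume c: "sqrt (2 * \<epsilon>) < c"
  have c0: "c \<ge> 0" using c constants by (meson less_eq_real_def order_trans real_sqrt_ge_zero mult_nonneg_nonneg zero_le_numeral)
  have "2 * \<epsilon> < c\<^sup>2" using c constants by (metis real_sqrt_less_iff real_sqrt_abs abs_of_nonneg c0)
  then have "(c\<^sup>2 / 2 - \<epsilon>) / 2 > 0" by simp
  from assms[OF this] show "\<forall>\<^sub>F t in at_top. \<bar>y t\<bar> < c"
  proof eventually_elim
    case (elim t)
    then have "(y t)\<^sup>2 < c\<^sup>2" using \<open>2 * \<epsilon> < c\<^sup>2\<close> by (simp add: X_def field_simps)
    then show ?case using c0 power2_less_imp_less[of "\<bar>y t\<bar>" c] by simp
  qed
qed

text \<open>Once \<open>X\<close> is near \<open>[0, \<epsilon>]\<close>, \<open>n_rate\<close> is a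
  scalar linear inequality with bounded forcing. All bounds are attained only up to an arbitrary
  positive margin, which is removed by continuity.\<close>

lemma Limsup_n_le:
  assumes X: "\<And>e. e > 0 \<Longrightarrow> \<forall>\<^sub>F t in at_top. X t \<le> \<epsilon> + e"
    and \<Theta>: "\<Theta> \<ge> 0" "\<And>e. e > 0 \<Longrightarrow> \<forall>\<^sub>F t in ess_at_top. \<theta> t \<le> \<Theta> + e"
    and \<Delta>: "\<Delta> \<ge> 0" "\<And>e. e > 0 \<Longrightarrow> \<forall>\<^sub>F t in ess_at_top. \<delta> t \<le> \<Delta> + e"
  shows "Limsup at_top (\<lambda>t. ereal (n t)) \<le> ereal (sqrt (2 * \<epsilon> * (\<Theta> / p)\<^sup>2 + G * \<Delta>\<^sup>2))"
proof (rule Limsup_ereal_leI)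
  define c0 where "c0 = 2 * \<epsilon> * (\<Theta> / p)\<^sup>2 + G * \<Delta>\<^sup>2"
  have c0: "c0 \<ge> 0" using constants G_nonneg by (simp add: c0_def)
  fix c assume c: "sqrt (2 * \<epsilon> * (\<Theta> / p)\<^sup>2 + G * \<Delta>\<^sup>2) < c"
  have c_pos: "c \<ge> 0" using real_sqrt_ge_zero[OF c0] c unfolding c0_def by linarith
  have c1: "c0 < c\<^sup>2"
    using c c_pos by (metis c0_def real_sqrt_less_iff real_sqrt_abs abs_of_nonneg)
  \<comment> \<open>The squared bound with every constituent enlarged by \<open>\<eta>\<close>. At
    \<open>\<eta> = 0\<close> it is below \<open>c\<^sup>2\<close>, hence also for some
    \<open>\<eta> > 0\<close>; half of the remaining gap absorbs the transient.\<close>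
  define g where "g = (\<lambda>\<eta>. ((\<Theta> + \<eta>) / p)\<^sup>2 * (2 * (\<epsilon> + \<eta>)) + G * (\<Delta> + \<eta>)\<^sup>2)"
  have "(g \<longlongrightarrow> ((\<Theta> + 0) / p)\<^sup>2 * (2 * (\<epsilon> + 0)) + G * (\<Delta> + 0)\<^sup>2) (at_right 0)"
    unfolding g_def using p by (intro tendsto_intros) auto
  then have "\<forall>\<^sub>F \<eta> in at_right 0. g \<eta> < c\<^sup>2"
    using c1 by (intro order_tendstoD(2)) (auto simp: c0_def algebra_simps)
  then have "\<forall>\<^sub>F \<eta> in at_right 0. g \<eta> < c\<^sup>2 \<and> \<eta> > 0"
    using eventually_at_right_less[of 0] by (rule eventually_conj)
  then obtain \<eta> where \<eta>: "g \<eta> < c\<^sup>2" "\<eta> > 0"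
    using eventually_happens[of _ "at_right (0::real)"] by force
  obtain T1 where T1: "\<And>t. t \<ge> T1 \<Longrightarrow> X t \<le> \<epsilon> + \<eta>"
    using X[OF \<eta>(2)] unfolding eventually_at_top_linorder by blast
  obtain T2 where T2: "AE t in lebesgue. t \<ge> T2 \<longrightarrow> \<theta> t \<le> \<Theta> + \<eta>"
    using \<Theta>(2)[OF \<eta>(2)] unfolding eventually_ess_at_top by blast
  obtain T3 where T3: "AE t in lebesgue. t \<ge> T3 \<longrightarrow> \<delta> t \<le> \<Delta> + \<eta>"
    using \<Delta>(2)[OF \<eta>(2)] unfolding eventually_ess_at_top by blast
  define T where "T = Max {0, T1, T2, T3}"
  have T: "T \<ge> 0" "T \<ge> T1" "T \<ge> T2" "T \<ge> T3" by (auto simp: T_def)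
  have "\<forall>\<^sub>F t in at_top. (n t)\<^sup>2 \<le> 2 * p * g \<eta> / (2 * p) + (c\<^sup>2 - g \<eta>) / 2"
  proof (rule gronwall_eventually_le[OF n_ac n_sq_cont _ T(1)])
    show "AE x in lebesgue. T \<le> x \<longrightarrow> (\<exists>D. ((\<lambda>t. (n t)\<^sup>2) has_real_derivative D) (at x within {0..}) \<and>
        D \<le> 2 * p * g \<eta> - 2 * p * (n x)\<^sup>2)"
      using n_rate T2 T3
    proof (eventually_elim, intro impI)
      fix x assume 1: "0 \<le> x \<longrightarrow> (\<exists>D. ((\<lambda>t. (n t)\<^sup>2) has_real_derivative D) (at x within {0..}) \<and>
          D / (2 * p) \<le> - (n x)\<^sup>2 + (\<theta> x / p)\<^sup>2 * (y x)\<^sup>2 + G * (\<delta> x)\<^sup>2)"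
        and 2: "T2 \<le> x \<longrightarrow> \<theta> x \<le> \<Theta> + \<eta>" and 3: "T3 \<le> x \<longrightarrow> \<delta> x \<le> \<Delta> + \<eta>" and x: "T \<le> x"
      then obtain D where D: "((\<lambda>t. (n t)\<^sup>2) has_real_derivative D) (at x within {0..})"
        "D / (2 * p) \<le> - (n x)\<^sup>2 + (\<theta> x / p)\<^sup>2 * (y x)\<^sup>2 + G * (\<delta> x)\<^sup>2"
        using T by auto
      have "(\<theta> x / p)\<^sup>2 * (y x)\<^sup>2 \<le> ((\<Theta> + \<eta>) / p)\<^sup>2 * (2 * (\<epsilon> + \<eta>))"
        using 2 x T T1[of x] p \<theta>_nonneg[of x]
        by (intro mult_mono power_mono divide_right_mono) (auto simp: X_def)
      moreover have "G * (\<delta> x)\<^sup>2 \<le> G * (\<Delta> + \<eta>)\<^sup>2"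
        using 3 x T \<delta>_nonneg[of x] G_nonneg by (intro mult_left_mono power_mono) auto
      ultimately have "D / (2 * p) \<le> g \<eta> - (n x)\<^sup>2" using D(2) by (simp add: g_def)
      then have "D \<le> 2 * p * g \<eta> - 2 * p * (n x)\<^sup>2" using p by (simp add: field_simps)
      then show "\<exists>D. ((\<lambda>t. (n t)\<^sup>2) has_real_derivative D) (at x within {0..}) \<and>
        D \<le> 2 * p * g \<eta> - 2 * p * (n x)\<^sup>2" using D(1) by blast
    qed
  qed (use p \<eta> in auto)
  then show "\<forall>\<^sub>F t in at_top. n t < c"
  proof eventually_elim
    case (elim t)
    then have "(n t)\<^sup>2 \<le> g \<eta> + (c\<^sup>2 - g \<eta>) / 2" using p by simp
    also have "\<dots> < c\<^sup>2" using \<eta>(1) by (simp add: field_simps)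
    finally have "(n t)\<^sup>2 < c\<^sup>2" .
    then show ?case using c_pos by (rule power2_less_imp_less)
  qed
qed

text \<open>At a late time the gain is close to its limit, so the parameters exceed it only
  slightly, and the condition on \<open>\<beta>\<close> permits a deficit of zero. The forcing of
  \<open>W\<close> can thus be made arbitrarily small.\<close>

lemma tendsto_zero:
  assumes l: "(E \<longlongrightarrow> l) at_top"
    and \<beta>: "\<beta> > 0" "1 \<le> \<beta> * (\<kappa> + E 0)" "\<forall>\<^sub>F t in ess_at_top. \<beta> \<le> b t"
    and \<theta>: "\<And>e. e > 0 \<Longrightarrow> \<forall>\<^sub>F t in ess_at_top. \<theta> t / p \<le> \<kappa> + l + e \<and> \<bar>\<theta>2 t\<bar> \<le> \<kappa> + l + e"
    and d: "\<And>e. e > 0 \<Longrightarrow> \<forall>\<^sub>F t in ess_at_top. \<bar>d t\<bar> \<le> e \<and> \<delta> t \<le> e"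
  shows "(W \<longlongrightarrow> 0) at_top"
proof (rule tendstoI)
  fix e :: real assume e: "e > 0"
  \<comment> \<open>The forcing \<open>Z\<close> with all perturbations bounded through
    \<open>\<eta>\<close>. The excesses are \<open>2 * \<eta>\<close>: one \<open>\<eta>\<close>
    from the parameters over \<open>\<kappa> + l\<close>, another from the distance of
    \<open>E T\<close> to \<open>l\<close>.\<close>
  define g where "g = (\<lambda>\<eta>. G * \<eta>\<^sup>2 + a / \<kappa> * (\<eta>\<^sup>2 + (2 * \<eta>)\<^sup>2 + ((2 * \<eta>)\<^sup>2)\<^sup>2 + ((2 * \<eta>)\<^sup>2)\<^sup>2))"
  have "(g \<longlongrightarrow> G * 0\<^sup>2 + a / \<kappa> * (0\<^sup>2 + (2 * 0)\<^sup>2 + ((2 * 0)\<^sup>2)\<^sup>2 + ((2 * 0)\<^sup>2)\<^sup>2)) (at_right 0)"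
    unfolding g_def by (intro tendsto_intros)
  then have "\<forall>\<^sub>F \<eta> in at_right 0. g \<eta> < \<mu> * (e / 2)"
    using e \<mu>_pos by (intro order_tendstoD(2)) auto
  then have "\<forall>\<^sub>F \<eta> in at_right 0. g \<eta> < \<mu> * (e / 2) \<and> \<eta> > 0"
    using eventually_at_right_less[of 0] by (rule eventually_conj)
  then obtain \<eta> where \<eta>: "g \<eta> < \<mu> * (e / 2)" "\<eta> > 0"
    using eventually_happens[of _ "at_right (0::real)"] by force
  obtain T1 where T1: "\<And>t. t \<ge> T1 \<Longrightarrow> E t > l - \<eta>"
    using order_tendstoD(1)[OF l, of "l - \<eta>"] \<eta> unfolding eventually_at_top_linorder by auto
  have "\<forall>\<^sub>F t in ess_at_top. \<beta> \<le> b t \<and> (\<theta> t / p \<le> \<kappa> + l + \<eta> \<and> \<bar>\<theta>2 t\<bar> \<le> \<kappa> + l + \<eta>) \<and>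
      (\<bar>d t\<bar> \<le> \<eta> \<and> \<delta> t \<le> \<eta>)"
    by (intro eventually_conj \<beta> \<theta> d \<eta>)
  then obtain T2 where T2: "AE t in lebesgue. t \<ge> T2 \<longrightarrow> \<beta> \<le> b t \<and>
      (\<theta> t / p \<le> \<kappa> + l + \<eta> \<and> \<bar>\<theta>2 t\<bar> \<le> \<kappa> + l + \<eta>) \<and> (\<bar>d t\<bar> \<le> \<eta> \<and> \<delta> t \<le> \<eta>)"
    unfolding eventually_ess_at_top by blast
  define T where "T = Max {0, T1, T2}"
  have T: "T \<ge> 0" "T \<ge> T1" "T \<ge> T2" by (auto simp: T_def)
  have "1 \<le> \<beta> * (\<kappa> + E 0)" by (rule \<beta>)
  also have "\<dots> \<le> \<beta> * (\<kappa> + E T + 0)" using \<beta>(1) E_mono[OF _ T(1)] by simp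
  finally have h: "1 \<le> \<beta> * (\<kappa> + E T + 0)" .
  have bounds: "AE t in lebesgue. T \<le> t \<longrightarrow> \<beta> \<le> b t \<and> \<bar>\<theta>2 t\<bar> \<le> \<kappa> + E T + 2 * \<eta> \<and>
      \<theta> t / p \<le> \<kappa> + E T + 2 * \<eta> \<and> \<bar>d t\<bar> \<le> \<eta> \<and> \<delta> t \<le> \<eta>"
    using T2
  proof eventually_elim
    case (elim t)
    then show ?case using T T1[of T] by auto
  qed
  let ?Z = "G * \<eta>\<^sup>2 + a / (\<kappa> + E T) * (\<eta>\<^sup>2 + (2 * \<eta>)\<^sup>2 + ((2 * \<eta>)\<^sup>2)\<^sup>2 + 4 * \<beta> * 0\<^sup>2 + ((2 * \<eta>)\<^sup>2)\<^sup>2)"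
  have "AE x in lebesgue. T \<le> x \<longrightarrow>
      (\<exists>D. (W has_real_derivative D) (at x within {0..}) \<and> D \<le> ?Z - \<mu> * W x)"
    using \<eta>(2) by (intro W_decay(2)[OF T(1) \<beta>(1) h _ _ _ _ bounds order_refl]) auto
  then have "\<forall>\<^sub>F t in at_top. W t \<le> ?Z / \<mu> + e / 2"
    using e by (intro gronwall_eventually_le[OF W_ac W_cont \<mu>_pos T(1)]) auto
  then show "\<forall>\<^sub>F t in at_top. dist (W t) 0 < e"
  proof eventually_elim
    case (elim t)
    have "a / (\<kappa> + E T) \<le> a / \<kappa>"
      using constants E_pos[of T] by (intro divide_left_mono) (auto intro!: mult_pos_pos add_pos_pos)
    then have "?Z \<le> g \<eta>" unfolding g_def by (intro add_left_mono mult_mono) (use constants in auto)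
    also have "\<dots> < \<mu> * (e / 2)" by (rule \<eta>)
    finally have "?Z / \<mu> < e / 2" using \<mu>_pos by (simp add: pos_divide_less_eq mult.commute)
    then have "W t < e" using elim by linarith
    then show ?case using W_nonneg[of t] by (simp add: dist_real_def)
  qed
qed

lemma tendsto_zero_components:
  assumes "(W \<longlongrightarrow> 0) at_top"
  shows "((\<lambda>t. \<bar>y t\<bar>) \<longlongrightarrow> 0) at_top" "(n \<longlongrightarrow> 0) at_top"
proof -
  have lim: "((\<lambda>t. sqrt (c * W t)) \<longlongrightarrow> 0) at_top" for c
  proof -
    have "((\<lambda>t. sqrt (c * W t)) \<longlongrightarrow> sqrt (c * 0)) at_top" by (intro tendsto_intros assms)
    then show ?thesis by simp
  qed
  show "((\<lambda>t. \<bar>y t\<bar>) \<longlongrightarrow> 0) at_top"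
  proof (rule tendsto_sandwich[OF _ _ tendsto_const lim[of 2]])
    have "\<bar>y t\<bar> \<le> sqrt (2 * W t)" for t
      using p by (intro real_le_rsqrt) (simp add: W_def X_def)
    then show "\<forall>\<^sub>F t in at_top. \<bar>y t\<bar> \<le> sqrt (2 * W t)" by simp
  qed simp
  show "(n \<longlongrightarrow> 0) at_top"
  proof (rule tendsto_sandwich[OF _ _ tendsto_const lim[of "2 * p"]])
    have "n t \<le> sqrt (2 * p * W t)" for t
      using p X_nonneg[of t] by (intro real_le_rsqrt) (simp add: W_def distrib_left)
    then show "\<forall>\<^sub>F t in at_top. n t \<le> sqrt (2 * p * W t)" by simp
  qed (use n_nonneg in simp)
qed

context
  fixes \<beta> h s r dd \<delta>\<delta> :: real
  assumes \<beta>: "\<beta> > 0" and h: "1 \<le> \<beta> * (\<kappa> + E 0 + h)" and s: "s \<ge> 0" and r: "r \<ge> 0"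
    and dd: "dd \<ge> 0" and \<delta>\<delta>: "\<delta>\<delta> \<ge> 0"
    and bounds: "AE t in lebesgue. 0 \<le> t \<longrightarrow> \<beta> \<le> b t \<and> \<bar>\<theta>2 t\<bar> \<le> \<kappa> + E 0 + s \<and>
      \<theta> t / p \<le> \<kappa> + E 0 + r \<and> \<bar>d t\<bar> \<le> dd \<and> \<delta> t \<le> \<delta>\<delta>"
begin

text \<open>The claims are proved together because each feeds the next: the bound on
  \<open>W\<close> gives \<open>(n t)\<^sup>2 / 2 \<le> p * (W 0 + Z / \<mu>)\<close>, the first
  summand of \<open>B\<close>; this makes the coupling a bounded perturbation of \<open>X\<close>,
  which bounds \<open>E\<close>; the limit of \<open>E\<close> then confines
  \<open>X\<close>.\<close>

lemma global_bounds:
  defines "Z \<equiv> G * \<delta>\<delta>\<^sup>2 + a / (\<kappa> + E 0) * (dd\<^sup>2 + s\<^sup>2 + (s\<^sup>2)\<^sup>2 + 4 * \<beta> * h\<^sup>2 + (r\<^sup>2)\<^sup>2)"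
  defines "B \<equiv> p * (W 0 + Z / \<mu>) + s\<^sup>2 + dd\<^sup>2 + (s\<^sup>2)\<^sup>2 + 2 * \<beta> * h\<^sup>2"
  shows W_bound: "\<And>t. t \<ge> 0 \<Longrightarrow> W t \<le> exp (- \<mu> * t) * W 0 + Z / \<mu>"
    and E_bound: "\<And>t. t \<ge> 0 \<Longrightarrow> E t \<le> E 0 + \<Gamma> / (2 * C) * X 0
      + a * B / min 1 \<kappa> * ((2 * C * (1 + E 0) + \<epsilon> * \<Gamma>) / (4 * C\<^sup>2 * \<epsilon> * (1 + E 0)))"
    and X_eventually: "\<And>e. e > 0 \<Longrightarrow> \<forall>\<^sub>F t in at_top. X t \<le> \<epsilon> + e"
    and E_convergent: "\<exists>l. (E \<longlongrightarrow> l) at_top \<and> l > 0"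
proof -
  note W_decay0 = W_decay[OF order_refl \<beta> h s r dd \<delta>\<delta> bounds]
  have Z: "Z \<ge> 0" using G_nonneg constants E_pos[of 0] \<beta> by (simp add: Z_def)
  then have Z\<mu>: "Z / \<mu> \<ge> 0" using \<mu>_pos by simp
  show W: "W t \<le> exp (- \<mu> * t) * W 0 + Z / \<mu>" if t: "t \<ge> 0" for t
  proof -
    have "W t \<le> exp (- \<mu> * (t - 0)) * (W 0 - Z / \<mu>) + Z / \<mu>"
      using W_decay0(1)[OF t] by (simp add: Z_def)
    also have "\<dots> \<le> exp (- \<mu> * (t - 0)) * W 0 + Z / \<mu>" using Z\<mu> by simp
    finally show ?thesis by simp
  qed
  have W': "W t \<le> W 0 + Z / \<mu>" if t: "t \<ge> 0" for t
  proof -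
    have "exp (- \<mu> * t) * W 0 \<le> 1 * W 0"
      using t \<mu>_pos W_nonneg by (intro mult_right_mono) auto
    then show ?thesis using W[OF t] by simp
  qed
  have "(n t)\<^sup>2 / 2 \<le> p * (W 0 + Z / \<mu>)" if "t \<ge> 0" for t
  proof -
    have "(n t)\<^sup>2 / 2 \<le> p * W t" using p X_nonneg[of t] by (simp add: W_def distrib_left)
    also have "\<dots> \<le> p * (W 0 + Z / \<mu>)" using W'[OF that] p by simp
    finally show ?thesis .
  qed
  from X_rate[OF order_refl \<beta> h s r dd \<delta>\<delta> bounds this]
  have rate: "AE t in lebesgue. 0 \<le> t \<longrightarrow> (\<exists>D. (X has_real_derivative D) (at t within {0..}) \<and>
      D \<le> a * B / min 1 \<kappa> / (1 + E t) - 2 * C * X t)"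
    by (simp add: B_def)
  have B: "a * B / min 1 \<kappa> \<ge> 0"
    using p W_nonneg[of 0] Z\<mu> constants \<beta> by (simp add: B_def)
  show E: "E t \<le> E 0 + \<Gamma> / (2 * C) * X 0
      + a * B / min 1 \<kappa> * ((2 * C * (1 + E 0) + \<epsilon> * \<Gamma>) / (4 * C\<^sup>2 * \<epsilon> * (1 + E 0)))" if "t \<ge> 0" for t
    using constants B X_nonneg E_pos[of 0] that
    by (intro adaptation_bound[OF _ _ _ _ _ _ X_ac X_cont E_ac E_cont E_eq E_mono rate]) auto
  have "\<exists>l. (E \<longlongrightarrow> l) at_top \<and> (\<forall>t\<ge>0. E t \<le> l)"
    by (rule bounded_mono_tendsto_at_top) (rule E_mono E; assumption)+
  then obtain l where l: "(E \<longlongrightarrow> l) at_top" "\<And>t. 0 \<le> t \<Longrightarrow> E t \<le> l" by blast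
  then show "\<exists>l. (E \<longlongrightarrow> l) at_top \<and> l > 0" using E_pos[of 0] by force
  \<comment> \<open>The added \<open>1\<close> makes the bound positive, as
    \<open>eventually_le_deadzone\<close> divides by it.\<close>
  have rate': "AE t in lebesgue. 0 \<le> t \<longrightarrow> (\<exists>D. (X has_real_derivative D) (at t within {0..}) \<and>
      D \<le> a * B / min 1 \<kappa> + 1)"
    using rate
  proof (eventually_elim, intro impI)
    fix t assume *: "0 \<le> t \<longrightarrow> (\<exists>D. (X has_real_derivative D) (at t within {0..}) \<and>
      D \<le> a * B / min 1 \<kappa> / (1 + E t) - 2 * C * X t)" "0 \<le> t"
    have "a * B / min 1 \<kappa> / (1 + E t) \<le> a * B / min 1 \<kappa> / 1"
      using B E_pos[of t] by (intro divide_left_mono) auto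
    moreover have "2 * C * X t \<ge> 0" using constants X_nonneg by simp
    ultimately show "\<exists>D. (X has_real_derivative D) (at t within {0..}) \<and> D \<le> a * B / min 1 \<kappa> + 1"
      using * by force
  qed
  show "\<forall>\<^sub>F t in at_top. X t \<le> \<epsilon> + e" if "e > 0" for e
    using constants B that
    by (intro eventually_le_deadzone[OF _ _ X_ac E_ac E_eq l(1) rate']) auto
qed

end

end

section \<open>Essential bounds and limits\<close>

text \<open>No half-line is a null set. Without this, essential limits along the filter would be
  vacuous and an upper limit of norms could be minus infinity.\<close>

lemma ess_at_top_neq_bot: "ess_at_top \<noteq> bot"
proof
  assume "ess_at_top = bot"
  then have "\<forall>\<^sub>F t in ess_at_top. False" by simp
  then obtain T where "AE t in lebesgue. t \<ge> (T::real) \<longrightarrow> False"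
    unfolding eventually_ess_at_top by blast
  then have "AE t in lebesgue_on {T..T + 1}. False"
    by (subst AE_restrict_space_iff) (auto elim: eventually_mono)
  then have "ae_filter (lebesgue_on {T..T + 1}) = bot" by (simp add: trivial_limit_def)
  then show False unfolding ae_filter_eq_bot_iff
    by (simp add: emeasure_restrict_space)
qed

lemma AE_halfline_imp_ess:
  assumes "AE t in lebesgue. 0 \<le> t \<longrightarrow> P t"
  shows "\<forall>\<^sub>F t in ess_at_top. P t"
  using assms unfolding eventually_ess_at_top by blast

lemma not_AE_halfline_False: "\<not> (AE t in lebesgue. 0 \<le> (t::real) \<longrightarrow> False)"
  using AE_halfline_imp_ess[of "\<lambda>_. False"] ess_at_top_neq_bot by (auto simp: trivial_limit_def)

text \<open>\<open>real_of_ereal\<close> sends infinite values to 0, so the essential supremum must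
  first be shown to be a nonnegative real; it cannot be negative because the half-line has positive
  measure.\<close>

lemma L_infinity_bound:
  assumes "L_infinity f"
  shows "AE t in lebesgue. 0 \<le> t \<longrightarrow> norm (f t) \<le> Linf_norm f" and "0 \<le> Linf_norm f"
proof -
  define s where "s = esssup (lebesgue_on {0..}) (\<lambda>t. ereal (norm (f t)))"
  have s: "s < \<infinity>" using assms by (simp add: L_infinity_def s_def)
  have "AE t in lebesgue_on {0..}. ereal (norm (f t)) \<le> s" unfolding s_def by (rule esssup_AE)
  then have AE: "AE t in lebesgue. 0 \<le> t \<longrightarrow> ereal (norm (f t)) \<le> s" by (simp only: AE_halfline)
  have "s \<ge> 0"
  proof (rule ccontr)
    assume "\<not> s \<ge> 0"
    then have neg: "\<not> ereal (norm (f t)) \<le> s" for t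
      by (meson ereal_less_eq(5) norm_ge_zero order_trans)
    have "AE t in lebesgue. 0 \<le> (t::real) \<longrightarrow> False"
      using AE by eventually_elim (use neg in blast)
    then show False using not_AE_halfline_False by blast
  qed
  with s obtain r where r: "s = ereal r" "r \<ge> 0" by (cases s) auto
  have norm: "Linf_norm f = r" using r by (simp add: Linf_norm_def flip: s_def)
  show "AE t in lebesgue. 0 \<le> t \<longrightarrow> norm (f t) \<le> Linf_norm f" using AE by (simp add: r norm)
  show "0 \<le> Linf_norm f" using r norm by simp
qed

text \<open>Again an infinite value has to be excluded before \<open>real_of_ereal\<close> is
  meaningful; the essential boundedness of \<open>b\<close> does this.\<close>

lemma essinf_halfline_bound:
  assumes "L_infinity b" "essinf_halfline b > 0"
  shows "real_of_ereal (essinf_halfline b) > 0"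
    and "AE t in lebesgue. 0 \<le> t \<longrightarrow> real_of_ereal (essinf_halfline b) \<le> b t"
proof -
  have less: "AE t in lebesgue. 0 \<le> t \<longrightarrow> y < ereal (b t)" if "y < essinf_halfline b" for y
  proof -
    have "essinf_halfline b \<le> Liminf (ae_filter (lebesgue_on {0..})) (\<lambda>t. ereal (b t))"
      by (simp add: essinf_halfline_def)
    then have "AE t in lebesgue_on {0..}. y < ereal (b t)" using that unfolding le_Liminf_iff by blast
    then show ?thesis by (simp only: AE_halfline)
  qed
  have "essinf_halfline b \<noteq> \<infinity>"
  proof
    assume "essinf_halfline b = \<infinity>"
    then have "AE t in lebesgue. 0 \<le> t \<longrightarrow> ereal (Linf_norm b) < ereal (b t)" by (intro less) simp
    then have "AE t in lebesgue. 0 \<le> (t::real) \<longrightarrow> False"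
      using L_infinity_bound(1)[OF assms(1)] by eventually_elim auto
    then show False using not_AE_halfline_False by blast
  qed
  with assms(2) obtain r where r: "essinf_halfline b = ereal r" "r > 0"
    by (cases "essinf_halfline b") auto
  \<comment> \<open>\<open>Liminf\<close> controls only levels strictly below \<open>r\<close>; a
    sequence of levels increasing to \<open>r\<close> costs only countably many null sets.\<close>
  have "AE t in lebesgue. \<forall>k::nat. 0 \<le> t \<longrightarrow> ereal (r - 1 / real (Suc k)) < ereal (b t)"
    unfolding AE_all_countable by (intro allI less) (simp add: r)
  then show "AE t in lebesgue. 0 \<le> t \<longrightarrow> real_of_ereal (essinf_halfline b) \<le> b t"
  proof (eventually_elim, intro impI)
    fix t assume *: "\<forall>k::nat. 0 \<le> t \<longrightarrow> ereal (r - 1 / real (Suc k)) < ereal (b t)" "0 \<le> t"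
    have "r \<le> b t"
    proof (rule field_le_epsilon)
      fix e :: real assume "e > 0"
      then obtain k where "1 / real (Suc k) < e" using nat_approx_posE by blast
      moreover have "r - 1 / real (Suc k) < b t" using * by auto
      ultimately show "r \<le> b t + e" by linarith
    qed
    then show "real_of_ereal (essinf_halfline b) \<le> b t" by (simp add: r)
  qed
  show "real_of_ereal (essinf_halfline b) > 0" using r by simp
qed

text \<open>Nonnegativity and the eventual bound place the upper limit among the reals, so that
  converting it by \<open>real_of_ereal\<close> loses nothing.\<close>

lemma real_Limsup_bound:
  assumes F: "F \<noteq> bot" and nonneg: "\<And>t. f t \<ge> 0" and bound: "\<forall>\<^sub>F t in F. f t \<le> M"
  defines "l \<equiv> real_of_ereal (Limsup F (\<lambda>t. ereal (f t)))"
  shows "l \<ge> 0" and "e > 0 \<Longrightarrow> \<forall>\<^sub>F t in F. f t \<le> l + e"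
proof -
  have "Limsup F (\<lambda>t. ereal (f t)) \<ge> 0" using nonneg by (intro le_Limsup F) simp
  moreover have "Limsup F (\<lambda>t. ereal (f t)) \<le> ereal M" using bound by (intro Limsup_bounded) simp
  ultimately have l: "Limsup F (\<lambda>t. ereal (f t)) = ereal l" "l \<ge> 0"
    unfolding l_def by (cases "Limsup F (\<lambda>t. ereal (f t))"; simp)+
  show "l \<ge> 0" by (rule l)
  show "\<forall>\<^sub>F t in F. f t \<le> l + e" if "e > 0"
  proof -
    have "Limsup F (\<lambda>t. ereal (f t)) \<le> ereal l" using l by simp
    moreover have "ereal l < ereal (l + e)" using that by simp
    ultimately have "\<forall>\<^sub>F t in F. ereal (f t) < ereal (l + e)" unfolding Limsup_le_iff by blast
    then show ?thesis by eventually_elim simp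
  qed
qed

theorem corollary2:
  fixes p \<epsilon> \<Gamma> \<kappa> a C :: real
    and K :: "real \<Rightarrow> real \<Rightarrow> real"
    and L :: "L2 \<Rightarrow> real \<Rightarrow> real"
    and \<phi> P1 P2 P3 :: "real \<Rightarrow> real"
    and w \<theta>1 \<delta> :: "real \<Rightarrow> L2"
    and y z u d \<theta>2 b :: "real \<Rightarrow> real"
    and k1 k2 R G \<mu> \<beta> Z B :: real
    and g :: "real \<Rightarrow> real \<Rightarrow> real"
  assumes p: "p > 0"
    and constants: "\<epsilon> > 0" "\<Gamma> > 0" "\<kappa> > 0" "a > 0" "C > 0" "2 * \<kappa> > a"
    and \<phi>: "C_infinity \<phi>" "\<And>r. \<phi> r \<ge> 0"
    and P_smooth: "C_infinity P1" "C_infinity P2" "C_infinity P3"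
    and P1: "\<And>r. P1 r \<ge> 1 / (4 * a * \<kappa>^6) *
      (\<kappa> + 4 * a * C + 4 * \<kappa>^3 + 4 * a * \<kappa> * \<phi> r + 8 * a * \<kappa>^2)"
    and P2: "\<And>r. P2 r \<ge> 1 / (4 * a^3 * \<kappa>^5) *
      (1 / (16 * \<kappa>) * (\<kappa> + 4 * a * C + 4 * \<kappa>^3 + 4 * a * \<kappa> * \<phi> r)^2
        + \<kappa>^2 + a^2 * (\<phi> r)^2 + 4 * a^2 * (\<kappa>^3 + 1))"
    and P3: "\<And>r. P3 r \<ge> 1 / (64 * a^7 * \<kappa>^4) *
      ((\<kappa>^2 + a^2 * (\<phi> r)^2)^2 + 16 * a^4)"
    and L: "\<And>v r. v \<in> H2 \<inter> H10 \<Longrightarrow> \<bar>L v r\<bar> \<le> norm v + \<phi> r * \<bar>r\<bar>"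
    and K: "\<And>x r. x \<in> {0..1} \<Longrightarrow> \<bar>K x r\<bar> \<le> \<bar>r\<bar>"
    and inputs: "L_infinity d" "L_infinity \<theta>1" "L_infinity \<theta>2" "L_infinity \<delta>" "L_infinity b"
    and b_pos: "AE t in lebesgue_on {0..}. b t > 0" "essinf_halfline b > 0"
    and w_reg: "continuous_on {0..} w"
      "loc_abs_continuous (\<lambda>t. (norm (w t))\<^sup>2)"
      "\<And>T. T > 0 \<Longrightarrow> L1_H2_H10 T w"
    and z_reg: "C1_halfline z"
    and y_reg: "continuous_on {0..} y" "loc_abs_continuous y"
    and w_eq: "AE t in lebesgue_on {0..}. w t \<in> H2 \<inter> H10 \<and>
      (\<exists>wt. (w has_vector_derivative wt) (at t within {0..}) \<and>
        (AE x in unit_meas. rep_L2 wt x =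
          p * rep_L2 (weak_deriv (weak_deriv (w t))) x
          + rep_L2 (\<theta>1 t) x * K x (y t) + rep_L2 (\<delta> t) x))"
    and y_eq: "AE t in lebesgue_on {0..}.
      (y has_real_derivative b t * u t + \<theta>2 t * L (w t) (y t) + d t) (at t within {0..})"
    and u_eq: "\<And>t. u t = - ((\<kappa> + exp (z t))^7 *
      (P1 (y t) + P2 (y t) * (y t)^2 + P3 (y t) * (y t)^6) * y t)"
    and z_eq: "AE t in lebesgue_on {0..}.
      (z has_real_derivative \<Gamma> * exp (- z t) * max (1/2 * (y t)^2 - \<epsilon>) 0) (at t within {0..})"
    and k_def: "k1 = 1 / (2 * p)" "k2 = 1 / (2 * p)"
    and R_def: "R = 1 / p"
    and G_def: "G = 1 / (p^2 * (4 * pi^2 - 5))"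
    and \<mu>_def: "\<mu> = min ((2 * \<kappa> - a) / (2 * \<kappa> * k2)) (2 * C)"
    and \<beta>_def: "\<beta> = real_of_ereal (essinf_halfline b)"
    and g_def: "\<And>s l. g s l = (max (s - \<kappa> - exp l) 0)^2"
    and Z_def: "Z = G * (Linf_norm \<delta>)^2 + a / (\<kappa> + exp (z 0)) *
      ((Linf_norm d)^2 + g (Linf_norm \<theta>2) (z 0) + (g (Linf_norm \<theta>2) (z 0))^2
        + 4 * \<beta> * g (1 / \<beta>) (z 0) + (g (R * Linf_norm \<theta>1) (z 0))^2)"
    and B_def: "B = 1 / (2 * k1) * (k2 * (norm (w 0))^2 + 1/2 * \<bar>y 0\<bar>^2 + Z / \<mu>)
      + g (Linf_norm \<theta>2) (z 0) + (Linf_norm d)^2 + (g (Linf_norm \<theta>2) (z 0))^2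
      + 2 * \<beta> * g (1 / \<beta>) (z 0)"
  shows "(\<forall>t\<ge>0.
        2 * k1 * (norm (w t))^2 + \<bar>y t\<bar>^2
          \<le> exp (- \<mu> * t) * (2 * k2 * (norm (w 0))^2 + \<bar>y 0\<bar>^2) + 2 * (1 / \<mu>) * Z \<and>
        z 0 \<le> z t \<and>
        z t \<le> ln (exp (z 0) + \<Gamma> / (4 * C) * \<bar>y 0\<bar>^2
          + a * B * ((2 * C * (1 + exp (z 0)) + \<epsilon> * \<Gamma>)
              / (4 * C^2 * \<epsilon> * min 1 \<kappa> * (1 + exp (z 0))))))
    \<and> Limsup at_top (\<lambda>t. ereal (norm (w t))) \<le> ereal (sqrt (k2 / k1 *
        (2 * \<epsilon> * R^2 * (real_of_ereal (Limsup ess_at_top (\<lambda>t. ereal (norm (\<theta>1 t)))))^2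
          + G * (real_of_ereal (Limsup ess_at_top (\<lambda>t. ereal (norm (\<delta> t)))))^2)))
    \<and> Limsup at_top (\<lambda>t. ereal \<bar>y t\<bar>) \<le> ereal (sqrt (2 * \<epsilon>))
    \<and> ((d \<longlongrightarrow> 0) ess_at_top \<and> (\<delta> \<longlongrightarrow> 0) ess_at_top \<and>
        Liminf ess_at_top (\<lambda>t. ereal (b t)) \<ge> ereal (1 / \<kappa>) \<longrightarrow>
        (((\<lambda>t. \<bar>y t\<bar>) \<longlongrightarrow> 0) at_top \<and> ((\<lambda>t. norm (w t)) \<longlongrightarrow> 0) at_top) \<or>
        (\<exists>z_inf. (z \<longlongrightarrow> z_inf) at_top \<and>
          ereal (\<kappa> + exp z_inf)
            < Limsup ess_at_top (\<lambda>t. ereal (max (1 / p * norm (\<theta>1 t)) \<bar>\<theta>2 t\<bar>))))"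
proof -
  \<comment> \<open>Only the pointwise growth bound of \<open>L\<close> enters the estimates, so its
    value along the solution is treated as one more function of time.\<close>
  define v where "v = (\<lambda>t. L (w t) (y t))"
  interpret cl: closed_loop p \<epsilon> \<Gamma> \<kappa> a C \<phi> P1 P2 P3 "\<lambda>t. norm (w t)" "\<lambda>t. norm (\<theta>1 t)"
    "\<lambda>t. norm (\<delta> t)" y z d \<theta>2 b v
  proof (unfold_locales; (rule p constants \<phi> P1 P2 P3 w_reg(2) y_reg z_reg norm_ge_zero)?)
    show "continuous_on {0..} (\<lambda>t. norm (w t))" by (intro continuous_intros w_reg)
    show "AE t in lebesgue. 0 \<le> t \<longrightarrow>
      (\<exists>D. ((\<lambda>t. (norm (w t))\<^sup>2) has_real_derivative D) (at t within {0..}) \<and>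
        D \<le> 2 * (- p * pi\<^sup>2 * (norm (w t))\<^sup>2 + \<bar>y t\<bar> * norm (w t) * norm (\<theta>1 t)
          + norm (w t) * norm (\<delta> t)))"
      using w_eq unfolding AE_halfline
    proof (eventually_elim, intro impI)
      fix t assume *: "0 \<le> t \<longrightarrow> w t \<in> H2 \<inter> H10 \<and>
        (\<exists>wt. (w has_vector_derivative wt) (at t within {0..}) \<and>
        (AE x in unit_meas. rep_L2 wt x =
          p * rep_L2 (weak_deriv (weak_deriv (w t))) x
          + rep_L2 (\<theta>1 t) x * K x (y t) + rep_L2 (\<delta> t) x))" and t: "0 \<le> t"
      then obtain wt where wt: "w t \<in> H2 \<inter> H10" "(w has_vector_derivative wt) (at t within {0..})"
        "AE x in unit_meas. rep_L2 wt x =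
          p * rep_L2 (weak_deriv (weak_deriv (w t))) x
          + rep_L2 (\<theta>1 t) x * K x (y t) + rep_L2 (\<delta> t) x" by blast
      have "((\<lambda>t. inner (w t) (w t)) has_real_derivative 2 * inner (w t) wt) (at t within {0..})"
        using bounded_bilinear.has_vector_derivative[OF bounded_bilinear_inner wt(2) wt(2)]
        by (simp add: has_real_derivative_iff_has_vector_derivative inner_commute)
      then have "((\<lambda>t. (norm (w t))\<^sup>2) has_real_derivative 2 * inner (w t) wt) (at t within {0..})"
        by (simp add: power2_norm_eq_inner)
      moreover have "inner (w t) wt \<le> - p * pi\<^sup>2 * (norm (w t))\<^sup>2
          + \<bar>y t\<bar> * norm (w t) * norm (\<theta>1 t) + norm (w t) * norm (\<delta> t)"
        using p by (intro heat_energy_estimate[OF wt(1) _ wt(3)] K) auto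
      ultimately show "\<exists>D. ((\<lambda>t. (norm (w t))\<^sup>2) has_real_derivative D) (at t within {0..}) \<and>
        D \<le> 2 * (- p * pi\<^sup>2 * (norm (w t))\<^sup>2 + \<bar>y t\<bar> * norm (w t) * norm (\<theta>1 t)
          + norm (w t) * norm (\<delta> t))"
        by (intro exI[of _ "2 * inner (w t) wt"] conjI) auto
    qed
    show "AE t in lebesgue. 0 \<le> t \<longrightarrow>
      (y has_real_derivative
        b t * - ((\<kappa> + exp (z t))^7 * (P1 (y t) + P2 (y t) * (y t)^2 + P3 (y t) * (y t)^6) * y t)
        + \<theta>2 t * v t + d t) (at t within {0..}) \<and> \<bar>v t\<bar> \<le> norm (w t) + \<phi> (y t) * \<bar>y t\<bar>"
      using y_eq w_eq unfolding AE_halfline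
      by eventually_elim (auto simp: u_eq v_def intro!: L)
    show "AE t in lebesgue. 0 \<le> t \<longrightarrow>
      (z has_real_derivative \<Gamma> * exp (- z t) * max (1/2 * (y t)^2 - \<epsilon>) 0) (at t within {0..})"
      using z_eq unfolding AE_halfline .
  qed

  \<comment> \<open>The excesses of \<open>\<theta>2\<close>, of \<open>\<theta>1\<close> scaled by
    \<open>R\<close>, and of \<open>1 / \<beta>\<close> over the initial gain. Their squares are the
    values of \<open>g\<close> in \<open>Z\<close> and \<open>B\<close>.\<close>
  define s r h where "s = max (Linf_norm \<theta>2 - \<kappa> - exp (z 0)) 0"
    and "r = max (R * Linf_norm \<theta>1 - \<kappa> - exp (z 0)) 0"
    and "h = max (1 / \<beta> - \<kappa> - exp (z 0)) 0"
  have E0: "cl.E 0 = exp (z 0)" by (simp add: cl.E_def)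
  have \<beta>: "\<beta> > 0" and b_ge: "AE t in lebesgue. 0 \<le> t \<longrightarrow> \<beta> \<le> b t"
    using essinf_halfline_bound[OF inputs(5) b_pos(2)] by (simp_all add: \<beta>_def)
  have "1 = \<beta> * (1 / \<beta>)" using \<beta> by simp
  also have "\<dots> \<le> \<beta> * (\<kappa> + cl.E 0 + h)"
    using \<beta> unfolding h_def E0 by (intro mult_left_mono) (auto simp: max_def)
  finally have h: "1 \<le> \<beta> * (\<kappa> + cl.E 0 + h)" .
  have bounds: "AE t in lebesgue. 0 \<le> t \<longrightarrow> \<beta> \<le> b t \<and> \<bar>\<theta>2 t\<bar> \<le> \<kappa> + cl.E 0 + s \<and>
      norm (\<theta>1 t) / p \<le> \<kappa> + cl.E 0 + r \<and> \<bar>d t\<bar> \<le> Linf_norm d \<and> norm (\<delta> t) \<le> Linf_norm \<delta>"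
    using b_ge L_infinity_bound(1)[OF inputs(1)] L_infinity_bound(1)[OF inputs(2)]
      L_infinity_bound(1)[OF inputs(3)] L_infinity_bound(1)[OF inputs(4)]
  proof (eventually_elim, intro impI)
    fix t assume *: "0 \<le> t \<longrightarrow> \<beta> \<le> b t" "0 \<le> t \<longrightarrow> norm (d t) \<le> Linf_norm d"
      "0 \<le> t \<longrightarrow> norm (\<theta>1 t) \<le> Linf_norm \<theta>1" "0 \<le> t \<longrightarrow> norm (\<theta>2 t) \<le> Linf_norm \<theta>2"
      "0 \<le> t \<longrightarrow> norm (\<delta> t) \<le> Linf_norm \<delta>" and t: "0 \<le> t"
    have "norm (\<theta>1 t) / p \<le> R * Linf_norm \<theta>1"
      using *(3) t p by (simp add: R_def divide_right_mono)
    then have "norm (\<theta>1 t) / p \<le> \<kappa> + cl.E 0 + r" unfolding r_def E0 by linarith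
    moreover have "\<bar>\<theta>2 t\<bar> \<le> \<kappa> + cl.E 0 + s" using *(4) t unfolding s_def E0 real_norm_def by linarith
    ultimately show "\<beta> \<le> b t \<and> \<bar>\<theta>2 t\<bar> \<le> \<kappa> + cl.E 0 + s \<and>
      norm (\<theta>1 t) / p \<le> \<kappa> + cl.E 0 + r \<and> \<bar>d t\<bar> \<le> Linf_norm d \<and> norm (\<delta> t) \<le> Linf_norm \<delta>"
      using * t by simp
  qed
  have s0: "s \<ge> 0" and r0: "r \<ge> 0" by (simp_all add: s_def r_def)
  have G: "cl.G = G" by (simp add: cl.G_def G_def)
  have \<mu>: "cl.\<mu> = \<mu>" using p by (simp add: cl.\<mu>_def \<mu>_def k_def field_simps)
  have sq: "s\<^sup>2 = g (Linf_norm \<theta>2) (z 0)" "r\<^sup>2 = g (R * Linf_norm \<theta>1) (z 0)" "h\<^sup>2 = g (1 / \<beta>) (z 0)"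
    by (simp_all add: s_def r_def h_def g_def)
  have Z: "G * (Linf_norm \<delta>)\<^sup>2 + a / (\<kappa> + cl.E 0) *
      ((Linf_norm d)\<^sup>2 + s\<^sup>2 + (s\<^sup>2)\<^sup>2 + 4 * \<beta> * h\<^sup>2 + (r\<^sup>2)\<^sup>2) = Z"
    unfolding sq E0 Z_def by simp
  have B: "p * (cl.W 0 + Z / \<mu>) + s\<^sup>2 + (Linf_norm d)\<^sup>2 + (s\<^sup>2)\<^sup>2 + 2 * \<beta> * h\<^sup>2 = B"
    unfolding sq B_def using p by (simp add: cl.W_def cl.X_def k_def)
  note global = cl.global_bounds[OF \<beta> h s0 r0 L_infinity_bound(2)[OF inputs(1)]
      L_infinity_bound(2)[OF inputs(4)] bounds, unfolded G \<mu> Z B]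
  have W: "2 * k1 * (norm (w t))\<^sup>2 + \<bar>y t\<bar>\<^sup>2 = 2 * cl.W t"
    "2 * k2 * (norm (w t))\<^sup>2 + \<bar>y t\<bar>\<^sup>2 = 2 * cl.W t" for t
    by (simp_all add: cl.W_def cl.X_def k_def)
  have state: "2 * k1 * (norm (w t))\<^sup>2 + \<bar>y t\<bar>\<^sup>2
      \<le> exp (- \<mu> * t) * (2 * k2 * (norm (w 0))\<^sup>2 + \<bar>y 0\<bar>\<^sup>2) + 2 * (1 / \<mu>) * Z"
    if "t \<ge> 0" for t
  proof -
    have "2 * cl.W t \<le> 2 * (exp (- \<mu> * t) * cl.W 0 + Z / \<mu>)"
      using global(1)[OF that] by (rule mult_left_mono) simp
    then show ?thesis unfolding W by simp
  qed
  have z_ge: "z 0 \<le> z t" if "t \<ge> 0" for t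
    using cl.E_mono[OF order_refl that] by (simp add: cl.E_def)
  have z_le: "z t \<le> ln (exp (z 0) + \<Gamma> / (4 * C) * \<bar>y 0\<bar>\<^sup>2
      + a * B * ((2 * C * (1 + exp (z 0)) + \<epsilon> * \<Gamma>)
        / (4 * C\<^sup>2 * \<epsilon> * min 1 \<kappa> * (1 + exp (z 0)))))" if "t \<ge> 0" for t
  proof -
    have "exp (z t) \<le> exp (z 0) + \<Gamma> / (4 * C) * \<bar>y 0\<bar>\<^sup>2
      + a * B * ((2 * C * (1 + exp (z 0)) + \<epsilon> * \<Gamma>)
        / (4 * C\<^sup>2 * \<epsilon> * min 1 \<kappa> * (1 + exp (z 0))))"
      using global(2)[OF that] by (simp add: cl.E_def cl.X_def mult_ac)
    then show ?thesis by (subst ln_ge_iff) (auto intro: less_le_trans[OF exp_gt_zero])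
  qed
  define \<Theta> \<Delta> where "\<Theta> = real_of_ereal (Limsup ess_at_top (\<lambda>t. ereal (norm (\<theta>1 t))))"
    and "\<Delta> = real_of_ereal (Limsup ess_at_top (\<lambda>t. ereal (norm (\<delta> t))))"
  note \<Theta> = real_Limsup_bound[OF ess_at_top_neq_bot norm_ge_zero
      AE_halfline_imp_ess[OF L_infinity_bound(1)[OF inputs(2)]], folded \<Theta>_def]
  note \<Delta> = real_Limsup_bound[OF ess_at_top_neq_bot norm_ge_zero
      AE_halfline_imp_ess[OF L_infinity_bound(1)[OF inputs(4)]], folded \<Delta>_def]
  have "Limsup at_top (\<lambda>t. ereal (norm (w t)))
      \<le> ereal (sqrt (2 * \<epsilon> * (\<Theta> / p)\<^sup>2 + cl.G * \<Delta>\<^sup>2))"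
    by (rule cl.Limsup_n_le[OF global(3) \<Theta> \<Delta>])
  moreover have "2 * \<epsilon> * (\<Theta> / p)\<^sup>2 + cl.G * \<Delta>\<^sup>2 = k2 / k1 * (2 * \<epsilon> * R\<^sup>2 * \<Theta>\<^sup>2 + G * \<Delta>\<^sup>2)"
    using p by (simp add: k_def G R_def power_divide)
  ultimately have limsup_w: "Limsup at_top (\<lambda>t. ereal (norm (w t)))
      \<le> ereal (sqrt (k2 / k1 * (2 * \<epsilon> * R\<^sup>2 * \<Theta>\<^sup>2 + G * \<Delta>\<^sup>2)))" by simp
  have limsup_y: "Limsup at_top (\<lambda>t. ereal \<bar>y t\<bar>) \<le> ereal (sqrt (2 * \<epsilon>))"
    by (rule cl.Limsup_y_le[OF global(3)])
  obtain l where l: "(cl.E \<longlongrightarrow> l) at_top" "l > 0" using global(4) by blast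
  have z_lim: "(z \<longlongrightarrow> ln l) at_top"
    using tendsto_ln[OF l(1)] l(2) by (simp add: cl.E_def)
  have dichotomy: "(((\<lambda>t. \<bar>y t\<bar>) \<longlongrightarrow> 0) at_top \<and> ((\<lambda>t. norm (w t)) \<longlongrightarrow> 0) at_top) \<or>
        (\<exists>z_inf. (z \<longlongrightarrow> z_inf) at_top \<and>
          ereal (\<kappa> + exp z_inf)
            < Limsup ess_at_top (\<lambda>t. ereal (max (1 / p * norm (\<theta>1 t)) \<bar>\<theta>2 t\<bar>)))"
    if d0: "(d \<longlongrightarrow> 0) ess_at_top" and \<delta>0: "(\<delta> \<longlongrightarrow> 0) ess_at_top"
      and b0: "Liminf ess_at_top (\<lambda>t. ereal (b t)) \<ge> ereal (1 / \<kappa>)"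
  proof (cases "ereal (\<kappa> + exp (ln l)) < Limsup ess_at_top (\<lambda>t. ereal (max (1 / p * norm (\<theta>1 t)) \<bar>\<theta>2 t\<bar>))")
    case True
    then show ?thesis using z_lim by blast
  next
    case False
    then have le: "Limsup ess_at_top (\<lambda>t. ereal (max (1 / p * norm (\<theta>1 t)) \<bar>\<theta>2 t\<bar>)) \<le> ereal (\<kappa> + l)"
      using l(2) by (simp add: not_less)
    \<comment> \<open>A lower limit of at least \<open>1 / \<kappa>\<close> ensures
      \<open>b t > c\<close> eventually only for \<open>c\<close> strictly below
      \<open>1 / \<kappa>\<close>. Since \<open>E 0 > 0\<close>, this value is strictly below, yet
      large enough that the initial gain has no deficit.\<close>
    define \<beta>' where "\<beta>' = 1 / (\<kappa> + cl.E 0)"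
    have \<beta>': "\<beta>' > 0" "1 \<le> \<beta>' * (\<kappa> + cl.E 0)" "\<beta>' < 1 / \<kappa>"
      using constants(3) cl.E_pos[of 0] by (auto simp: \<beta>'_def add_pos_pos intro!: divide_strict_left_mono)
    have "(cl.W \<longlongrightarrow> 0) at_top"
    proof (rule cl.tendsto_zero[OF l(1) \<beta>'(1,2)])
      have "ereal \<beta>' < ereal (1 / \<kappa>)" using \<beta>' by simp
      then have "\<forall>\<^sub>F t in ess_at_top. ereal \<beta>' < ereal (b t)" using b0 unfolding le_Liminf_iff by blast
      then show "\<forall>\<^sub>F t in ess_at_top. \<beta>' \<le> b t" by eventually_elim simp
    next
      fix e :: real assume e: "e > 0"
      have "ereal (\<kappa> + l) < ereal (\<kappa> + l + e)" using e by simp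
      then have "\<forall>\<^sub>F t in ess_at_top. ereal (max (1 / p * norm (\<theta>1 t)) \<bar>\<theta>2 t\<bar>) < ereal (\<kappa> + l + e)"
        using le unfolding Limsup_le_iff by blast
      then show "\<forall>\<^sub>F t in ess_at_top. norm (\<theta>1 t) / p \<le> \<kappa> + l + e \<and> \<bar>\<theta>2 t\<bar> \<le> \<kappa> + l + e"
        by eventually_elim simp
      show "\<forall>\<^sub>F t in ess_at_top. \<bar>d t\<bar> \<le> e \<and> norm (\<delta> t) \<le> e"
        using tendstoD[OF d0 e] tendstoD[OF \<delta>0 e] by eventually_elim (simp add: dist_norm)
    qed
    from cl.tendsto_zero_components[OF this] show ?thesis by blast
  qed
  show ?thesis
    using state z_ge z_le limsup_w limsup_y dichotomy unfolding \<Theta>_def \<Delta>_def by blast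
qed

end
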